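(* Let $R$ be a commutative ring and $S\subset R$ a countable multiplicative subset. Then a flat $R$-module $F$ is $S$-strongly flat if and only if the $R/sR$-module $F/sF$ is projective for every $s\in S$ and the $S^{-1}R$-module $S^{-1}F$ is projective.
   Context: Multiplicative subsets may contain zero-divisors; "countable" means at most countable. For a commutative ring $R$ and a multiplicative subset $S\subset R$: $S^{-1}R$ is the localization and $S^{-1}F=S^{-1}R\otimes_R F$ for an $R$-module $F$. An $R$-module $C$ is called $S$-weakly cotorsion if $\operatorname{Ext}^1_R(S^{-1}R,C)=0$. An $R$-module $F$ is called $S$-strongly flat if $\operatorname{Ext}^1_R(F,C)=0$ for every $S$-weakly cotorsion $R$-module $C$. *)

theory Defs
  imports "HOL-Algebra.QuotRing" "HOL-Algebra.Module" "HOL-Library.Countable_Set"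
begin

text \<open>
  Modules are the records of \<^theory>\<open>HOL-Algebra.Module\<close>; their \<^const>\<open>mult\<close> and \<^const>\<open>one\<close>
  fields play no role in this theory.

  Notions that quantify over all modules (flat, projective, strongly flat) take an argument
  of type \<open>'u itself\<close>: the modules quantified over are those whose carrier is a set of
  elements of \<open>'u\<close>. The type \<open>'u\<close> plays the role of a universe. For a module with
  carrier type \<open>'f\<close> over a ring with carrier type \<open>'r\<close>, an injection
  \<open>('r + 'f + nat) set \<Rightarrow> 'u\<close> ensures that \<open>'u\<close> is large enough for these notions not to depend
  on it: it contains copies of the ideals (to test flatness), of free covers (to test
  projectivity), and of the weakly cotorsion modules that detect strong flatness over a
  countable multiplicative subset, whose cardinality is at most
  \<open>(|'r| + |'f| + \<aleph>\<^sub>0)\<close> to the power \<open>\<aleph>\<^sub>0\<close>.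
\<close>

definition mod_hom ::
  "('r, 'k) ring_scheme \<Rightarrow> ('r, 'm) module \<Rightarrow> ('r, 'n) module \<Rightarrow> ('m \<Rightarrow> 'n) set" where
  "mod_hom R M N = {f \<in> carrier M \<rightarrow> carrier N.
     (\<forall>x\<in>carrier M. \<forall>y\<in>carrier M. f (x \<oplus>\<^bsub>M\<^esub> y) = f x \<oplus>\<^bsub>N\<^esub> f y) \<and>
     (\<forall>a\<in>carrier R. \<forall>x\<in>carrier M. f (a \<odot>\<^bsub>M\<^esub> x) = a \<odot>\<^bsub>N\<^esub> f x)}"

text \<open>
  \<^const>\<open>extensional\<close> makes equality of elements of the Hom module equality of maps on
  \<open>carrier M\<close>.
\<close>

definition Hom_mod ::
  "('r, 'k) ring_scheme \<Rightarrow> ('r, 'm) module \<Rightarrow> ('r, 'n) module \<Rightarrow> ('r, 'm \<Rightarrow> 'n) module" where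
  "Hom_mod R M N =
    \<lparr>carrier = mod_hom R M N \<inter> extensional (carrier M), mult = undefined, one = undefined,
     zero = (\<lambda>x\<in>carrier M. \<zero>\<^bsub>N\<^esub>),
     add = (\<lambda>f g. \<lambda>x\<in>carrier M. f x \<oplus>\<^bsub>N\<^esub> g x),
     smult = (\<lambda>a f. \<lambda>x\<in>carrier M. a \<odot>\<^bsub>N\<^esub> f x)\<rparr>"

definition quot_mod :: "('r, 'm) module \<Rightarrow> 'm set \<Rightarrow> ('r, 'm set) module" where
  "quot_mod M N =
    \<lparr>carrier = a_rcosets\<^bsub>M\<^esub> N, mult = undefined, one = undefined, zero = N, add = set_add M,
     smult = (\<lambda>a X. \<Union>x\<in>X. N +>\<^bsub>M\<^esub> (a \<odot>\<^bsub>M\<^esub> x))\<rparr>"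

definition submod_span ::
  "('r, 'k) ring_scheme \<Rightarrow> ('r, 'm) module \<Rightarrow> 'm set \<Rightarrow> 'm set" where
  "submod_span R M A = \<Inter>{N. submodule N R M \<and> A \<subseteq> N}"

definition free_mod :: "('r, 'k) ring_scheme \<Rightarrow> 'a set \<Rightarrow> ('r, 'a \<Rightarrow> 'r) module" where
  "free_mod R A =
    \<lparr>carrier = {\<phi>. (\<forall>x\<in>A. \<phi> x \<in> carrier R) \<and> (\<forall>x. x \<notin> A \<longrightarrow> \<phi> x = \<zero>\<^bsub>R\<^esub>) \<and> finite {x. \<phi> x \<noteq> \<zero>\<^bsub>R\<^esub>}},
     mult = undefined, one = undefined, zero = (\<lambda>x. \<zero>\<^bsub>R\<^esub>),
     add = (\<lambda>\<phi> \<psi> x. \<phi> x \<oplus>\<^bsub>R\<^esub> \<psi> x),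
     smult = (\<lambda>a \<phi> x. a \<otimes>\<^bsub>R\<^esub> \<phi> x)\<rparr>"

definition free_basis :: "('r, 'k) ring_scheme \<Rightarrow> 'a \<Rightarrow> 'a \<Rightarrow> 'r" where
  "free_basis R a = (\<lambda>x. if x = a then \<one>\<^bsub>R\<^esub> else \<zero>\<^bsub>R\<^esub>)"

text \<open>The linear map from a free module to \<open>M\<close> given on the basis by \<open>f\<close>.\<close>

definition lin_ext ::
  "('r, 'k) ring_scheme \<Rightarrow> ('r, 'm) module \<Rightarrow> ('a \<Rightarrow> 'm) \<Rightarrow> ('a \<Rightarrow> 'r) \<Rightarrow> 'm" where
  "lin_ext R M f \<phi> = (\<Oplus>\<^bsub>M\<^esub>x\<in>{x. \<phi> x \<noteq> \<zero>\<^bsub>R\<^esub>}. \<phi> x \<odot>\<^bsub>M\<^esub> f x)"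

text \<open>
  The standard free resolution
  \<open>\<cdots> \<rightarrow> free_cover (syz (syz M)) \<rightarrow> free_cover (syz M) \<rightarrow> free_cover M \<rightarrow> M \<rightarrow> 0\<close>:
  each term is free on the underlying set of the kernel of the preceding map. As \<open>syz M\<close> has
  the operations of \<open>free_cover M\<close>, the map \<open>cover_map R (syz R M)\<close> is also the differential
  into \<open>free_cover M\<close>.
\<close>

definition free_cover :: "('r, 'k) ring_scheme \<Rightarrow> ('r, 'm) module \<Rightarrow> ('r, 'm \<Rightarrow> 'r) module" where
  "free_cover R M = free_mod R (carrier M)"

definition cover_map :: "('r, 'k) ring_scheme \<Rightarrow> ('r, 'm) module \<Rightarrow> ('m \<Rightarrow> 'r) \<Rightarrow> 'm" where
  "cover_map R M = lin_ext R M (\<lambda>x. x)"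

definition syz :: "('r, 'k) ring_scheme \<Rightarrow> ('r, 'm) module \<Rightarrow> ('r, 'm \<Rightarrow> 'r) module" where
  "syz R M = (free_cover R M)\<lparr>carrier := a_kernel (free_cover R M) M (cover_map R M)\<rparr>"

text \<open>
  \<open>Ext\<^sup>1(M, C)\<close> is the cohomology at \<open>Hom(P\<^sub>1, C)\<close> of the complex
  \<open>Hom(P\<^sub>0, C) \<rightarrow> Hom(P\<^sub>1, C) \<rightarrow> Hom(P\<^sub>2, C)\<close>, where \<open>P\<^sub>0, P\<^sub>1, P\<^sub>2\<close> are the free modules above.
\<close>

definition Ext1 ::
  "('r, 'k) ring_scheme \<Rightarrow> ('r, 'm) module \<Rightarrow> ('r, 'c) module
    \<Rightarrow> ('r, ((('m \<Rightarrow> 'r) \<Rightarrow> 'r) \<Rightarrow> 'c) set) module" where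
  "Ext1 R M C =
    (let P0 = free_cover R M;
         P1 = free_cover R (syz R M);
         P2 = free_cover R (syz R (syz R M));
         d1 = cover_map R (syz R M);
         d2 = cover_map R (syz R (syz R M));
         pull1 = (\<lambda>f. compose (carrier P1) f d1);
         pull2 = (\<lambda>f. compose (carrier P2) f d2);
         Z = a_kernel (Hom_mod R P1 C) (Hom_mod R P2 C) pull2;
         B = pull1 ` carrier (Hom_mod R P0 C)
     in quot_mod ((Hom_mod R P1 C)\<lparr>carrier := Z\<rparr>) B)"

definition Ext1_vanishes :: "('r, 'k) ring_scheme \<Rightarrow> ('r, 'm) module \<Rightarrow> ('r, 'c) module \<Rightarrow> bool" where
  "Ext1_vanishes R M C \<longleftrightarrow> carrier (Ext1 R M C) = {\<zero>\<^bsub>Ext1 R M C\<^esub>}"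

definition tensor_rels ::
  "('r, 'k) ring_scheme \<Rightarrow> ('r, 'm) module \<Rightarrow> ('r, 'n) module \<Rightarrow> ('m \<times> 'n \<Rightarrow> 'r) set" where
  "tensor_rels R M N =
    (let T = free_mod R (carrier M \<times> carrier N); e = (\<lambda>x y. free_basis R (x, y))
     in submod_span R T
      ({e (x \<oplus>\<^bsub>M\<^esub> x') y \<ominus>\<^bsub>T\<^esub> (e x y \<oplus>\<^bsub>T\<^esub> e x' y) | x x' y.
          x \<in> carrier M \<and> x' \<in> carrier M \<and> y \<in> carrier N} \<union>
       {e x (y \<oplus>\<^bsub>N\<^esub> y') \<ominus>\<^bsub>T\<^esub> (e x y \<oplus>\<^bsub>T\<^esub> e x y') | x y y'.
          x \<in> carrier M \<and> y \<in> carrier N \<and> y' \<in> carrier N} \<union>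
       {e (a \<odot>\<^bsub>M\<^esub> x) y \<ominus>\<^bsub>T\<^esub> a \<odot>\<^bsub>T\<^esub> e x y | a x y.
          a \<in> carrier R \<and> x \<in> carrier M \<and> y \<in> carrier N} \<union>
       {e x (a \<odot>\<^bsub>N\<^esub> y) \<ominus>\<^bsub>T\<^esub> a \<odot>\<^bsub>T\<^esub> e x y | a x y.
          a \<in> carrier R \<and> x \<in> carrier M \<and> y \<in> carrier N}))"

definition tensor ::
  "('r, 'k) ring_scheme \<Rightarrow> ('r, 'm) module \<Rightarrow> ('r, 'n) module
    \<Rightarrow> ('r, ('m \<times> 'n \<Rightarrow> 'r) set) module" where
  "tensor R M N = quot_mod (free_mod R (carrier M \<times> carrier N)) (tensor_rels R M N)"

definition pure_tensor ::
  "('r, 'k) ring_scheme \<Rightarrow> ('r, 'm) module \<Rightarrow> ('r, 'n) module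
    \<Rightarrow> 'm \<Rightarrow> 'n \<Rightarrow> ('m \<times> 'n \<Rightarrow> 'r) set" where
  "pure_tensor R M N x y =
    tensor_rels R M N +>\<^bsub>free_mod R (carrier M \<times> carrier N)\<^esub> free_basis R (x, y)"

text \<open>
  The map \<open>f \<otimes> id : M \<otimes> F \<rightarrow> N \<otimes> F\<close>, for linear \<open>f : M \<rightarrow> N\<close>. A representative of a class
  \<open>X\<close> in \<open>M \<otimes> F\<close> is a formal linear combination of pairs \<open>(x, y)\<close>; replacing each
  \<open>(x, y)\<close> by \<open>f x \<otimes> y\<close> gives an element of \<open>N \<otimes> F\<close> that does not depend on the representative.
\<close>

definition tensor_map ::
  "('r, 'k) ring_scheme \<Rightarrow> ('r, 'f) module \<Rightarrow> ('r, 'n) module \<Rightarrow> ('m \<Rightarrow> 'n)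
    \<Rightarrow> ('m \<times> 'f \<Rightarrow> 'r) set \<Rightarrow> ('n \<times> 'f \<Rightarrow> 'r) set" where
  "tensor_map R F N f X =
    the_elem (lin_ext R (tensor R N F) (\<lambda>(x, y). pure_tensor R N F (f x) y) ` X)"

definition flat_mod :: "('r, 'k) ring_scheme \<Rightarrow> ('r, 'f) module \<Rightarrow> 'u itself \<Rightarrow> bool" where
  "flat_mod R F (U :: 'u itself) \<longleftrightarrow> module R F \<and>
    (\<forall>(M :: ('r, 'u) module) (N :: ('r, 'u) module) f.
       module R M \<longrightarrow> module R N \<longrightarrow> f \<in> mod_hom R M N \<longrightarrow> inj_on f (carrier M) \<longrightarrow>
       inj_on (tensor_map R F N f) (carrier (tensor R M F)))"

definition projective_mod :: "('r, 'k) ring_scheme \<Rightarrow> ('r, 'p) module \<Rightarrow> 'u itself \<Rightarrow> bool" where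
  "projective_mod R P (U :: 'u itself) \<longleftrightarrow> module R P \<and>
    (\<forall>(M :: ('r, 'u) module) (N :: ('r, 'u) module) g f.
       module R M \<longrightarrow> module R N \<longrightarrow> g \<in> mod_hom R M N \<longrightarrow> g ` carrier M = carrier N \<longrightarrow>
       f \<in> mod_hom R P N \<longrightarrow>
       (\<exists>h\<in>mod_hom R P M. \<forall>x\<in>carrier P. g (h x) = f x))"

text \<open>
  The fraction \<open>a/s\<close> is the set of all pairs \<open>(b, t)\<close> with \<open>u(at - bs) = 0\<close> for some
  \<open>u \<in> S\<close>; zero-divisors, and zero, are allowed in \<open>S\<close>.
\<close>

definition loc_frac :: "('r, 'k) ring_scheme \<Rightarrow> 'r set \<Rightarrow> 'r \<Rightarrow> 'r \<Rightarrow> ('r \<times> 'r) set" where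
  "loc_frac R S a s = {(b, t). b \<in> carrier R \<and> t \<in> S \<and>
     (\<exists>u\<in>S. u \<otimes>\<^bsub>R\<^esub> (a \<otimes>\<^bsub>R\<^esub> t \<ominus>\<^bsub>R\<^esub> b \<otimes>\<^bsub>R\<^esub> s) = \<zero>\<^bsub>R\<^esub>)}"

definition loc_ring :: "('r, 'k) ring_scheme \<Rightarrow> 'r set \<Rightarrow> ('r \<times> 'r) set ring" where
  "loc_ring R S =
    \<lparr>carrier = {loc_frac R S a s | a s. a \<in> carrier R \<and> s \<in> S},
     mult = (\<lambda>X Y. \<Union>(a, s)\<in>X. \<Union>(b, t)\<in>Y. loc_frac R S (a \<otimes>\<^bsub>R\<^esub> b) (s \<otimes>\<^bsub>R\<^esub> t)),
     one = loc_frac R S \<one>\<^bsub>R\<^esub> \<one>\<^bsub>R\<^esub>,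
     zero = loc_frac R S \<zero>\<^bsub>R\<^esub> \<one>\<^bsub>R\<^esub>,
     add = (\<lambda>X Y. \<Union>(a, s)\<in>X. \<Union>(b, t)\<in>Y.
              loc_frac R S (a \<otimes>\<^bsub>R\<^esub> t \<oplus>\<^bsub>R\<^esub> b \<otimes>\<^bsub>R\<^esub> s) (s \<otimes>\<^bsub>R\<^esub> t))\<rparr>"

definition loc_ring_mod :: "('r, 'k) ring_scheme \<Rightarrow> 'r set \<Rightarrow> ('r, ('r \<times> 'r) set) module" where
  "loc_ring_mod R S =
    \<lparr>carrier = carrier (loc_ring R S), mult = mult (loc_ring R S), one = one (loc_ring R S),
     zero = zero (loc_ring R S), add = add (loc_ring R S),
     smult = (\<lambda>r X. \<Union>(a, s)\<in>X. loc_frac R S (r \<otimes>\<^bsub>R\<^esub> a) s)\<rparr>"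

text \<open>
  The tensor product over \<open>R\<close> of the localized ring with \<open>F\<close>, as a module over the localized
  ring, which acts on the first factor.
\<close>

definition loc_mod ::
  "('r, 'k) ring_scheme \<Rightarrow> 'r set \<Rightarrow> ('r, 'f) module
    \<Rightarrow> (('r \<times> 'r) set, (('r \<times> 'r) set \<times> 'f \<Rightarrow> 'r) set) module" where
  "loc_mod R S F =
    (let T = tensor R (loc_ring_mod R S) F
     in \<lparr>carrier = carrier T, mult = undefined, one = undefined, zero = zero T, add = add T,
         smult = (\<lambda>q. tensor_map R F (loc_ring_mod R S) (\<lambda>p. q \<otimes>\<^bsub>loc_ring R S\<^esub> p))\<rparr>)"

text \<open>\<open>F/sF\<close>, with scalars in the quotient ring \<open>R Quot (PIdl\<^bsub>R\<^esub> s)\<close>, i.e. cosets.\<close>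

definition red_mod ::
  "('r, 'k) ring_scheme \<Rightarrow> ('r, 'f) module \<Rightarrow> 'r \<Rightarrow> ('r set, 'f set) module" where
  "red_mod R F s =
    (let sF = (\<lambda>x. s \<odot>\<^bsub>F\<^esub> x) ` carrier F; Q = quot_mod F sF
     in \<lparr>carrier = carrier Q, mult = undefined, one = undefined, zero = zero Q, add = add Q,
         smult = (\<lambda>A X. \<Union>a\<in>A. \<Union>x\<in>X. sF +>\<^bsub>F\<^esub> (a \<odot>\<^bsub>F\<^esub> x))\<rparr>)"

definition weakly_cotorsion :: "('r, 'k) ring_scheme \<Rightarrow> 'r set \<Rightarrow> ('r, 'c) module \<Rightarrow> bool" where
  "weakly_cotorsion R S C \<longleftrightarrow> module R C \<and> Ext1_vanishes R (loc_ring_mod R S) C"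

definition strongly_flat ::
  "('r, 'k) ring_scheme \<Rightarrow> 'r set \<Rightarrow> ('r, 'f) module \<Rightarrow> 'u itself \<Rightarrow> bool" where
  "strongly_flat R S F (U :: 'u itself) \<longleftrightarrow> module R F \<and>
    (\<forall>C :: ('r, 'u) module. weakly_cotorsion R S C \<longrightarrow> Ext1_vanishes R F C)"

end

theory Submission
  imports Defs
begin

text \<open>
  Let \<open>0 \<rightarrow> K \<rightarrow> P \<rightarrow> F \<rightarrow> 0\<close> be exact with \<open>P\<close> free, and let \<open>s\<^sub>0, s\<^sub>1, \<dots>\<close> be a sequence in \<open>S\<close> in which
  every element of \<open>S\<close> occurs infinitely often. The ring \<open>S\<^sup>-\<^sup>1R\<close> is the direct limit of
  \<open>R \<rightarrow> R \<rightarrow> R \<rightarrow> \<cdots>\<close> with the maps \<open>s\<^sub>0, s\<^sub>1, \<dots>\<close>; from the resulting resolution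
  \<open>0 \<rightarrow> \<Oplus>R \<rightarrow> \<Oplus>R \<rightarrow> S\<^sup>-\<^sup>1R \<rightarrow> 0\<close> one sees that \<open>C\<close> is weakly cotorsion if and only if every tower of
  equations \<open>x\<^sub>n = c\<^sub>n + s\<^sub>n x\<^bsub>n+1\<^esub>\<close> is solvable in \<open>C\<close> (\<open>tower_solvable\<close>). Moreover \<open>Ext\<^sup>1(A, C)\<close> vanishes if
  and only if every map from the first syzygy of \<open>A\<close> to \<open>C\<close> extends to the free cover
  (\<open>Ext1_vanishes_iff\<close>).

  Suppose that \<open>F\<close> is strongly flat. In a module over \<open>R/sR\<close> the towers are solvable because
  substituting the equations into each other ends at the next occurrence of \<open>s\<close>, and in a module
  over \<open>S\<^sup>-\<^sup>1R\<close> because one can divide by \<open>s\<^sub>n\<close>. So the kernel of a surjection of modules over either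
  ring is weakly cotorsion over \<open>R\<close>, and a map from \<open>F\<close> lifts along the surjection. By the universal
  properties of \<open>F/sF\<close> and \<open>S\<^sup>-\<^sup>1F\<close> this is their projectivity.

  Conversely, let \<open>F\<close> be flat with projective reductions and localization, let \<open>C\<close> be weakly
  cotorsion and \<open>g : K \<rightarrow> C\<close>. Projectivity of \<open>F/sF\<close> and flatness give maps \<open>r : P \<rightarrow> K\<close> and
  \<open>E : K \<rightarrow> K\<close> with \<open>k = r k + s E k\<close> on \<open>K\<close> (\<open>split_element\<close>): up to a map that extends to \<open>P\<close>, every
  map \<open>g\<close> on \<open>K\<close> is divisible by \<open>s\<close>. Repeating this along the sequence, one writes \<open>g = g\<^sub>0\<close> and
  \<open>g\<^sub>n = f\<^sub>n + s\<^sub>n g\<^bsub>n+1\<^esub>\<close> with \<open>f\<^sub>n\<close> defined on all of \<open>P\<close>. As \<open>C\<close> is weakly cotorsion and \<open>P\<close> is free, there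
  are \<open>y\<^sub>n : P \<rightarrow> C\<close> with \<open>y\<^sub>n = f\<^sub>n + s\<^sub>n y\<^bsub>n+1\<^esub>\<close>, and the differences \<open>w\<^sub>n = g\<^sub>n - y\<^sub>n\<close> satisfy
  \<open>w\<^sub>n = s\<^sub>n w\<^bsub>n+1\<^esub>\<close>. They form a map from \<open>K\<close> into \<open>Hom(S\<^sup>-\<^sup>1R, C)\<close>, which factors through \<open>S\<^sup>-\<^sup>1K\<close>, a direct
  summand of \<open>S\<^sup>-\<^sup>1P\<close>; so \<open>w\<^sub>0\<close> extends to \<open>P\<close> (\<open>extend_compatible_family\<close>), and with it
  \<open>g = w\<^sub>0 + y\<^sub>0\<close>.
\<close>

section \<open>Linear maps\<close>

lemma (in abelian_group) diff_eq_zero_iff: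
  "x \<in> carrier G \<Longrightarrow> y \<in> carrier G \<Longrightarrow> x \<ominus> y = \<zero> \<longleftrightarrow> x = y"
  by (metis a_minus_def add.inv_closed add.inv_equality add.inv_inv r_neg)

lemma mod_homI:
  assumes "\<And>x. x \<in> carrier M \<Longrightarrow> f x \<in> carrier N"
    and "\<And>x y. x \<in> carrier M \<Longrightarrow> y \<in> carrier M \<Longrightarrow> f (x \<oplus>\<^bsub>M\<^esub> y) = f x \<oplus>\<^bsub>N\<^esub> f y"
    and "\<And>a x. a \<in> carrier R \<Longrightarrow> x \<in> carrier M \<Longrightarrow> f (a \<odot>\<^bsub>M\<^esub> x) = a \<odot>\<^bsub>N\<^esub> f x"
  shows "f \<in> mod_hom R M N"
  using assms by (auto simp: mod_hom_def)

lemma mod_hom_closed: "f \<in> mod_hom R M N \<Longrightarrow> x \<in> carrier M \<Longrightarrow> f x \<in> carrier N"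
  and mod_hom_add: "f \<in> mod_hom R M N \<Longrightarrow> x \<in> carrier M \<Longrightarrow> y \<in> carrier M
      \<Longrightarrow> f (x \<oplus>\<^bsub>M\<^esub> y) = f x \<oplus>\<^bsub>N\<^esub> f y"
  and mod_hom_smult: "f \<in> mod_hom R M N \<Longrightarrow> a \<in> carrier R \<Longrightarrow> x \<in> carrier M
      \<Longrightarrow> f (a \<odot>\<^bsub>M\<^esub> x) = a \<odot>\<^bsub>N\<^esub> f x"
  by (auto simp: mod_hom_def)

lemma mod_hom_zero:
  assumes "module R M" "module R N" "f \<in> mod_hom R M N"
  shows "f \<zero>\<^bsub>M\<^esub> = \<zero>\<^bsub>N\<^esub>"
proof -
  interpret M: module R M by fact
  interpret N: module R N by fact
  have "f (\<zero>\<^bsub>R\<^esub> \<odot>\<^bsub>M\<^esub> \<zero>\<^bsub>M\<^esub>) = \<zero>\<^bsub>R\<^esub> \<odot>\<^bsub>N\<^esub> f \<zero>\<^bsub>M\<^esub>"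
    using assms(3) by (intro mod_hom_smult[OF assms(3)]) auto
  then show ?thesis using mod_hom_closed[OF assms(3)] by simp
qed

lemma (in module) neg_eq_smult: "x \<in> carrier M \<Longrightarrow> \<ominus>\<^bsub>M\<^esub> x = (\<ominus> \<one>) \<odot>\<^bsub>M\<^esub> x"
  by (simp add: smult_l_minus)

lemma mod_hom_minus:
  assumes "module R M" "module R N" "f \<in> mod_hom R M N" "x \<in> carrier M" "y \<in> carrier M"
  shows "f (x \<ominus>\<^bsub>M\<^esub> y) = f x \<ominus>\<^bsub>N\<^esub> f y"
proof -
  interpret M: module R M by fact
  interpret N: module R N by fact
  show ?thesis unfolding a_minus_def
    using assms(4,5) mod_hom_closed[OF assms(3)]
    by (simp add: M.neg_eq_smult N.neg_eq_smult mod_hom_add[OF assms(3)] mod_hom_smult[OF assms(3)])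
qed

lemma mod_hom_comp:
  "f \<in> mod_hom R M N \<Longrightarrow> g \<in> mod_hom R N L \<Longrightarrow> (\<lambda>x. g (f x)) \<in> mod_hom R M L"
  by (auto simp: mod_hom_def Pi_iff)

lemma mod_hom_cong:
  assumes "module R M" "f \<in> mod_hom R M N" "\<And>x. x \<in> carrier M \<Longrightarrow> g x = f x"
  shows "g \<in> mod_hom R M N"
proof -
  interpret M: module R M by fact
  show ?thesis using assms(2,3) by (auto simp: mod_hom_def)
qed

lemma mod_hom_plus:
  assumes "module R M" "module R N" "f \<in> mod_hom R M N" "g \<in> mod_hom R M N"
  shows "(\<lambda>x. f x \<oplus>\<^bsub>N\<^esub> g x) \<in> mod_hom R M N"
proof -
  interpret M: module R M by fact
  interpret N: module R N by fact
  show ?thesis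
    using mod_hom_closed[OF assms(3)] mod_hom_closed[OF assms(4)]
    by (intro mod_homI) (auto simp: mod_hom_add[OF assms(3)] mod_hom_add[OF assms(4)]
      mod_hom_smult[OF assms(3)] mod_hom_smult[OF assms(4)] N.a_ac N.smult_r_distr)
qed

lemma mod_hom_scale:
  assumes "module R M" "module R N" "f \<in> mod_hom R M N" "a \<in> carrier R"
  shows "(\<lambda>x. a \<odot>\<^bsub>N\<^esub> f x) \<in> mod_hom R M N"
proof -
  interpret M: module R M by fact
  interpret N: module R N by fact
  show ?thesis
    using mod_hom_closed[OF assms(3)] assms(4)
    by (intro mod_homI) (auto simp: mod_hom_add[OF assms(3)]
      mod_hom_smult[OF assms(3)] N.smult_r_distr N.smult_assoc1[symmetric] M.m_comm)
qed

lemma mod_hom_diff: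
  assumes "module R M" "module R N" "f \<in> mod_hom R M N" "g \<in> mod_hom R M N"
  shows "(\<lambda>x. f x \<ominus>\<^bsub>N\<^esub> g x) \<in> mod_hom R M N"
proof -
  interpret M: module R M by fact
  interpret N: module R N by fact
  have "(\<lambda>x. f x \<oplus>\<^bsub>N\<^esub> (\<ominus>\<^bsub>R\<^esub> \<one>\<^bsub>R\<^esub>) \<odot>\<^bsub>N\<^esub> g x) \<in> mod_hom R M N"
    by (intro mod_hom_plus mod_hom_scale assms) auto
  then show ?thesis
    by (rule mod_hom_cong[OF assms(1)])
      (simp add: a_minus_def N.neg_eq_smult mod_hom_closed[OF assms(4)])
qed

lemma equalizer_submodule:
  assumes "module R M" "module R N" "f \<in> mod_hom R M N" "g \<in> mod_hom R M N"
  shows "submodule {x \<in> carrier M. f x = g x} R M"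
proof -
  interpret M: module R M by fact
  interpret N: module R N by fact
  show ?thesis
    by (intro M.submoduleI)
      (auto simp: mod_hom_zero[OF assms(1,2)] assms(3,4) M.neg_eq_smult
        mod_hom_add[OF assms(3)] mod_hom_add[OF assms(4)]
        mod_hom_smult[OF assms(3)] mod_hom_smult[OF assms(4)])
qed

lemma kernel_submodule:
  assumes "module R M" "module R N" "f \<in> mod_hom R M N"
  shows "submodule {x \<in> carrier M. f x = \<zero>\<^bsub>N\<^esub>} R M"
proof -
  interpret M: module R M by fact
  interpret N: module R N by fact
  have "(\<lambda>x. \<zero>\<^bsub>N\<^esub>) \<in> mod_hom R M N" by (intro mod_homI) auto
  then show ?thesis using equalizer_submodule[OF assms] by simp
qed

lemma range_submodule:
  assumes "module R M" "module R N" "f \<in> mod_hom R M N"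
  shows "submodule (f ` carrier M) R N"
proof -
  interpret M: module R M by fact
  interpret N: module R N by fact
  note z = mod_hom_zero[OF assms]
  have minus: "\<ominus>\<^bsub>N\<^esub> f x \<in> f ` carrier M" if "x \<in> carrier M" for x
    using that mod_hom_minus[OF assms M.zero_closed that] mod_hom_closed[OF assms(3) that]
    by (auto simp: z a_minus_def intro!: image_eqI[of _ _ "\<ominus>\<^bsub>M\<^esub> x"])
  show ?thesis
    by (intro N.submoduleI)
      (auto simp: mod_hom_closed[OF assms(3)] minus z[symmetric]
        mod_hom_add[OF assms(3), symmetric] mod_hom_smult[OF assms(3), symmetric])
qed

lemma submodule_restrict:
  assumes "module R M" "submodule H R M"
  shows "module R (M\<lparr>carrier := H\<rparr>)"
  using submodule.submodule_is_module[OF assms(2,1)] .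

text \<open>
  Most maps below are constructed through choices that cannot be made linearly. It is enough that
  the pairs arising from all the choices form a submodule of \<open>A \<times> C\<close> in which zero is related to
  zero only: the difference of two pairs with the same first entry has first entry zero.
\<close>

lemma linear_relation_hom:
  assumes "module R A" "module R C"
    and closed: "\<And>a c. G a c \<Longrightarrow> a \<in> carrier A \<and> c \<in> carrier C"
    and total: "\<And>a. a \<in> carrier A \<Longrightarrow> \<exists>c. G a c"
    and add: "\<And>a c a' c'. G a c \<Longrightarrow> G a' c' \<Longrightarrow> G (a \<oplus>\<^bsub>A\<^esub> a') (c \<oplus>\<^bsub>C\<^esub> c')"
    and smult: "\<And>r a c. r \<in> carrier R \<Longrightarrow> G a c \<Longrightarrow> G (r \<odot>\<^bsub>A\<^esub> a) (r \<odot>\<^bsub>C\<^esub> c)"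
    and zero: "\<And>c. G \<zero>\<^bsub>A\<^esub> c \<Longrightarrow> c = \<zero>\<^bsub>C\<^esub>"
  obtains h where "h \<in> mod_hom R A C" "\<And>a c. G a c \<Longrightarrow> h a = c"
proof -
  interpret A: module R A by fact
  interpret C: module R C by fact
  have uniq: "c = c'" if "G a c" "G a c'" for a c c'
  proof -
    have a: "a \<in> carrier A" "c \<in> carrier C" "c' \<in> carrier C" using closed that by auto
    have "G (a \<oplus>\<^bsub>A\<^esub> (\<ominus>\<^bsub>R\<^esub> \<one>\<^bsub>R\<^esub>) \<odot>\<^bsub>A\<^esub> a) (c \<oplus>\<^bsub>C\<^esub> (\<ominus>\<^bsub>R\<^esub> \<one>\<^bsub>R\<^esub>) \<odot>\<^bsub>C\<^esub> c')"
      using that by (intro add smult) auto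
    then have "G \<zero>\<^bsub>A\<^esub> (c \<ominus>\<^bsub>C\<^esub> c')"
      using a by (simp add: A.neg_eq_smult[symmetric] C.neg_eq_smult[symmetric] A.r_neg a_minus_def)
    from zero[OF this] show ?thesis using a by (simp add: C.diff_eq_zero_iff)
  qed
  define h where "h a = (SOME c. G a c)" for a
  have G: "G a (h a)" if "a \<in> carrier A" for a
    unfolding h_def using total[OF that] by (rule someI_ex)
  have *: "h a = c" if "G a c" for a c
    using uniq[OF that G] closed[OF that] by auto
  have "h \<in> mod_hom R A C"
    using closed G by (intro mod_homI) (blast, (rule *, rule add; rule G; assumption), (rule *, rule smult; (assumption | rule G))+)
  then show thesis using * that by blast
qed

lemma hom_factor:
  assumes "module R A" "module R B" "module R C"
    and "p \<in> mod_hom R A B" "p ` carrier A = carrier B" "f \<in> mod_hom R A C"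
    and ker: "\<And>x. x \<in> carrier A \<Longrightarrow> p x = \<zero>\<^bsub>B\<^esub> \<Longrightarrow> f x = \<zero>\<^bsub>C\<^esub>"
  obtains h where "h \<in> mod_hom R B C" "\<And>x. x \<in> carrier A \<Longrightarrow> h (p x) = f x"
proof -
  interpret A: module R A by fact
  define G where "G b c \<longleftrightarrow> (\<exists>x\<in>carrier A. b = p x \<and> c = f x)" for b c
  obtain h where h: "h \<in> mod_hom R B C" "\<And>b c. G b c \<Longrightarrow> h b = c"
  proof (rule linear_relation_hom[OF assms(2,3), of G])
    show "\<exists>c. G a c" if "a \<in> carrier B" for a
      using that unfolding G_def assms(5)[symmetric] by blast
    show "G (a \<oplus>\<^bsub>B\<^esub> a') (c \<oplus>\<^bsub>C\<^esub> c')" if "G a c" "G a' c'" for a c a' c'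
      using that unfolding G_def
      by (metis A.add.m_closed mod_hom_add[OF assms(4)] mod_hom_add[OF assms(6)])
    show "G (r \<odot>\<^bsub>B\<^esub> a) (r \<odot>\<^bsub>C\<^esub> c)" if "r \<in> carrier R" "G a c" for r a c
      using that unfolding G_def
      by (metis A.smult_closed mod_hom_smult[OF assms(4)] mod_hom_smult[OF assms(6)])
    show "a \<in> carrier B \<and> c \<in> carrier C" if "G a c" for a c
      using that unfolding G_def by (auto intro: mod_hom_closed[OF assms(4)] mod_hom_closed[OF assms(6)])
    show "c = \<zero>\<^bsub>C\<^esub>" if "G \<zero>\<^bsub>B\<^esub> c" for c using that ker unfolding G_def by auto
  qed blast
  show thesis by (rule that[OF h(1)]) (rule h(2), auto simp: G_def)
qed

text \<open>
  Quotients, reductions and copies of a module in another type are all images of it, so the module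
  axioms pass to them from representatives.
\<close>

lemma module_image:
  assumes "module R M" "cring R'"
    and \<phi>: "\<phi> \<in> ring_hom R R'" "\<phi> ` carrier R = carrier R'"
    and p: "p ` carrier M = carrier Q"
    and add: "\<And>x y. x \<in> carrier M \<Longrightarrow> y \<in> carrier M \<Longrightarrow> p (x \<oplus>\<^bsub>M\<^esub> y) = p x \<oplus>\<^bsub>Q\<^esub> p y"
    and zero: "p \<zero>\<^bsub>M\<^esub> = \<zero>\<^bsub>Q\<^esub>"
    and smult: "\<And>a x. a \<in> carrier R \<Longrightarrow> x \<in> carrier M \<Longrightarrow> p (a \<odot>\<^bsub>M\<^esub> x) = \<phi> a \<odot>\<^bsub>Q\<^esub> p x"
  shows "module R' Q"
proof -
  interpret M: module R M by fact
  have carQ: "\<And>X. X \<in> carrier Q \<longleftrightarrow> (\<exists>x\<in>carrier M. X = p x)" using p by auto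
  have carR: "\<And>X. X \<in> carrier R' \<longleftrightarrow> (\<exists>x\<in>carrier R. X = \<phi> x)" using \<phi> by auto
  have Qg: "abelian_group Q"
  proof (rule abelian_groupI)
    fix X Y assume "X \<in> carrier Q" "Y \<in> carrier Q"
    then obtain x y where xy: "x \<in> carrier M" "X = p x" "y \<in> carrier M" "Y = p y"
      unfolding carQ by blast
    show "X \<oplus>\<^bsub>Q\<^esub> Y \<in> carrier Q" unfolding carQ using xy by (metis M.add.m_closed add)
    show "X \<oplus>\<^bsub>Q\<^esub> Y = Y \<oplus>\<^bsub>Q\<^esub> X" using xy by (metis M.add.m_comm add)
    fix Z assume "Z \<in> carrier Q"
    then obtain z where z: "z \<in> carrier M" "Z = p z" unfolding carQ by blast
    show "X \<oplus>\<^bsub>Q\<^esub> Y \<oplus>\<^bsub>Q\<^esub> Z = X \<oplus>\<^bsub>Q\<^esub> (Y \<oplus>\<^bsub>Q\<^esub> Z)"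
      using xy z by (metis M.add.m_closed M.add.m_assoc add)
  next
    show "\<zero>\<^bsub>Q\<^esub> \<in> carrier Q" unfolding carQ by (metis M.zero_closed zero)
    fix X assume "X \<in> carrier Q"
    then obtain x where x: "x \<in> carrier M" "X = p x" unfolding carQ by blast
    show "\<zero>\<^bsub>Q\<^esub> \<oplus>\<^bsub>Q\<^esub> X = X" using x by (metis M.zero_closed M.add.l_one add zero)
    show "\<exists>Y\<in>carrier Q. Y \<oplus>\<^bsub>Q\<^esub> X = \<zero>\<^bsub>Q\<^esub>"
      using x p zero add[of "\<ominus>\<^bsub>M\<^esub> x" x] by (intro bexI[of _ "p (\<ominus>\<^bsub>M\<^esub> x)"]) (auto simp: M.l_neg)
  qed
  show ?thesis
  proof (rule moduleI[OF assms(2) Qg])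
    fix a X assume "a \<in> carrier R'" "X \<in> carrier Q"
    then obtain a' x where a: "a' \<in> carrier R" "a = \<phi> a'" "x \<in> carrier M" "X = p x"
      unfolding carQ carR by blast
    show "a \<odot>\<^bsub>Q\<^esub> X \<in> carrier Q" using a p by (metis M.smult_closed smult carQ)
    {
      fix Y assume "Y \<in> carrier Q"
      then obtain y where y: "y \<in> carrier M" "Y = p y" unfolding carQ by blast
      show "a \<odot>\<^bsub>Q\<^esub> (X \<oplus>\<^bsub>Q\<^esub> Y) = a \<odot>\<^bsub>Q\<^esub> X \<oplus>\<^bsub>Q\<^esub> a \<odot>\<^bsub>Q\<^esub> Y"
        using a y by (metis M.smult_closed M.smult_r_distr M.add.m_closed add smult)
    }
    fix b assume "b \<in> carrier R'"
    then obtain b' where b: "b' \<in> carrier R" "b = \<phi> b'" unfolding carR by blast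
    show "(a \<oplus>\<^bsub>R'\<^esub> b) \<odot>\<^bsub>Q\<^esub> X = a \<odot>\<^bsub>Q\<^esub> X \<oplus>\<^bsub>Q\<^esub> b \<odot>\<^bsub>Q\<^esub> X"
      using a b by (metis M.smult_closed M.smult_l_distr M.R.add.m_closed add smult
        ring_hom_add[OF \<phi>(1)])
    show "a \<otimes>\<^bsub>R'\<^esub> b \<odot>\<^bsub>Q\<^esub> X = a \<odot>\<^bsub>Q\<^esub> (b \<odot>\<^bsub>Q\<^esub> X)"
      using a b by (metis M.smult_closed M.smult_assoc1 M.R.m_closed smult ring_hom_mult[OF \<phi>(1)])
  next
    fix X assume "X \<in> carrier Q"
    then obtain x where x: "x \<in> carrier M" "X = p x" unfolding carQ by blast
    show "\<one>\<^bsub>R'\<^esub> \<odot>\<^bsub>Q\<^esub> X = X" using x by (metis M.smult_one M.R.one_closed smult ring_hom_one[OF \<phi>(1)])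
  qed
qed

section \<open>Free modules\<close>

lemma free_mod_simps:
  "\<zero>\<^bsub>free_mod R A\<^esub> = (\<lambda>x. \<zero>\<^bsub>R\<^esub>)"
  "\<phi> \<oplus>\<^bsub>free_mod R A\<^esub> \<psi> = (\<lambda>x. \<phi> x \<oplus>\<^bsub>R\<^esub> \<psi> x)"
  "a \<odot>\<^bsub>free_mod R A\<^esub> \<phi> = (\<lambda>x. a \<otimes>\<^bsub>R\<^esub> \<phi> x)"
  by (auto simp: free_mod_def)

lemma free_mod_carrier:
  "\<phi> \<in> carrier (free_mod R A) \<longleftrightarrow>
    (\<forall>x\<in>A. \<phi> x \<in> carrier R) \<and> (\<forall>x. x \<notin> A \<longrightarrow> \<phi> x = \<zero>\<^bsub>R\<^esub>) \<and> finite {x. \<phi> x \<noteq> \<zero>\<^bsub>R\<^esub>}"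
  by (simp add: free_mod_def)

context cring
begin

lemma free_mod_closed: "\<phi> \<in> carrier (free_mod R A) \<Longrightarrow> \<phi> x \<in> carrier R"
  by (cases "x \<in> A") (auto simp: free_mod_carrier)

lemma free_mod_module: "module R (free_mod R A)"
proof (rule moduleI)
  show "cring R" by unfold_locales
  have add: "(\<lambda>x. \<phi> x \<oplus> \<psi> x) \<in> carrier (free_mod R A)"
    if "\<phi> \<in> carrier (free_mod R A)" "\<psi> \<in> carrier (free_mod R A)" for \<phi> \<psi>
  proof -
    have "finite {x. \<phi> x \<oplus> \<psi> x \<noteq> \<zero>}"
      using that by (intro finite_subset[of "{x. \<phi> x \<oplus> \<psi> x \<noteq> \<zero>}" "{x. \<phi> x \<noteq> \<zero>} \<union> {x. \<psi> x \<noteq> \<zero>}"])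
        (auto simp: free_mod_carrier)
    then show ?thesis using that by (simp add: free_mod_carrier)
  qed
  have sm: "(\<lambda>x. a \<otimes> \<phi> x) \<in> carrier (free_mod R A)"
    if "\<phi> \<in> carrier (free_mod R A)" "a \<in> carrier R" for \<phi> a
  proof -
    have "finite {x. a \<otimes> \<phi> x \<noteq> \<zero>}"
      using that by (intro finite_subset[of "{x. a \<otimes> \<phi> x \<noteq> \<zero>}" "{x. \<phi> x \<noteq> \<zero>}"])
        (auto simp: free_mod_carrier)
    then show ?thesis using that by (simp add: free_mod_carrier)
  qed
  note fc = free_mod_closed[of _ A]
  show "abelian_group (free_mod R A)"
  proof (rule abelian_groupI, unfold free_mod_simps)
    fix \<phi> assume \<phi>: "\<phi> \<in> carrier (free_mod R A)"
    show "\<exists>\<psi>\<in>carrier (free_mod R A). (\<lambda>x. \<psi> x \<oplus> \<phi> x) = (\<lambda>x. \<zero>)"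
      using sm[OF \<phi>, of "\<ominus> \<one>"] fc[OF \<phi>] by (intro bexI[of _ "\<lambda>x. \<ominus> \<one> \<otimes> \<phi> x"]) (auto simp: l_minus l_neg)
  next
    show "(\<lambda>x. \<zero>) \<in> carrier (free_mod R A)" by (simp add: free_mod_carrier)
  qed (auto simp: fc a_ac add)
  show "a \<odot>\<^bsub>free_mod R A\<^esub> \<phi> \<in> carrier (free_mod R A)"
    if "a \<in> carrier R" "\<phi> \<in> carrier (free_mod R A)" for a \<phi>
    using sm that by (simp add: free_mod_simps)
qed (auto simp: free_mod_simps free_mod_closed l_distr r_distr m_assoc)

lemma free_basis_closed: "a \<in> A \<Longrightarrow> free_basis R a \<in> carrier (free_mod R A)"
  by (auto simp: free_mod_carrier free_basis_def)

text \<open>Induction on a finite set containing the support, splitting off one basis element at a time.\<close>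

lemma free_basis_generates:
  assumes "submodule H R (free_mod R A)" "\<And>a. a \<in> A \<Longrightarrow> free_basis R a \<in> H"
  shows "carrier (free_mod R A) \<subseteq> H"
proof
  interpret T: module R "free_mod R A" by (rule free_mod_module)
  fix \<phi> assume \<phi>: "\<phi> \<in> carrier (free_mod R A)"
  have "\<forall>\<phi>\<in>carrier (free_mod R A). {x. \<phi> x \<noteq> \<zero>} \<subseteq> B \<longrightarrow> \<phi> \<in> H" if "finite B" for B
    using that
  proof induction
    case empty
    have "(\<lambda>x. \<zero>) \<in> H"
      using subgroup.one_closed[OF submodule.axioms(1)[OF assms(1)]] by (simp add: free_mod_simps)
    moreover have "\<phi> = (\<lambda>x. \<zero>)" if "{x. \<phi> x \<noteq> \<zero>} \<subseteq> {}" for \<phi> :: "'c \<Rightarrow> 'a"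
      using that by auto
    ultimately show ?case by metis
  next
    case (insert b B)
    show ?case
    proof (intro ballI impI)
      fix \<phi> assume \<phi>: "\<phi> \<in> carrier (free_mod R A)" and sub: "{x. \<phi> x \<noteq> \<zero>} \<subseteq> insert b B"
      show "\<phi> \<in> H"
      proof (cases "\<phi> b = \<zero>")
        case True then show ?thesis using sub insert \<phi> by blast
      next
        case False
        then have b: "b \<in> A" using \<phi> by (auto simp: free_mod_carrier)
        let ?\<psi> = "\<phi>(b := \<zero>)"
        have "finite {x. (\<phi>(b := \<zero>)) x \<noteq> \<zero>}"
          using \<phi> by (auto simp: free_mod_carrier elim: rev_finite_subset)
        then have "?\<psi> \<in> carrier (free_mod R A)" using \<phi> by (auto simp: free_mod_carrier)
        moreover have "{x. ?\<psi> x \<noteq> \<zero>} \<subseteq> B" using sub by auto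
        ultimately have 1: "?\<psi> \<in> H" using insert.IH by blast
        have "\<phi> b \<odot>\<^bsub>free_mod R A\<^esub> free_basis R b \<in> H"
          using T.submoduleE(4)[OF assms(1) free_mod_closed[OF \<phi>] assms(2)[OF b]] .
        then have "?\<psi> \<oplus>\<^bsub>free_mod R A\<^esub> \<phi> b \<odot>\<^bsub>free_mod R A\<^esub> free_basis R b \<in> H"
          using T.submoduleE(5)[OF assms(1) 1] by blast
        moreover have "?\<psi> \<oplus>\<^bsub>free_mod R A\<^esub> \<phi> b \<odot>\<^bsub>free_mod R A\<^esub> free_basis R b = \<phi>"
          using free_mod_closed[OF \<phi>] by (auto simp: free_mod_simps free_basis_def)
        ultimately show ?thesis by simp
      qed
    qed
  qed
  with \<phi> show "\<phi> \<in> H" by (auto simp: free_mod_carrier)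
qed

lemma free_hom_eqI:
  assumes "module R M" "f \<in> mod_hom R (free_mod R A) M" "g \<in> mod_hom R (free_mod R A) M"
    and "\<And>a. a \<in> A \<Longrightarrow> f (free_basis R a) = g (free_basis R a)"
    and "\<phi> \<in> carrier (free_mod R A)"
  shows "f \<phi> = g \<phi>"
proof -
  have "carrier (free_mod R A) \<subseteq> {x \<in> carrier (free_mod R A). f x = g x}"
    using assms(4) free_basis_closed
    by (intro free_basis_generates equalizer_submodule[OF free_mod_module assms(1-3)]) simp
  then show ?thesis using assms(5) by blast
qed

text \<open>
  \<open>lin_ext\<close> sums over the support, which changes with \<open>\<phi>\<close>; additivity needs a common index set.
\<close>

lemma lin_ext_superset:
  assumes "module R M" "\<And>a. a \<in> A \<Longrightarrow> f a \<in> carrier M" "\<phi> \<in> carrier (free_mod R A)"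
    and "finite B" "{x. \<phi> x \<noteq> \<zero>} \<subseteq> B" "B \<subseteq> A"
  shows "lin_ext R M f \<phi> = (\<Oplus>\<^bsub>M\<^esub>x\<in>B. \<phi> x \<odot>\<^bsub>M\<^esub> f x)"
proof -
  interpret M: module R M by fact
  show ?thesis unfolding lin_ext_def
    using assms(2-6) free_mod_closed[OF assms(3)]
    by (intro M.add.finprod_mono_neutral_cong_left) auto
qed

lemma lin_ext_hom:
  assumes "module R M" "\<And>a. a \<in> A \<Longrightarrow> f a \<in> carrier M"
  shows "lin_ext R M f \<in> mod_hom R (free_mod R A) M"
proof -
  interpret M: module R M by fact
  interpret T: module R "free_mod R A" by (rule free_mod_module)
  have sup: "lin_ext R M f \<phi> = (\<Oplus>\<^bsub>M\<^esub>x\<in>B. \<phi> x \<odot>\<^bsub>M\<^esub> f x)"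
    if "\<phi> \<in> carrier (free_mod R A)" "finite B" "{x. \<phi> x \<noteq> \<zero>} \<subseteq> B" "B \<subseteq> A" for \<phi> B
    using lin_ext_superset[OF assms(1), where f = f, OF assms(2)] that by blast
  have supp: "finite {x. \<phi> x \<noteq> \<zero>}" "{x. \<phi> x \<noteq> \<zero>} \<subseteq> A" if "\<phi> \<in> carrier (free_mod R A)" for \<phi>
    using that by (auto simp: free_mod_carrier)
  note cl = free_mod_closed[of _ A]
  show ?thesis
  proof (rule mod_homI)
    fix \<phi> assume \<phi>: "\<phi> \<in> carrier (free_mod R A)"
    let ?B = "{x. \<phi> x \<noteq> \<zero>}"
    note [simp] = cl[OF \<phi>]
    have fB: "f \<in> ?B \<rightarrow> carrier M" using supp[OF \<phi>] assms(2) by auto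
    then show "lin_ext R M f \<phi> \<in> carrier M"
      unfolding lin_ext_def by (intro M.finsum_closed) auto
    fix a assume a: "a \<in> carrier R"
    have "lin_ext R M f (a \<odot>\<^bsub>free_mod R A\<^esub> \<phi>) = (\<Oplus>\<^bsub>M\<^esub>x\<in>?B. (a \<odot>\<^bsub>free_mod R A\<^esub> \<phi>) x \<odot>\<^bsub>M\<^esub> f x)"
      using a supp[OF \<phi>] by (intro sup) (auto intro: T.smult_closed \<phi>, auto simp: free_mod_simps)
    also have "\<dots> = (\<Oplus>\<^bsub>M\<^esub>x\<in>?B. a \<odot>\<^bsub>M\<^esub> (\<phi> x \<odot>\<^bsub>M\<^esub> f x))"
      using a fB by (intro M.finsum_cong') (auto simp: free_mod_simps M.smult_assoc1 Pi_iff)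
    also have "\<dots> = a \<odot>\<^bsub>M\<^esub> lin_ext R M f \<phi>" unfolding lin_ext_def
      using a fB supp[OF \<phi>] by (subst M.finsum_smult_ldistr) auto
    finally show "lin_ext R M f (a \<odot>\<^bsub>free_mod R A\<^esub> \<phi>) = a \<odot>\<^bsub>M\<^esub> lin_ext R M f \<phi>" .
  next
    fix \<phi> \<psi> assume \<phi>: "\<phi> \<in> carrier (free_mod R A)" and \<psi>: "\<psi> \<in> carrier (free_mod R A)"
    let ?B = "{x. \<phi> x \<noteq> \<zero>} \<union> {x. \<psi> x \<noteq> \<zero>}"
    note [simp] = cl[OF \<phi>] cl[OF \<psi>]
    have B: "finite ?B" "?B \<subseteq> A" using supp \<phi> \<psi> by auto
    then have fB: "f \<in> ?B \<rightarrow> carrier M" using assms(2) by auto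
    have "lin_ext R M f (\<phi> \<oplus>\<^bsub>free_mod R A\<^esub> \<psi>) = (\<Oplus>\<^bsub>M\<^esub>x\<in>?B. (\<phi> \<oplus>\<^bsub>free_mod R A\<^esub> \<psi>) x \<odot>\<^bsub>M\<^esub> f x)"
      using B T.add.m_closed[OF \<phi> \<psi>] by (intro sup) (auto simp: free_mod_simps)
    also have "\<dots> = (\<Oplus>\<^bsub>M\<^esub>x\<in>?B. \<phi> x \<odot>\<^bsub>M\<^esub> f x \<oplus>\<^bsub>M\<^esub> \<psi> x \<odot>\<^bsub>M\<^esub> f x)"
      using fB by (intro M.finsum_cong') (auto simp: free_mod_simps M.smult_l_distr Pi_iff)
    also have "\<dots> = (\<Oplus>\<^bsub>M\<^esub>x\<in>?B. \<phi> x \<odot>\<^bsub>M\<^esub> f x) \<oplus>\<^bsub>M\<^esub> (\<Oplus>\<^bsub>M\<^esub>x\<in>?B. \<psi> x \<odot>\<^bsub>M\<^esub> f x)"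
      using fB by (intro M.finsum_addf) (auto simp: Pi_iff)
    also have "\<dots> = lin_ext R M f \<phi> \<oplus>\<^bsub>M\<^esub> lin_ext R M f \<psi>"
      using sup[OF \<phi> B(1) _ B(2)] sup[OF \<psi> B(1) _ B(2)] by auto
    finally show "lin_ext R M f (\<phi> \<oplus>\<^bsub>free_mod R A\<^esub> \<psi>) = lin_ext R M f \<phi> \<oplus>\<^bsub>M\<^esub> lin_ext R M f \<psi>" .
  qed
qed

lemma lin_ext_basis:
  assumes "module R M" "a \<in> A" "\<And>a. a \<in> A \<Longrightarrow> f a \<in> carrier M"
  shows "lin_ext R M f (free_basis R a) = f a"
proof -
  interpret M: module R M by fact
  have "lin_ext R M f (free_basis R a) = (\<Oplus>\<^bsub>M\<^esub>x\<in>{a}. free_basis R a x \<odot>\<^bsub>M\<^esub> f x)"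
    using assms(2) by (intro lin_ext_superset[OF assms(1,3) free_basis_closed])
      (auto simp: free_basis_def)
  also have "\<dots> = f a" using assms(2,3) by (simp add: free_basis_def M.finsum_insert)
  finally show ?thesis .
qed

lemma free_basis_lift:
  assumes "module R X" "module R Y" "g \<in> mod_hom R X Y" "g ` carrier X = carrier Y"
    and "f \<in> mod_hom R (free_mod R A) Y"
  obtains h where "h \<in> mod_hom R (free_mod R A) X"
    "\<And>\<phi>. \<phi> \<in> carrier (free_mod R A) \<Longrightarrow> g (h \<phi>) = f \<phi>"
proof -
  have "\<exists>x\<in>carrier X. g x = f (free_basis R a)" if "a \<in> A" for a
    using mod_hom_closed[OF assms(5) free_basis_closed[OF that]] assms(4)
    by (metis (no_types, lifting) imageE)
  then obtain c where c: "\<And>a. a \<in> A \<Longrightarrow> c a \<in> carrier X \<and> g (c a) = f (free_basis R a)"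
    by metis
  let ?h = "lin_ext R X c"
  have h: "?h \<in> mod_hom R (free_mod R A) X" using c by (intro lin_ext_hom assms) auto
  have "g (?h (free_basis R a)) = f (free_basis R a)" if "a \<in> A" for a
    using c that by (simp add: lin_ext_basis[OF assms(1) that])
  then show thesis
    using free_hom_eqI[OF assms(2) mod_hom_comp[OF h assms(3)] assms(5)] by (intro that[OF h]) simp
qed

end

section \<open>Ext and extension of maps\<close>

lemma cover_map_hom: "module R M \<Longrightarrow> cover_map R M \<in> mod_hom R (free_cover R M) M"
  unfolding cover_map_def free_cover_def
  by (rule cring.lin_ext_hom[OF module.axioms(1)]) auto

lemma cover_map_basis:
  assumes "module R M" "x \<in> carrier M"
  shows "cover_map R M (free_basis R x) = x"
  unfolding cover_map_def
  by (rule cring.lin_ext_basis[OF module.axioms(1)[OF assms(1)] assms]) auto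

lemma cover_map_onto:
  assumes "module R M" shows "cover_map R M ` carrier (free_cover R M) = carrier M"
proof
  show "cover_map R M ` carrier (free_cover R M) \<subseteq> carrier M"
    using mod_hom_closed[OF cover_map_hom[OF assms]] by blast
  show "carrier M \<subseteq> cover_map R M ` carrier (free_cover R M)"
  proof
    fix x assume x: "x \<in> carrier M"
    have "free_basis R x \<in> carrier (free_cover R M)"
      unfolding free_cover_def by (rule cring.free_basis_closed[OF module.axioms(1)[OF assms] x])
    then show "x \<in> cover_map R M ` carrier (free_cover R M)"
      using cover_map_basis[OF assms x] by (metis imageI)
  qed
qed

lemma free_cover_module: "module R M \<Longrightarrow> module R (free_cover R M)"
  unfolding free_cover_def by (rule cring.free_mod_module[OF module.axioms(1)])

lemma syz_simps:
  "carrier (syz R M) = {x \<in> carrier (free_cover R M). cover_map R M x = \<zero>\<^bsub>M\<^esub>}"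
  "add (syz R M) = add (free_cover R M)"
  "zero (syz R M) = zero (free_cover R M)"
  "smult (syz R M) = smult (free_cover R M)"
  by (auto simp: syz_def a_kernel_def' )

lemma syz_submodule: "module R M \<Longrightarrow> submodule (carrier (syz R M)) R (free_cover R M)"
  unfolding syz_simps by (intro kernel_submodule free_cover_module cover_map_hom)

lemma syz_module:
  assumes "module R M" shows "module R (syz R M)"
proof -
  have "syz R M = (free_cover R M)\<lparr>carrier := carrier (syz R M)\<rparr>" by (simp add: syz_def)
  then show ?thesis
    using submodule_restrict[OF free_cover_module syz_submodule] assms by metis
qed

lemma syz_incl: "module R M \<Longrightarrow> (\<lambda>x. x) \<in> mod_hom R (syz R M) (free_cover R M)"
  by (auto simp: mod_hom_def syz_simps)

lemma syz_restrict_hom: "f \<in> mod_hom R (free_cover R M) N \<Longrightarrow> f \<in> mod_hom R (syz R M) N"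
  by (auto simp: mod_hom_def syz_simps)

lemma Hom_mod_simps:
  "f \<in> carrier (Hom_mod R M N) \<longleftrightarrow> f \<in> mod_hom R M N \<and> f \<in> extensional (carrier M)"
  "\<zero>\<^bsub>Hom_mod R M N\<^esub> = (\<lambda>x\<in>carrier M. \<zero>\<^bsub>N\<^esub>)"
  "f \<oplus>\<^bsub>Hom_mod R M N\<^esub> g = (\<lambda>x\<in>carrier M. f x \<oplus>\<^bsub>N\<^esub> g x)"
  "a \<odot>\<^bsub>Hom_mod R M N\<^esub> f = (\<lambda>x\<in>carrier M. a \<odot>\<^bsub>N\<^esub> f x)"
  by (auto simp: Hom_mod_def)

lemma Hom_mod_module:
  assumes "module R M" "module R N"
  shows "module R (Hom_mod R M N)"
proof -
  interpret M: module R M by fact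
  interpret N: module R N by fact
  have r: "restrict f (carrier M) \<in> carrier (Hom_mod R M N)" if "f \<in> mod_hom R M N" for f
    unfolding Hom_mod_simps using mod_hom_cong[OF assms(1) that] by auto
  have add: "f \<oplus>\<^bsub>Hom_mod R M N\<^esub> g \<in> carrier (Hom_mod R M N)"
    if "f \<in> carrier (Hom_mod R M N)" "g \<in> carrier (Hom_mod R M N)" for f g
    unfolding Hom_mod_simps(3) using that
    by (intro r mod_hom_plus assms) (auto simp: Hom_mod_simps(1))
  have smult: "a \<odot>\<^bsub>Hom_mod R M N\<^esub> f \<in> carrier (Hom_mod R M N)"
    if "f \<in> carrier (Hom_mod R M N)" "a \<in> carrier R" for f a
    unfolding Hom_mod_simps(4) using that
    by (intro r mod_hom_scale assms) (auto simp: Hom_mod_simps(1))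
  have cl: "f x \<in> carrier N" if "f \<in> carrier (Hom_mod R M N)" "x \<in> carrier M" for f x
    using that mod_hom_closed by (auto simp: Hom_mod_simps(1))
  have rid: "restrict f (carrier M) = f" if "f \<in> carrier (Hom_mod R M N)" for f
    using that by (auto simp: Hom_mod_simps(1) extensional_restrict)
  show ?thesis
  proof (rule moduleI)
    show "cring R" by unfold_locales
    show "abelian_group (Hom_mod R M N)"
    proof (rule abelian_groupI)
      fix f assume f: "f \<in> carrier (Hom_mod R M N)"
      show "\<exists>g\<in>carrier (Hom_mod R M N). g \<oplus>\<^bsub>Hom_mod R M N\<^esub> f = \<zero>\<^bsub>Hom_mod R M N\<^esub>"
        using smult[OF f, of "\<ominus>\<^bsub>R\<^esub> \<one>\<^bsub>R\<^esub>"] cl[OF f]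
        by (intro bexI[of _ "(\<ominus>\<^bsub>R\<^esub> \<one>\<^bsub>R\<^esub>) \<odot>\<^bsub>Hom_mod R M N\<^esub> f"])
          (auto simp: Hom_mod_simps(2-) N.neg_eq_smult[symmetric] N.l_neg cong: restrict_cong)
      show "\<zero>\<^bsub>Hom_mod R M N\<^esub> \<oplus>\<^bsub>Hom_mod R M N\<^esub> f = f"
        using cl[OF f] rid[OF f] by (simp add: Hom_mod_simps(2-) cong: restrict_cong)
      fix g h assume g: "g \<in> carrier (Hom_mod R M N)" and h: "h \<in> carrier (Hom_mod R M N)"
      show "f \<oplus>\<^bsub>Hom_mod R M N\<^esub> g = g \<oplus>\<^bsub>Hom_mod R M N\<^esub> f"
        using cl[OF f] cl[OF g] by (simp add: Hom_mod_simps(2-) N.a_comm cong: restrict_cong)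
      show "f \<oplus>\<^bsub>Hom_mod R M N\<^esub> g \<oplus>\<^bsub>Hom_mod R M N\<^esub> h = f \<oplus>\<^bsub>Hom_mod R M N\<^esub> (g \<oplus>\<^bsub>Hom_mod R M N\<^esub> h)"
        using cl[OF f] cl[OF g] cl[OF h] by (simp add: Hom_mod_simps(2-) N.a_assoc cong: restrict_cong)
    next
      have "(\<lambda>x. \<zero>\<^bsub>N\<^esub>) \<in> mod_hom R M N" by (intro mod_homI) auto
      then show "\<zero>\<^bsub>Hom_mod R M N\<^esub> \<in> carrier (Hom_mod R M N)"
        unfolding Hom_mod_simps(2) by (rule r)
    qed (auto intro: add smult)
  qed (simp_all add: smult, simp_all add: cl rid Hom_mod_simps(2-) N.smult_l_distr N.smult_r_distr
      N.smult_assoc1 cong: restrict_cong)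
qed

lemma pullback_hom:
  assumes "module R M" "module R M'" "module R N" "d \<in> mod_hom R M M'"
  shows "(\<lambda>f. compose (carrier M) f d) \<in> mod_hom R (Hom_mod R M' N) (Hom_mod R M N)"
proof -
  have cl: "d x \<in> carrier M'" if "x \<in> carrier M" for x using assms(4) that by (rule mod_hom_closed)
  have "compose (carrier M) f d \<in> carrier (Hom_mod R M N)" if "f \<in> mod_hom R M' N" for f
    using mod_hom_cong[OF assms(1) mod_hom_comp[OF assms(4) that]]
    by (simp add: Hom_mod_simps(1) compose_def)
  then show ?thesis
    by (intro mod_homI) (simp_all add: Hom_mod_simps compose_def cl fun_eq_iff)
qed

text \<open>
  The elements of Ext are the cosets of the coboundaries \<open>B\<close> by cocycles \<open>z\<close>, and such a coset is
  \<open>B\<close> itself precisely when \<open>z\<close> lies in \<open>B\<close>.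
\<close>

lemma Ext1_vanishes_iff_subset:
  assumes "module R A" "module R C"
  defines "P0 \<equiv> free_cover R A" and "P1 \<equiv> free_cover R (syz R A)"
    and "P2 \<equiv> free_cover R (syz R (syz R A))"
    and "d1 \<equiv> cover_map R (syz R A)" and "d2 \<equiv> cover_map R (syz R (syz R A))"
  shows "Ext1_vanishes R A C \<longleftrightarrow>
    {f \<in> carrier (Hom_mod R P1 C). compose (carrier P2) f d2 = \<zero>\<^bsub>Hom_mod R P2 C\<^esub>}
      \<subseteq> (\<lambda>f. compose (carrier P1) f d1) ` carrier (Hom_mod R P0 C)"
    (is "_ \<longleftrightarrow> ?Z \<subseteq> ?B")
proof -
  have mods: "module R P0" "module R P1" "module R P2" "module R (syz R A)"
    unfolding P0_def P1_def P2_def using assms(1) by (intro free_cover_module syz_module; simp)+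
  interpret H: module R "Hom_mod R P1 C" by (rule Hom_mod_module[OF mods(2) assms(2)])
  have d1: "d1 \<in> mod_hom R P1 P0"
    unfolding d1_def P1_def P0_def
    using mod_hom_comp[OF cover_map_hom[OF mods(4)] syz_incl[OF assms(1)]] .
  have B: "submodule ?B R (Hom_mod R P1 C)"
    by (intro range_submodule pullback_hom Hom_mod_module mods assms(2) d1)
  then have Bg: "subgroup ?B (add_monoid (Hom_mod R P1 C))" by (rule submodule.axioms(1))
  have BZ: "?B \<subseteq> ?Z"
  proof
    fix z assume "z \<in> ?B"
    then obtain f where f: "f \<in> mod_hom R P0 C" "z = compose (carrier P1) f d1"
      by (auto simp: Hom_mod_simps)
    have "z \<in> carrier (Hom_mod R P1 C)"
      using \<open>z \<in> ?B\<close> H.submoduleE(1)[OF B] by blast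
    moreover have "d2 x \<in> carrier P1" "d1 (d2 x) = \<zero>\<^bsub>P0\<^esub>" if "x \<in> carrier P2" for x
      using mod_hom_closed[OF cover_map_hom[OF syz_module[OF mods(4)]]] that
      by (auto simp: d1_def d2_def P2_def P1_def P0_def syz_simps)
    then have "compose (carrier P2) z d2 = \<zero>\<^bsub>Hom_mod R P2 C\<^esub>"
      using mod_hom_zero[OF mods(1) assms(2) f(1)]
      by (simp add: f(2) compose_def Hom_mod_simps cong: restrict_cong)
    ultimately show "z \<in> ?Z" by blast
  qed
  have Zcar: "?Z \<subseteq> carrier (Hom_mod R P1 C)" by blast
  have ker: "a_kernel (Hom_mod R P1 C) (Hom_mod R P2 C) (\<lambda>f. compose (carrier P2) f d2) = ?Z"
    by (auto simp: a_kernel_def')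
  have "Ext1_vanishes R A C \<longleftrightarrow>
      (\<lambda>z. ?B +>\<^bsub>(Hom_mod R P1 C)\<lparr>carrier := ?Z\<rparr>\<^esub> z) ` ?Z = {?B}"
    unfolding Ext1_vanishes_def Ext1_def Let_def P0_def[symmetric] P1_def[symmetric]
      P2_def[symmetric] d1_def[symmetric] d2_def[symmetric] ker
    by (simp add: quot_mod_def A_RCOSETS_def' UNION_singleton_eq_range)
  also have "\<dots> \<longleftrightarrow> (\<lambda>z. ?B +>\<^bsub>Hom_mod R P1 C\<^esub> z) ` ?Z = {?B}"
    by (simp add: a_r_coset_def')
  also have "\<dots> \<longleftrightarrow> ?Z \<subseteq> ?B"
  proof
    assume *: "(\<lambda>z. ?B +>\<^bsub>Hom_mod R P1 C\<^esub> z) ` ?Z = {?B}"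
    show "?Z \<subseteq> ?B"
    proof
      fix z assume z: "z \<in> ?Z"
      then have eq: "?B +>\<^bsub>Hom_mod R P1 C\<^esub> z = ?B" using * by blast
      have "z \<in> ?B +>\<^bsub>Hom_mod R P1 C\<^esub> z"
        using H.a_rcosI[OF _ H.submoduleE(1)[OF B], of "\<zero>\<^bsub>Hom_mod R P1 C\<^esub>" z]
          subgroup.one_closed[OF Bg] z by simp
      then show "z \<in> ?B" using eq by simp
    qed
  next
    assume *: "?Z \<subseteq> ?B"
    have "?B +>\<^bsub>Hom_mod R P1 C\<^esub> z = ?B" if "z \<in> ?Z" for z
      using H.a_coset_join2[OF _ Bg] that * Zcar by blast
    moreover have "?Z \<noteq> {}" using BZ H.submoduleE(2)[OF B] by blast
    ultimately show "(\<lambda>z. ?B +>\<^bsub>Hom_mod R P1 C\<^esub> z) ` ?Z = {?B}"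
      by (metis (no_types, lifting) image_cong image_constant_conv)
  qed
  finally show ?thesis .
qed

text \<open>
  A cocycle kills the image of \<open>d2\<close>, which is the kernel of the surjection \<open>d1\<close> onto the first
  syzygy; so it is a map on the syzygy. It is a coboundary when this map extends to \<open>P0\<close>.
\<close>

lemma Ext1_vanishes_iff:
  assumes "module R A" "module R C"
  shows "Ext1_vanishes R A C \<longleftrightarrow> (\<forall>g\<in>mod_hom R (syz R A) C.
    \<exists>h\<in>mod_hom R (free_cover R A) C. \<forall>x\<in>carrier (syz R A). h x = g x)"
proof -
  let ?P0 = "free_cover R A" and ?P1 = "free_cover R (syz R A)"
  let ?P2 = "free_cover R (syz R (syz R A))"
  let ?d1 = "cover_map R (syz R A)" and ?d2 = "cover_map R (syz R (syz R A))"
  let ?Z = "{f \<in> carrier (Hom_mod R ?P1 C). compose (carrier ?P2) f ?d2 = \<zero>\<^bsub>Hom_mod R ?P2 C\<^esub>}"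
  note S = syz_module[OF assms(1)]
  note P0 = free_cover_module[OF assms(1)] and P1 = free_cover_module[OF S]
  note d1 = cover_map_hom[OF S] and d1_onto = cover_map_onto[OF S]
  have "?Z \<subseteq> (\<lambda>f. compose (carrier ?P1) f ?d1) ` carrier (Hom_mod R ?P0 C) \<longleftrightarrow>
    (\<forall>g\<in>mod_hom R (syz R A) C. \<exists>h\<in>mod_hom R ?P0 C. \<forall>x\<in>carrier (syz R A). h x = g x)"
    (is "?L \<longleftrightarrow> ?R")
  proof
    assume L: ?L
    show ?R
    proof
      fix g assume g: "g \<in> mod_hom R (syz R A) C"
      let ?z = "compose (carrier ?P1) g ?d1"
      have "?z \<in> carrier (Hom_mod R ?P1 C)"
        using mod_hom_closed[OF pullback_hom[OF P1 S assms(2) d1], of "restrict g (carrier (syz R A))"]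
          mod_hom_cong[OF S g] mod_hom_closed[OF d1]
        by (simp add: Hom_mod_simps(1) compose_def cong: restrict_cong)
      moreover have "?d2 x \<in> carrier ?P1" "?d1 (?d2 x) = \<zero>\<^bsub>?P0\<^esub>" if "x \<in> carrier ?P2" for x
        using mod_hom_closed[OF cover_map_hom[OF syz_module[OF S]]] that by (auto simp: syz_simps)
      then have "compose (carrier ?P2) ?z ?d2 = \<zero>\<^bsub>Hom_mod R ?P2 C\<^esub>"
        using mod_hom_zero[OF S assms(2) g]
        by (simp add: compose_def Hom_mod_simps syz_simps cong: restrict_cong)
      ultimately obtain f where f: "f \<in> carrier (Hom_mod R ?P0 C)"
        "?z = compose (carrier ?P1) f ?d1" using L by blast
      have "f x = g x" if "x \<in> carrier (syz R A)" for x
      proof -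
        from that obtain y where "y \<in> carrier ?P1" "x = ?d1 y" using d1_onto by blast
        then show ?thesis using f(2)[THEN fun_cong, of y] by (simp add: compose_def)
      qed
      then show "\<exists>h\<in>mod_hom R ?P0 C. \<forall>x\<in>carrier (syz R A). h x = g x"
        using f(1) by (auto simp: Hom_mod_simps)
    qed
  next
    assume R: ?R
    show ?L
    proof
      fix z assume z: "z \<in> ?Z"
      then have zh: "z \<in> mod_hom R ?P1 C" "z \<in> extensional (carrier ?P1)"
        by (auto simp: Hom_mod_simps)
      have ker: "z x = \<zero>\<^bsub>C\<^esub>" if "x \<in> carrier ?P1" "?d1 x = \<zero>\<^bsub>syz R A\<^esub>" for x
      proof -
        have "x \<in> carrier (syz R (syz R A))" using that by (auto simp: syz_simps)
        then obtain y where y: "y \<in> carrier ?P2" "x = ?d2 y"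
          using cover_map_onto[OF syz_module[OF S]] by blast
        have "compose (carrier ?P2) z ?d2 y = \<zero>\<^bsub>Hom_mod R ?P2 C\<^esub> y" using z by simp
        then show ?thesis using y by (simp add: compose_def Hom_mod_simps)
      qed
      obtain g where g: "g \<in> mod_hom R (syz R A) C" "\<And>x. x \<in> carrier ?P1 \<Longrightarrow> g (?d1 x) = z x"
        using hom_factor[OF P1 S assms(2) d1 d1_onto zh(1) ker] by blast
      obtain h where h: "h \<in> mod_hom R ?P0 C" "\<forall>x\<in>carrier (syz R A). h x = g x"
        using R g(1) by blast
      let ?f = "restrict h (carrier ?P0)"
      have "?f \<in> carrier (Hom_mod R ?P0 C)"
        using mod_hom_cong[OF P0 h(1)] by (simp add: Hom_mod_simps)
      moreover have "z = compose (carrier ?P1) ?f ?d1"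
      proof (rule extensionalityI[OF zh(2)])
        fix x assume x: "x \<in> carrier ?P1"
        have "?d1 x \<in> carrier (syz R A)" using mod_hom_closed[OF d1 x] .
        then show "z x = compose (carrier ?P1) ?f ?d1 x"
          using x h(2) g(2)[OF x] by (simp add: compose_def syz_simps)
      qed (simp add: compose_def)
      ultimately show "z \<in> (\<lambda>f. compose (carrier ?P1) f ?d1) ` carrier (Hom_mod R ?P0 C)"
        by blast
    qed
  qed
  then show ?thesis unfolding Ext1_vanishes_iff_subset[OF assms] .
qed

text \<open>
  The free cover of \<open>A\<close> maps to \<open>X\<close> over \<open>A\<close>, by some \<open>j\<close>. Every element of \<open>X\<close> is \<open>j y + z\<close> with
  \<open>z \<in> H\<close>, and if \<open>b\<close> extends \<open>g \<circ> j\<close> from the syzygy to the free cover, then \<open>b y + g z\<close> depends only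
  on \<open>j y + z\<close>.
\<close>

lemma Ext1_vanishes_extend:
  assumes "Ext1_vanishes R A C" "module R A" "module R C" "module R X"
    and p: "p \<in> mod_hom R X A" "p ` carrier X = carrier A"
    and H: "H = {x \<in> carrier X. p x = \<zero>\<^bsub>A\<^esub>}" and g: "g \<in> mod_hom R (X\<lparr>carrier := H\<rparr>) C"
  obtains h where "h \<in> mod_hom R X C" "\<And>x. x \<in> H \<Longrightarrow> h x = g x"
proof -
  let ?P = "free_cover R A" and ?\<pi> = "cover_map R A"
  interpret X: module R X by fact
  interpret A: module R A by fact
  interpret C: module R C by fact
  interpret P: module R ?P by (rule free_cover_module) fact
  note \<pi> = cover_map_hom[OF assms(2)]
  have Hs: "submodule H R X" unfolding H by (rule kernel_submodule[OF assms(4,2) p(1)])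
  have HX: "\<And>x. x \<in> H \<Longrightarrow> x \<in> carrier X" by (auto simp: H)
  obtain j where j: "j \<in> mod_hom R ?P X" "\<And>x. x \<in> carrier ?P \<Longrightarrow> p (j x) = ?\<pi> x"
    using X.free_basis_lift[OF assms(4,2) p \<pi>[unfolded free_cover_def]]
    unfolding free_cover_def by blast
  note jc = mod_hom_closed[OF j(1)]
  have jH: "j x \<in> H" if "x \<in> carrier (syz R A)" for x
    using that j(2) jc by (auto simp: H syz_simps)
  have "(\<lambda>x. g (j x)) \<in> mod_hom R (syz R A) C"
    by (rule mod_hom_comp[OF _ g], insert j(1) jH) (auto simp: mod_hom_def syz_simps)
  then obtain b where b: "b \<in> mod_hom R ?P C" "\<And>x. x \<in> carrier (syz R A) \<Longrightarrow> b x = g (j x)"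
    using bspec[OF assms(1)[unfolded Ext1_vanishes_iff[OF assms(2,3)]]] by blast
  have g_add: "g (x \<oplus>\<^bsub>X\<^esub> y) = g x \<oplus>\<^bsub>C\<^esub> g y" if "x \<in> H" "y \<in> H" for x y
    using mod_hom_add[OF g] that by simp
  have g_smult: "g (a \<odot>\<^bsub>X\<^esub> x) = a \<odot>\<^bsub>C\<^esub> g x" if "a \<in> carrier R" "x \<in> H" for a x
    using mod_hom_smult[OF g] that by simp
  have gc: "g x \<in> carrier C" if "x \<in> H" for x using mod_hom_closed[OF g] that by simp
  define G where "G x c \<longleftrightarrow> (\<exists>y\<in>carrier ?P. \<exists>z\<in>H. x = j y \<oplus>\<^bsub>X\<^esub> z \<and> c = b y \<oplus>\<^bsub>C\<^esub> g z)" for x c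
  have GI: "G x c" if "x = j y \<oplus>\<^bsub>X\<^esub> z" "c = b y \<oplus>\<^bsub>C\<^esub> g z" "y \<in> carrier ?P" "z \<in> H" for x c y z
    unfolding G_def using that by blast
  obtain h where h: "h \<in> mod_hom R X C" "\<And>x c. G x c \<Longrightarrow> h x = c"
  proof (rule linear_relation_hom[OF assms(4,3), of G])
    fix x assume x: "x \<in> carrier X"
    then have "p x \<in> carrier A" by (rule mod_hom_closed[OF p(1)])
    then obtain y where y: "y \<in> carrier ?P" "p x = ?\<pi> y" using cover_map_onto[OF assms(2)] by blast
    have "p (x \<ominus>\<^bsub>X\<^esub> j y) = \<zero>\<^bsub>A\<^esub>"
      using x y j(2) jc \<open>p x \<in> carrier A\<close> by (simp add: mod_hom_minus[OF assms(4,2) p(1)] A.diff_eq_zero_iff)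
    then have "x \<ominus>\<^bsub>X\<^esub> j y \<in> H" using x y jc by (auto simp: H)
    moreover have "x = j y \<oplus>\<^bsub>X\<^esub> (x \<ominus>\<^bsub>X\<^esub> j y)"
      using x jc[OF y(1)] by (simp add: a_minus_def X.a_lcomm X.r_neg)
    ultimately show "\<exists>c. G x c" unfolding G_def using y(1) by blast
  next
    fix x c x' c' assume "G x c" "G x' c'"
    then obtain y z y' z' where *: "y \<in> carrier ?P" "z \<in> H" "y' \<in> carrier ?P" "z' \<in> H"
      "x = j y \<oplus>\<^bsub>X\<^esub> z" "c = b y \<oplus>\<^bsub>C\<^esub> g z" "x' = j y' \<oplus>\<^bsub>X\<^esub> z'" "c' = b y' \<oplus>\<^bsub>C\<^esub> g z'"
      unfolding G_def by blast
    have "x \<oplus>\<^bsub>X\<^esub> x' = j (y \<oplus>\<^bsub>?P\<^esub> y') \<oplus>\<^bsub>X\<^esub> (z \<oplus>\<^bsub>X\<^esub> z')"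
      using * jc HX by (simp add: mod_hom_add[OF j(1)] X.a_ac)
    moreover have "c \<oplus>\<^bsub>C\<^esub> c' = b (y \<oplus>\<^bsub>?P\<^esub> y') \<oplus>\<^bsub>C\<^esub> g (z \<oplus>\<^bsub>X\<^esub> z')"
      using * gc mod_hom_closed[OF b(1)] by (simp add: mod_hom_add[OF b(1)] g_add C.a_ac)
    ultimately show "G (x \<oplus>\<^bsub>X\<^esub> x') (c \<oplus>\<^bsub>C\<^esub> c')"
      by (rule GI) (simp_all add: *(1-4) X.submoduleE(5)[OF Hs])
  next
    fix r x c assume r: "r \<in> carrier R" and "G x c"
    then obtain y z where *: "y \<in> carrier ?P" "z \<in> H" "x = j y \<oplus>\<^bsub>X\<^esub> z" "c = b y \<oplus>\<^bsub>C\<^esub> g z"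
      unfolding G_def by blast
    have "r \<odot>\<^bsub>X\<^esub> x = j (r \<odot>\<^bsub>?P\<^esub> y) \<oplus>\<^bsub>X\<^esub> r \<odot>\<^bsub>X\<^esub> z"
      using * r jc HX by (simp add: mod_hom_smult[OF j(1)] X.smult_r_distr)
    moreover have "r \<odot>\<^bsub>C\<^esub> c = b (r \<odot>\<^bsub>?P\<^esub> y) \<oplus>\<^bsub>C\<^esub> g (r \<odot>\<^bsub>X\<^esub> z)"
      using * r gc mod_hom_closed[OF b(1)] by (simp add: mod_hom_smult[OF b(1)] g_smult C.smult_r_distr)
    ultimately show "G (r \<odot>\<^bsub>X\<^esub> x) (r \<odot>\<^bsub>C\<^esub> c)"
      by (rule GI) (simp_all add: *(1,2) r X.submoduleE(4)[OF Hs])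
  next
    fix c assume "G \<zero>\<^bsub>X\<^esub> c"
    then obtain y z where *: "y \<in> carrier ?P" "z \<in> H" "\<zero>\<^bsub>X\<^esub> = j y \<oplus>\<^bsub>X\<^esub> z" "c = b y \<oplus>\<^bsub>C\<^esub> g z"
      unfolding G_def by blast
    have "\<zero>\<^bsub>A\<^esub> = p (j y \<oplus>\<^bsub>X\<^esub> z)"
      using *(3) mod_hom_zero[OF assms(4,2) p(1)] by simp
    also have "\<dots> = p (j y) \<oplus>\<^bsub>A\<^esub> p z"
      using *(1,2) jc HX by (intro mod_hom_add[OF p(1)]) auto
    also have "\<dots> = ?\<pi> y" using *(1,2) j(2) mod_hom_closed[OF \<pi>] by (simp add: H)
    finally have y: "y \<in> carrier (syz R A)" using *(1) by (simp add: syz_simps)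
    have "c = g (j y \<oplus>\<^bsub>X\<^esub> z)" using *(2,4) b(2)[OF y] jH[OF y] g_add by simp
    then show "c = \<zero>\<^bsub>C\<^esub>"
      using *(3)[symmetric] mod_hom_zero[OF submodule_restrict[OF assms(4) Hs] assms(3) g] by simp
  next
    show "x \<in> carrier X \<and> c \<in> carrier C" if "G x c" for x c
      using that jc HX gc mod_hom_closed[OF b(1)] unfolding G_def by auto
  qed blast
  have "h x = g x" if "x \<in> H" for x
  proof (rule h(2))
    show "G x (g x)" unfolding G_def
      using that HX gc mod_hom_zero[OF P.module_axioms assms(4) j(1)]
        mod_hom_zero[OF P.module_axioms assms(3) b(1)]
      by (intro bexI[of _ "\<zero>\<^bsub>?P\<^esub>"] bexI[of _ x]) auto
  qed
  with h(1) show thesis by (rule that)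
qed

text \<open>
  A lift to \<open>X\<close> exists on the free cover and sends the syzygy into the kernel \<open>H\<close>; subtracting an
  extension of this map to the free cover makes the lift descend to \<open>A\<close>.
\<close>

lemma Ext1_vanishes_lift:
  assumes "module R A" "module R X" "module R Y"
    and p: "p \<in> mod_hom R X Y" "p ` carrier X = carrier Y"
    and H: "H = {x \<in> carrier X. p x = \<zero>\<^bsub>Y\<^esub>}" and ext: "Ext1_vanishes R A (X\<lparr>carrier := H\<rparr>)"
    and f: "f \<in> mod_hom R A Y"
  obtains h where "h \<in> mod_hom R A X" "\<And>a. a \<in> carrier A \<Longrightarrow> p (h a) = f a"
proof -
  let ?P = "free_cover R A" and ?\<pi> = "cover_map R A"
  interpret X: module R X by fact
  interpret Y: module R Y by fact
  interpret A: module R A by fact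
  note P = free_cover_module[OF assms(1)]
  note \<pi> = cover_map_hom[OF assms(1)]
  have Hm: "module R (X\<lparr>carrier := H\<rparr>)"
    unfolding H by (intro submodule_restrict kernel_submodule assms)
  have HX: "\<And>x. x \<in> H \<Longrightarrow> x \<in> carrier X" by (auto simp: H)
  obtain j where j: "j \<in> mod_hom R ?P X" "\<And>x. x \<in> carrier ?P \<Longrightarrow> p (j x) = f (?\<pi> x)"
    using X.free_basis_lift[OF assms(2,3) p mod_hom_comp[OF \<pi> f, unfolded free_cover_def]]
    unfolding free_cover_def by blast
  have "j x \<in> H" if "x \<in> carrier (syz R A)" for x
    using that j(2) mod_hom_closed[OF j(1)] mod_hom_zero[OF assms(1,3) f] by (auto simp: H syz_simps)
  then have "j \<in> mod_hom R (syz R A) (X\<lparr>carrier := H\<rparr>)"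
    using j(1) by (auto simp: mod_hom_def syz_simps)
  then obtain b where b: "b \<in> mod_hom R ?P (X\<lparr>carrier := H\<rparr>)" "\<And>x. x \<in> carrier (syz R A) \<Longrightarrow> b x = j x"
    using bspec[OF ext[unfolded Ext1_vanishes_iff[OF assms(1) Hm]]] by blast
  have bX: "b \<in> mod_hom R ?P X" using b(1) HX by (auto simp: mod_hom_def)
  have bH: "p (b x) = \<zero>\<^bsub>Y\<^esub>" if "x \<in> carrier ?P" for x
    using mod_hom_closed[OF b(1) that] by (simp add: H)
  have "j x \<ominus>\<^bsub>X\<^esub> b x = \<zero>\<^bsub>X\<^esub>" if "x \<in> carrier ?P" "?\<pi> x = \<zero>\<^bsub>A\<^esub>" for x
    using that b(2)[of x] mod_hom_closed[OF bX] mod_hom_closed[OF j(1)]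
    by (simp add: syz_simps X.diff_eq_zero_iff)
  then obtain h where h: "h \<in> mod_hom R A X" "\<And>x. x \<in> carrier ?P \<Longrightarrow> h (?\<pi> x) = j x \<ominus>\<^bsub>X\<^esub> b x"
    using hom_factor[OF P assms(1,2) \<pi> cover_map_onto[OF assms(1)] mod_hom_diff[OF P assms(2) j(1) bX]]
    by metis
  show thesis
  proof (rule that[OF h(1)])
    fix a assume "a \<in> carrier A"
    then obtain x where x: "x \<in> carrier ?P" "a = ?\<pi> x" using cover_map_onto[OF assms(1)] by blast
    show "p (h a) = f a"
      using x mod_hom_closed[OF bX] mod_hom_closed[OF j(1)] mod_hom_closed[OF \<pi> x(1)] mod_hom_closed[OF f]
      by (simp add: h(2) mod_hom_minus[OF assms(2,3) p(1)] j(2) bH) (simp add: a_minus_def)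
  qed
qed

section \<open>Quotients\<close>

lemma (in module) submodule_abelian_subgroup:
  assumes "submodule N R M" shows "abelian_subgroup N M"
  by (intro abelian_subgroupI3 additive_subgroupI submodule.axioms(1)[OF assms] M.abelian_group_axioms)

lemma (in module) coset_eq_iff:
  assumes "submodule N R M" "x \<in> carrier M" "y \<in> carrier M"
  shows "N +>\<^bsub>M\<^esub> x = N +>\<^bsub>M\<^esub> y \<longleftrightarrow> x \<ominus>\<^bsub>M\<^esub> y \<in> N"
proof -
  interpret N: abelian_subgroup N M by (rule submodule_abelian_subgroup) fact
  have "N +>\<^bsub>M\<^esub> x = N +>\<^bsub>M\<^esub> y \<longleftrightarrow> x \<in> N +>\<^bsub>M\<^esub> y"
    using assms(2,3) N.a_repr_independence' N.a_repr_independenceD by (metis N.a_rcos_self)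
  also have "\<dots> \<longleftrightarrow> x \<ominus>\<^bsub>M\<^esub> y \<in> N"
    using assms(2,3) N.a_rcos_module by (simp add: a_minus_def)
  finally show ?thesis .
qed

lemma (in module) coset_mem_iff:
  assumes "submodule N R M" "x \<in> carrier M" "y \<in> carrier M"
  shows "y \<in> N +>\<^bsub>M\<^esub> x \<longleftrightarrow> y \<ominus>\<^bsub>M\<^esub> x \<in> N"
  using abelian_subgroup.a_rcos_module[OF submodule_abelian_subgroup[OF assms(1)]]
    assms(2,3) by (simp add: a_minus_def)

lemma (in module) coset_self: "submodule N R M \<Longrightarrow> x \<in> carrier M \<Longrightarrow> x \<in> N +>\<^bsub>M\<^esub> x"
  using abelian_subgroup.a_rcos_self[OF submodule_abelian_subgroup] .

lemma (in module) coset_subset: "submodule N R M \<Longrightarrow> x \<in> carrier M \<Longrightarrow> N +>\<^bsub>M\<^esub> x \<subseteq> carrier M"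
  using submoduleE(1) a_r_coset_subset_G by blast

lemma (in module) coset_zero: "submodule N R M \<Longrightarrow> N +>\<^bsub>M\<^esub> \<zero>\<^bsub>M\<^esub> = N"
  using submoduleE(1) by simp

lemma (in abelian_group) diff_zero: "x \<in> carrier G \<Longrightarrow> x \<ominus> \<zero> = x"
  by (metis a_minus_def add.inv_equality l_zero r_zero zero_closed)

lemma (in module) coset_eq_zero_iff:
  assumes "submodule N R M" "x \<in> carrier M"
  shows "N +>\<^bsub>M\<^esub> x = N \<longleftrightarrow> x \<in> N"
  using coset_eq_iff[OF assms, of "\<zero>\<^bsub>M\<^esub>"] coset_zero[OF assms(1)] assms(2) by (simp add: M.diff_zero)

text \<open>Operations on cosets are written as unions over all representatives; this evaluates them at one.\<close>

lemma (in module) coset_UN: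
  assumes "submodule N R M" "x \<in> carrier M"
    and "\<And>y. y \<in> carrier M \<Longrightarrow> y \<ominus>\<^bsub>M\<^esub> x \<in> N \<Longrightarrow> f y = f x"
  shows "(\<Union>y\<in>N +>\<^bsub>M\<^esub> x. f y) = f x"
proof (rule SUP_eq_const)
  show "N +>\<^bsub>M\<^esub> x \<noteq> {}" using coset_self[OF assms(1,2)] by blast
  show "f y = f x" if "y \<in> N +>\<^bsub>M\<^esub> x" for y
  proof -
    have "y \<in> carrier M" using coset_subset[OF assms(1,2)] that by blast
    then show ?thesis using coset_mem_iff[OF assms(1,2)] assms(3) that by blast
  qed
qed

lemma (in module) smult_minus_distr:
  "a \<in> carrier R \<Longrightarrow> x \<in> carrier M \<Longrightarrow> y \<in> carrier M
    \<Longrightarrow> a \<odot>\<^bsub>M\<^esub> (x \<ominus>\<^bsub>M\<^esub> y) = a \<odot>\<^bsub>M\<^esub> x \<ominus>\<^bsub>M\<^esub> a \<odot>\<^bsub>M\<^esub> y"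
  by (simp add: a_minus_def smult_r_distr smult_r_minus)

lemma quot_mod_ops:
  assumes "module R M" "submodule N R M"
  shows "carrier (quot_mod M N) = (\<lambda>x. N +>\<^bsub>M\<^esub> x) ` carrier M"
    and "\<zero>\<^bsub>quot_mod M N\<^esub> = N"
    and "x \<in> carrier M \<Longrightarrow> y \<in> carrier M
      \<Longrightarrow> (N +>\<^bsub>M\<^esub> x) \<oplus>\<^bsub>quot_mod M N\<^esub> (N +>\<^bsub>M\<^esub> y) = N +>\<^bsub>M\<^esub> (x \<oplus>\<^bsub>M\<^esub> y)"
    and "a \<in> carrier R \<Longrightarrow> x \<in> carrier M \<Longrightarrow> a \<odot>\<^bsub>quot_mod M N\<^esub> (N +>\<^bsub>M\<^esub> x) = N +>\<^bsub>M\<^esub> (a \<odot>\<^bsub>M\<^esub> x)"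
proof -
  interpret M: module R M by fact
  interpret N: abelian_subgroup N M by (rule M.submodule_abelian_subgroup) fact
  show "carrier (quot_mod M N) = (\<lambda>x. N +>\<^bsub>M\<^esub> x) ` carrier M"
    by (auto simp: quot_mod_def A_RCOSETS_def')
  show "\<zero>\<^bsub>quot_mod M N\<^esub> = N" by (simp add: quot_mod_def)
  show "(N +>\<^bsub>M\<^esub> x) \<oplus>\<^bsub>quot_mod M N\<^esub> (N +>\<^bsub>M\<^esub> y) = N +>\<^bsub>M\<^esub> (x \<oplus>\<^bsub>M\<^esub> y)"
    if "x \<in> carrier M" "y \<in> carrier M"
    using N.a_rcos_sum[OF that] by (simp add: quot_mod_def)
  show "a \<odot>\<^bsub>quot_mod M N\<^esub> (N +>\<^bsub>M\<^esub> x) = N +>\<^bsub>M\<^esub> (a \<odot>\<^bsub>M\<^esub> x)" if "a \<in> carrier R" "x \<in> carrier M"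
  proof -
    have "(\<Union>y\<in>N +>\<^bsub>M\<^esub> x. N +>\<^bsub>M\<^esub> (a \<odot>\<^bsub>M\<^esub> y)) = N +>\<^bsub>M\<^esub> (a \<odot>\<^bsub>M\<^esub> x)"
      using that M.submoduleE(4)[OF assms(2)]
      by (intro M.coset_UN assms(2)) (auto simp: M.coset_eq_iff[OF assms(2)] M.smult_minus_distr[symmetric])
    then show ?thesis by (simp add: quot_mod_def)
  qed
qed

lemma id_ring_hom: "(\<lambda>x. x) \<in> ring_hom R R"
  by (rule ring_hom_memI) auto

lemma quot_mod_module:
  assumes "module R M" "submodule N R M"
  shows "module R (quot_mod M N)"
proof -
  interpret M: module R M by fact
  show ?thesis
    by (rule module_image[OF assms(1) M.R.is_cring id_ring_hom, of "\<lambda>x. N +>\<^bsub>M\<^esub> x"])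
      (simp_all add: quot_mod_ops[OF assms] M.coset_zero[OF assms(2)])
qed

lemma quot_proj_hom:
  assumes "module R M" "submodule N R M"
  shows "(\<lambda>x. N +>\<^bsub>M\<^esub> x) \<in> mod_hom R M (quot_mod M N)"
  by (intro mod_homI) (simp_all add: quot_mod_ops[OF assms])

section \<open>Tensor products\<close>

definition bilinear_map ::
  "('r, 'k) ring_scheme \<Rightarrow> ('r, 'm) module \<Rightarrow> ('r, 'n) module \<Rightarrow> ('r, 'x) module
    \<Rightarrow> ('m \<Rightarrow> 'n \<Rightarrow> 'x) \<Rightarrow> bool" where
  "bilinear_map R M N X B \<longleftrightarrow>
    (\<forall>y\<in>carrier N. (\<lambda>x. B x y) \<in> mod_hom R M X) \<and> (\<forall>x\<in>carrier M. B x \<in> mod_hom R N X)"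

lemma span_submodule:
  assumes "module R M" "A \<subseteq> carrier M"
  shows "submodule (submod_span R M A) R M" "A \<subseteq> submod_span R M A"
    "submodule N R M \<Longrightarrow> A \<subseteq> N \<Longrightarrow> submod_span R M A \<subseteq> N"
proof -
  interpret M: module R M by fact
  have "submodule (carrier M) R M" by (rule M.carrier_is_submodule)
  then have car: "submod_span R M A \<subseteq> carrier M" using assms(2) by (auto simp: submod_span_def)
  have zero: "\<zero>\<^bsub>M\<^esub> \<in> N" if "submodule N R M" for N
    using subgroup.one_closed[OF submodule.axioms(1)[OF that]] by simp
  show "submodule (submod_span R M A) R M"
    using M.submoduleE(3,4,5) zero by (intro M.submoduleI car) (simp_all add: submod_span_def)
qed (auto simp: submod_span_def)

context
  fixes R :: "('r, 'k) ring_scheme" and M :: "('r, 'm) module" and N :: "('r, 'n) module"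
  assumes R: "cring R"
begin

abbreviation (input) "pairs_free \<equiv> free_mod R (carrier M \<times> carrier N)"

lemma tensor_rels_submodule:
  assumes "module R M" "module R N"
  shows "submodule (tensor_rels R M N) R pairs_free"
proof -
  interpret M: module R M by fact
  interpret N: module R N by fact
  interpret T: module R "pairs_free" by (rule M.R.free_mod_module)
  have [simp]: "free_basis R (x, y) \<in> carrier pairs_free" if "x \<in> carrier M" "y \<in> carrier N" for x y
    using that by (intro M.R.free_basis_closed) auto
  show ?thesis unfolding tensor_rels_def Let_def
    by (rule span_submodule(1)[OF T.module_axioms]) auto
qed

lemma tensor_module: "module R M \<Longrightarrow> module R N \<Longrightarrow> module R (tensor R M N)"
  unfolding tensor_def by (intro quot_mod_module cring.free_mod_module R tensor_rels_submodule)

lemma tensor_proj_hom: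
  assumes "module R M" "module R N"
  shows "(\<lambda>\<phi>. tensor_rels R M N +>\<^bsub>pairs_free\<^esub> \<phi>) \<in> mod_hom R pairs_free (tensor R M N)"
  unfolding tensor_def by (intro quot_proj_hom cring.free_mod_module R tensor_rels_submodule assms)

lemma tensor_carrier:
  assumes "module R M" "module R N"
  shows "carrier (tensor R M N) = (\<lambda>\<phi>. tensor_rels R M N +>\<^bsub>pairs_free\<^esub> \<phi>) ` carrier pairs_free"
  unfolding tensor_def
  by (rule quot_mod_ops(1)[OF cring.free_mod_module[OF R] tensor_rels_submodule[OF assms]])

lemma pure_tensor_bilinear:
  assumes "module R M" "module R N"
  shows "bilinear_map R M N (tensor R M N) (pure_tensor R M N)"
proof -
  interpret M: module R M by fact
  interpret N: module R N by fact
  interpret T: module R "pairs_free" by (rule M.R.free_mod_module)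
  have e [simp]: "free_basis R (x, y) \<in> carrier pairs_free" if "x \<in> carrier M" "y \<in> carrier N" for x y
    using that by (intro M.R.free_basis_closed) auto
  let ?gen = "{free_basis R (x \<oplus>\<^bsub>M\<^esub> x', y) \<ominus>\<^bsub>pairs_free\<^esub>
        (free_basis R (x, y) \<oplus>\<^bsub>pairs_free\<^esub> free_basis R (x', y)) | x x' y.
          x \<in> carrier M \<and> x' \<in> carrier M \<and> y \<in> carrier N} \<union>
       {free_basis R (x, y \<oplus>\<^bsub>N\<^esub> y') \<ominus>\<^bsub>pairs_free\<^esub>
        (free_basis R (x, y) \<oplus>\<^bsub>pairs_free\<^esub> free_basis R (x, y')) | x y y'.
          x \<in> carrier M \<and> y \<in> carrier N \<and> y' \<in> carrier N} \<union>
       {free_basis R (a \<odot>\<^bsub>M\<^esub> x, y) \<ominus>\<^bsub>pairs_free\<^esub> a \<odot>\<^bsub>pairs_free\<^esub> free_basis R (x, y) | a x y.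
          a \<in> carrier R \<and> x \<in> carrier M \<and> y \<in> carrier N} \<union>
       {free_basis R (x, a \<odot>\<^bsub>N\<^esub> y) \<ominus>\<^bsub>pairs_free\<^esub> a \<odot>\<^bsub>pairs_free\<^esub> free_basis R (x, y) | a x y.
          a \<in> carrier R \<and> x \<in> carrier M \<and> y \<in> carrier N}"
  have "?gen \<subseteq> carrier pairs_free" by auto
  then have sub: "?gen \<subseteq> tensor_rels R M N"
    unfolding tensor_rels_def Let_def by (rule span_submodule(2)[OF T.module_axioms])
  note S = tensor_rels_submodule[OF assms]
  note proj = tensor_proj_hom[OF assms]
  note ceq = T.coset_eq_iff[OF S]
  have add1: "pure_tensor R M N (x \<oplus>\<^bsub>M\<^esub> x') y = pure_tensor R M N x y \<oplus>\<^bsub>tensor R M N\<^esub> pure_tensor R M N x' y"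
    if "x \<in> carrier M" "x' \<in> carrier M" "y \<in> carrier N" for x x' y
    unfolding pure_tensor_def using that
    by (subst mod_hom_add[OF proj, symmetric]) (auto simp: ceq intro!: subsetD[OF sub])
  have add2: "pure_tensor R M N x (y \<oplus>\<^bsub>N\<^esub> y') = pure_tensor R M N x y \<oplus>\<^bsub>tensor R M N\<^esub> pure_tensor R M N x y'"
    if "x \<in> carrier M" "y' \<in> carrier N" "y \<in> carrier N" for x y y'
    unfolding pure_tensor_def using that
    by (subst mod_hom_add[OF proj, symmetric]) (auto simp: ceq intro!: subsetD[OF sub])
  have sm1: "pure_tensor R M N (a \<odot>\<^bsub>M\<^esub> x) y = a \<odot>\<^bsub>tensor R M N\<^esub> pure_tensor R M N x y"
    if "x \<in> carrier M" "y \<in> carrier N" "a \<in> carrier R" for x y a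
    unfolding pure_tensor_def using that
    by (subst mod_hom_smult[OF proj, symmetric]) (auto simp: ceq intro!: subsetD[OF sub])
  have sm2: "pure_tensor R M N x (a \<odot>\<^bsub>N\<^esub> y) = a \<odot>\<^bsub>tensor R M N\<^esub> pure_tensor R M N x y"
    if "x \<in> carrier M" "y \<in> carrier N" "a \<in> carrier R" for x y a
    unfolding pure_tensor_def using that
    by (subst mod_hom_smult[OF proj, symmetric]) (auto simp: ceq intro!: subsetD[OF sub])
  have cl: "pure_tensor R M N x y \<in> carrier (tensor R M N)" if "x \<in> carrier M" "y \<in> carrier N" for x y
    unfolding pure_tensor_def using that by (intro mod_hom_closed[OF proj]) auto
  show ?thesis
    unfolding bilinear_map_def by (intro conjI ballI mod_homI) (simp_all add: add1 add2 sm1 sm2 cl)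
qed

lemma pure_tensor_closed:
  assumes "module R M" "module R N" "x \<in> carrier M" "y \<in> carrier N"
  shows "pure_tensor R M N x y \<in> carrier (tensor R M N)"
  using pure_tensor_bilinear[OF assms(1,2)] assms(3,4)
  by (auto simp: bilinear_map_def intro: mod_hom_closed)

lemma tensor_hom_eqI:
  assumes "module R M" "module R N" "module R X"
    and f: "f \<in> mod_hom R (tensor R M N) X" and g: "g \<in> mod_hom R (tensor R M N) X"
    and eq: "\<And>x y. x \<in> carrier M \<Longrightarrow> y \<in> carrier N
      \<Longrightarrow> f (pure_tensor R M N x y) = g (pure_tensor R M N x y)"
    and Z: "Z \<in> carrier (tensor R M N)"
  shows "f Z = g Z"
proof -
  interpret M: module R M by fact
  obtain \<phi> where \<phi>: "\<phi> \<in> carrier pairs_free" "Z = tensor_rels R M N +>\<^bsub>pairs_free\<^esub> \<phi>"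
    using Z tensor_carrier[OF assms(1,2)] by auto
  note proj = tensor_proj_hom[OF assms(1,2)]
  show ?thesis unfolding \<phi>(2)
    by (rule M.R.free_hom_eqI[OF assms(3) mod_hom_comp[OF proj f] mod_hom_comp[OF proj g] _ \<phi>(1)])
      (use eq in \<open>auto simp: pure_tensor_def\<close>)
qed

text \<open>
  The linear extension of a bilinear map kills the generators of the relations, so its image of a
  class is a singleton.
\<close>

lemma tensor_descend:
  assumes "module R M" "module R N" "module R X" and B: "bilinear_map R M N X B"
  defines "b \<equiv> (\<lambda>Z. the_elem (lin_ext R X (\<lambda>(x, y). B x y) ` Z))"
  shows "b \<in> mod_hom R (tensor R M N) X"
    and "x \<in> carrier M \<Longrightarrow> y \<in> carrier N \<Longrightarrow> b (pure_tensor R M N x y) = B x y"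
proof -
  interpret M: module R M by fact
  interpret N: module R N by fact
  interpret X: module R X by fact
  interpret T: module R "pairs_free" by (rule M.R.free_mod_module)
  let ?l = "lin_ext R X (\<lambda>(x, y). B x y)"
  note S = tensor_rels_submodule[OF assms(1,2)]
  have Bc: "B x y \<in> carrier X" if "x \<in> carrier M" "y \<in> carrier N" for x y
    using that B by (auto simp: bilinear_map_def intro: mod_hom_closed)
  have l: "?l \<in> mod_hom R pairs_free X"
    using Bc by (intro M.R.lin_ext_hom assms(3)) auto
  have lb: "?l (free_basis R (x, y)) = B x y" if "x \<in> carrier M" "y \<in> carrier N" for x y
    using that Bc by (subst M.R.lin_ext_basis[OF assms(3), where A = "carrier M \<times> carrier N"]) auto
  have e [simp]: "free_basis R (x, y) \<in> carrier pairs_free" if "x \<in> carrier M" "y \<in> carrier N" for x y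
    using that by (intro M.R.free_basis_closed) auto
  note lsimps = mod_hom_minus[OF T.module_axioms assms(3) l] mod_hom_add[OF l] mod_hom_smult[OF l] lb
  have B_lin: "\<And>x x' y. x \<in> carrier M \<Longrightarrow> x' \<in> carrier M \<Longrightarrow> y \<in> carrier N
      \<Longrightarrow> B (x \<oplus>\<^bsub>M\<^esub> x') y = B x y \<oplus>\<^bsub>X\<^esub> B x' y"
    "\<And>x y y'. x \<in> carrier M \<Longrightarrow> y \<in> carrier N \<Longrightarrow> y' \<in> carrier N
      \<Longrightarrow> B x (y \<oplus>\<^bsub>N\<^esub> y') = B x y \<oplus>\<^bsub>X\<^esub> B x y'"
    "\<And>a x y. a \<in> carrier R \<Longrightarrow> x \<in> carrier M \<Longrightarrow> y \<in> carrier N \<Longrightarrow> B (a \<odot>\<^bsub>M\<^esub> x) y = a \<odot>\<^bsub>X\<^esub> B x y"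
    "\<And>a x y. a \<in> carrier R \<Longrightarrow> x \<in> carrier M \<Longrightarrow> y \<in> carrier N \<Longrightarrow> B x (a \<odot>\<^bsub>N\<^esub> y) = a \<odot>\<^bsub>X\<^esub> B x y"
    using B by (auto simp: bilinear_map_def mod_hom_def)
  have "tensor_rels R M N \<subseteq> {\<phi> \<in> carrier pairs_free. ?l \<phi> = \<zero>\<^bsub>X\<^esub>}"
    unfolding tensor_rels_def Let_def
    by (intro span_submodule(3) kernel_submodule T.module_axioms assms(3) l)
      (auto simp: lsimps B_lin Bc X.diff_eq_zero_iff)
  then have kill: "?l \<phi> = \<zero>\<^bsub>X\<^esub>" if "\<phi> \<in> tensor_rels R M N" for \<phi> using that by blast
  have b: "b (tensor_rels R M N +>\<^bsub>pairs_free\<^esub> \<phi>) = ?l \<phi>" if \<phi>: "\<phi> \<in> carrier pairs_free" for \<phi>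
  proof -
    have "?l \<psi> = ?l \<phi>" if "\<psi> \<in> tensor_rels R M N +>\<^bsub>pairs_free\<^esub> \<phi>" for \<psi>
    proof -
      have \<psi>: "\<psi> \<in> carrier pairs_free" using that T.coset_subset[OF S \<phi>] by blast
      then have "?l (\<psi> \<ominus>\<^bsub>pairs_free\<^esub> \<phi>) = \<zero>\<^bsub>X\<^esub>" using that \<phi> kill by (simp add: T.coset_mem_iff[OF S])
      then show ?thesis using \<phi> \<psi> mod_hom_closed[OF l]
        by (simp add: mod_hom_minus[OF T.module_axioms assms(3) l] X.diff_eq_zero_iff)
    qed
    then have "?l ` (tensor_rels R M N +>\<^bsub>pairs_free\<^esub> \<phi>) = {?l \<phi>}"
      using T.coset_self[OF S \<phi>] by blast
    then show ?thesis by (simp add: b_def)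
  qed
  note proj = tensor_proj_hom[OF assms(1,2)]
  have ex: "\<exists>\<phi>\<in>carrier pairs_free. Z = tensor_rels R M N +>\<^bsub>pairs_free\<^esub> \<phi>" if "Z \<in> carrier (tensor R M N)" for Z
    using that tensor_carrier[OF assms(1,2)] by auto
  show "b \<in> mod_hom R (tensor R M N) X"
  proof (rule mod_homI)
    fix Z assume Z: "Z \<in> carrier (tensor R M N)"
    then obtain \<phi> where \<phi>: "\<phi> \<in> carrier pairs_free" "Z = tensor_rels R M N +>\<^bsub>pairs_free\<^esub> \<phi>"
      using ex by blast
    show "b Z \<in> carrier X" using \<phi> mod_hom_closed[OF l] by (simp add: b)
    show "b (a \<odot>\<^bsub>tensor R M N\<^esub> Z) = a \<odot>\<^bsub>X\<^esub> b Z" if "a \<in> carrier R" for a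
      using \<phi> that by (simp add: mod_hom_smult[OF proj, symmetric] b mod_hom_smult[OF l])
    fix Y assume "Y \<in> carrier (tensor R M N)"
    then obtain \<psi> where \<psi>: "\<psi> \<in> carrier pairs_free" "Y = tensor_rels R M N +>\<^bsub>pairs_free\<^esub> \<psi>"
      using ex by blast
    show "b (Z \<oplus>\<^bsub>tensor R M N\<^esub> Y) = b Z \<oplus>\<^bsub>X\<^esub> b Y"
      using \<phi> \<psi> by (simp add: mod_hom_add[OF proj, symmetric] b mod_hom_add[OF l])
  qed
  show "b (pure_tensor R M N x y) = B x y" if "x \<in> carrier M" "y \<in> carrier N"
    using that by (simp add: pure_tensor_def b lb)
qed

end

lemma bilinear_map_compose:
  assumes "bilinear_map R N F X B" "f \<in> mod_hom R M N"
  shows "bilinear_map R M F X (\<lambda>x y. B (f x) y)"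
  using assms mod_hom_closed[OF assms(2)] unfolding bilinear_map_def
  by (auto intro: mod_hom_comp[OF assms(2)])

lemma tensor_map:
  assumes "cring R" "module R M" "module R N" "module R F" "f \<in> mod_hom R M N"
  shows "tensor_map R F N f \<in> mod_hom R (tensor R M F) (tensor R N F)"
    and "x \<in> carrier M \<Longrightarrow> y \<in> carrier F
      \<Longrightarrow> tensor_map R F N f (pure_tensor R M F x y) = pure_tensor R N F (f x) y"
proof -
  note B = bilinear_map_compose[OF pure_tensor_bilinear[OF assms(1,3,4)] assms(5)]
  note d = tensor_descend[OF assms(1,2,4) tensor_module[OF assms(1,3,4)] B]
  show "tensor_map R F N f \<in> mod_hom R (tensor R M F) (tensor R N F)"
    using d(1) by (simp add: tensor_map_def[abs_def])
  show "x \<in> carrier M \<Longrightarrow> y \<in> carrier F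
      \<Longrightarrow> tensor_map R F N f (pure_tensor R M F x y) = pure_tensor R N F (f x) y"
    using d(2) by (simp add: tensor_map_def)
qed

section \<open>Flatness\<close>

text \<open>
  Flatness and projectivity quantify over modules on one fixed type \<open>'u\<close>; replacing a module by a
  copy along an injection into \<open>'u\<close> makes them applicable to it.
\<close>

definition copy_mod :: "('m \<Rightarrow> 'u) \<Rightarrow> ('r, 'm) module \<Rightarrow> ('r, 'u) module" where
  "copy_mod i M =
    \<lparr>carrier = i ` carrier M, mult = undefined, one = undefined, zero = i \<zero>\<^bsub>M\<^esub>,
     add = (\<lambda>x y. i (inv_into (carrier M) i x \<oplus>\<^bsub>M\<^esub> inv_into (carrier M) i y)),
     smult = (\<lambda>a x. i (a \<odot>\<^bsub>M\<^esub> inv_into (carrier M) i x))\<rparr>"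

lemma copy_mod:
  assumes "module R M" "inj_on i (carrier M)"
  shows "module R (copy_mod i M)" "carrier (copy_mod i M) = i ` carrier M"
    "i \<in> mod_hom R M (copy_mod i M)" "inv_into (carrier M) i \<in> mod_hom R (copy_mod i M) M"
proof -
  interpret M: module R M by fact
  show "carrier (copy_mod i M) = i ` carrier M" by (simp add: copy_mod_def)
  show "module R (copy_mod i M)"
    by (rule module_image[OF assms(1) M.R.is_cring id_ring_hom, of i])
      (simp_all add: copy_mod_def inv_into_f_f[OF assms(2)])
  show "i \<in> mod_hom R M (copy_mod i M)"
    by (intro mod_homI) (simp_all add: copy_mod_def inv_into_f_f[OF assms(2)])
  show "inv_into (carrier M) i \<in> mod_hom R (copy_mod i M) M"
    by (intro mod_homI) (auto simp: copy_mod_def inv_into_f_f[OF assms(2)])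
qed



definition ring_mod :: "('r, 'k) ring_scheme \<Rightarrow> ('r, 'r) module" where
  "ring_mod R = \<lparr>carrier = carrier R, mult = mult R, one = one R, zero = zero R, add = add R,
    smult = mult R\<rparr>"

lemma ring_mod_simps [simp]:
  "carrier (ring_mod R) = carrier R" "zero (ring_mod R) = zero R" "add (ring_mod R) = add R"
  "smult (ring_mod R) = mult R"
  by (simp_all add: ring_mod_def)

lemma (in cring) ring_mod_module: "module R (ring_mod R)"
proof (rule moduleI)
  show "abelian_group (ring_mod R)"
    by (rule abelian_groupI) (auto simp: a_ac intro: bexI[of _ "\<ominus> x" for x] l_neg)
qed (auto simp: l_distr r_distr m_assoc is_cring)

lemma (in cring) ideal_submodule:
  assumes "ideal I R" shows "submodule I R (ring_mod R)"
proof -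
  interpret I: ideal I R by fact
  show ?thesis
  proof (rule module.submoduleI[OF ring_mod_module])
    show "\<ominus>\<^bsub>ring_mod R\<^esub> a \<in> I" if "a \<in> I" for a
      using that I.I_l_closed[OF that, of "\<ominus> \<one>"] module.neg_eq_smult[OF ring_mod_module, of a]
        I.Icarr[OF that] by simp
  qed (auto simp: I.Icarr I.I_l_closed)
qed

lemma mod_hom_finsum:
  assumes "module R M" "module R N" "f \<in> mod_hom R M N" "finite A" "g \<in> A \<rightarrow> carrier M"
  shows "f (\<Oplus>\<^bsub>M\<^esub>x\<in>A. g x) = (\<Oplus>\<^bsub>N\<^esub>x\<in>A. f (g x))"
proof -
  interpret M: module R M by fact
  interpret N: module R N by fact
  show ?thesis using assms(4,5)
  proof (induction rule: finite_induct)
    case empty then show ?case using mod_hom_zero[OF assms(1-3)] by simp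
  next
    case (insert x A)
    then show ?case using mod_hom_closed[OF assms(3)]
      by (simp add: M.finsum_insert N.finsum_insert mod_hom_add[OF assms(3)] Pi_def M.finsum_closed)
  qed
qed

text \<open>
  For \<open>\<phi>\<close> in the kernel of \<open>P \<rightarrow> F\<close> with coefficients in \<open>I\<close>, the element \<open>\<Sum> \<phi> x \<otimes> x\<close> of \<open>I \<otimes> F\<close> maps
  to zero in \<open>R \<otimes> F\<close>, so it is zero by flatness. Its image under \<open>a \<otimes> y \<mapsto> a [y]\<close>, which is
  well-defined as a map \<open>I \<otimes> F \<rightarrow> P / N\<close>, is the class of \<open>\<phi>\<close>.
\<close>

lemma flat_kernel_coeffs:
  fixes i :: "'r \<Rightarrow> 'u" and R :: "('r, 'k) ring_scheme" and F :: "('r, 'f) module"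
  assumes flat: "flat_mod R F TYPE('u)" and i: "inj i"
    and I: "ideal I R" and N: "submodule N R (free_cover R F)"
    and IN: "\<And>a k. a \<in> I \<Longrightarrow> k \<in> carrier (syz R F) \<Longrightarrow> a \<odot>\<^bsub>free_cover R F\<^esub> k \<in> N"
    and \<phi>: "\<phi> \<in> carrier (syz R F)" "\<And>x. \<phi> x \<in> I"
  shows "\<phi> \<in> N"
proof -
  have F: "module R F" using flat by (simp add: flat_mod_def)
  interpret F: module R F by fact
  let ?P = "free_cover R F"
  interpret P: module R ?P by (rule free_cover_module[OF F])
  let ?RM = "ring_mod R" and ?IM = "(ring_mod R)\<lparr>carrier := I\<rparr>"
  note RM = F.R.ring_mod_module
  have IM: "module R ?IM" by (rule submodule_restrict[OF RM F.R.ideal_submodule[OF I]])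
  have IR: "\<And>a. a \<in> I \<Longrightarrow> a \<in> carrier R" by (rule ideal.Icarr[OF I])
  have injs: "inj_on i (carrier ?IM)" "inj_on i (carrier ?RM)" using i by (auto intro: inj_on_subset)
  note M = copy_mod[OF IM injs(1)] and L = copy_mod[OF RM injs(2)]
  let ?M = "copy_mod i ?IM" and ?L = "copy_mod i ?RM"
  have cM [simp]: "carrier ?M = i ` I" and cL [simp]: "carrier ?L = i ` carrier R"
    by (simp_all add: M(2) L(2))
  \<comment> \<open>As both copies are made with \<open>i\<close>, the inclusion of \<open>I\<close> into \<open>R\<close> becomes the identity map.\<close>
  have incl: "(\<lambda>x. x) \<in> mod_hom R ?M ?L"
  proof (rule mod_hom_cong[OF M(1)])
    show "(\<lambda>x. i (inv_into (carrier ?IM) i x)) \<in> mod_hom R ?M ?L"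
      by (rule mod_hom_comp[OF M(4)], insert L(3) IR) (auto simp: mod_hom_def)
  qed (auto intro: f_inv_into_f[symmetric])
  have inj: "inj_on (tensor_map R F ?L (\<lambda>x. x)) (carrier (tensor R ?M F))"
    using flat M(1) L(1) incl unfolding flat_mod_def by (metis inj_on_id2)
  note TM = tensor_module[OF F.R.is_cring M(1) F] and TL = tensor_module[OF F.R.is_cring L(1) F]
  interpret TM: module R "tensor R ?M F" by (rule TM)
  interpret TL: module R "tensor R ?L F" by (rule TL)
  note BM = pure_tensor_bilinear[OF F.R.is_cring M(1) F]
    and BL = pure_tensor_bilinear[OF F.R.is_cring L(1) F]
  let ?A = "{x. \<phi> x \<noteq> \<zero>\<^bsub>R\<^esub>}"
  have \<phi>P: "\<phi> \<in> carrier ?P" "cover_map R F \<phi> = \<zero>\<^bsub>F\<^esub>" using \<phi>(1) by (auto simp: syz_simps)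
  have A: "finite ?A" "?A \<subseteq> carrier F"
    using \<phi>P(1) by (auto simp: free_cover_def free_mod_carrier)
  have \<phi>R: "\<And>x. \<phi> x \<in> carrier R" using \<phi>(2) IR by blast
  define z where "z = (\<Oplus>\<^bsub>tensor R ?M F\<^esub>x\<in>?A. pure_tensor R ?M F (i (\<phi> x)) x)"
  have pt: "(\<lambda>x. pure_tensor R ?M F (i (\<phi> x)) x) \<in> ?A \<rightarrow> carrier (tensor R ?M F)"
    using A \<phi>(2) by (auto intro!: pure_tensor_closed[OF F.R.is_cring M(1) F])
  have z: "z \<in> carrier (tensor R ?M F)" unfolding z_def by (rule TM.finsum_closed[OF pt])
  note tm = tensor_map[OF F.R.is_cring M(1) L(1) F incl]
  have one: "i \<one>\<^bsub>R\<^esub> \<in> carrier ?L" by simp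
  then have Bone: "pure_tensor R ?L F (i \<one>\<^bsub>R\<^esub>) \<in> mod_hom R F (tensor R ?L F)"
    using BL by (simp only: bilinear_map_def)
  have "tensor_map R F ?L (\<lambda>x. x) z = (\<Oplus>\<^bsub>tensor R ?L F\<^esub>x\<in>?A. pure_tensor R ?L F (i (\<phi> x)) x)"
    unfolding z_def mod_hom_finsum[OF TM TL tm(1) A(1) pt]
    using A \<phi>(2) \<phi>R by (intro TL.finsum_cong')
      (auto intro!: tm(2) pure_tensor_closed[OF F.R.is_cring L(1) F])
  also have "\<dots> = (\<Oplus>\<^bsub>tensor R ?L F\<^esub>x\<in>?A. pure_tensor R ?L F (i \<one>\<^bsub>R\<^esub>) (\<phi> x \<odot>\<^bsub>F\<^esub> x))"
  proof (rule TL.finsum_cong')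
    fix x assume x: "x \<in> ?A"
    then have xF: "x \<in> carrier F" using A by blast
    have "i (\<phi> x) = \<phi> x \<odot>\<^bsub>?L\<^esub> i \<one>\<^bsub>R\<^esub>"
      using mod_hom_smult[OF L(3), of "\<phi> x" "\<one>\<^bsub>R\<^esub>"] \<phi>R by simp
    then have "pure_tensor R ?L F (i (\<phi> x)) x = \<phi> x \<odot>\<^bsub>tensor R ?L F\<^esub> pure_tensor R ?L F (i \<one>\<^bsub>R\<^esub>) x"
      using mod_hom_smult[of "\<lambda>m. pure_tensor R ?L F m x", OF _ \<phi>R[of x] one] BL xF
      by (simp add: bilinear_map_def)
    then show "pure_tensor R ?L F (i (\<phi> x)) x = pure_tensor R ?L F (i \<one>\<^bsub>R\<^esub>) (\<phi> x \<odot>\<^bsub>F\<^esub> x)"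
      using mod_hom_smult[OF Bone \<phi>R xF] by simp
  qed (use A \<phi>R mod_hom_closed[OF Bone] in auto)
  also have "\<dots> = pure_tensor R ?L F (i \<one>\<^bsub>R\<^esub>) (\<Oplus>\<^bsub>F\<^esub>x\<in>?A. \<phi> x \<odot>\<^bsub>F\<^esub> x)"
    using A \<phi>R by (subst mod_hom_finsum[OF F TL Bone A(1)]) auto
  also have "(\<Oplus>\<^bsub>F\<^esub>x\<in>?A. \<phi> x \<odot>\<^bsub>F\<^esub> x) = \<zero>\<^bsub>F\<^esub>"
    using \<phi>P(2) by (simp add: cover_map_def lin_ext_def)
  also have "pure_tensor R ?L F (i \<one>\<^bsub>R\<^esub>) \<zero>\<^bsub>F\<^esub> = \<zero>\<^bsub>tensor R ?L F\<^esub>"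
    by (rule mod_hom_zero[OF F TL Bone])
  also have "\<dots> = tensor_map R F ?L (\<lambda>x. x) \<zero>\<^bsub>tensor R ?M F\<^esub>"
    by (rule mod_hom_zero[OF TM TL tm(1), symmetric])
  finally have z0: "z = \<zero>\<^bsub>tensor R ?M F\<^esub>" using inj z by (auto dest: inj_onD)
  let ?Q = "quot_mod ?P N" and ?p = "\<lambda>x. N +>\<^bsub>?P\<^esub> x"
  note Q = quot_mod_module[OF P.module_axioms N] and p = quot_proj_hom[OF P.module_axioms N]
  interpret Q: module R ?Q by (rule Q)
  let ?j = "inv_into I i"
  have j: "?j \<in> mod_hom R ?M ?IM" using M(4) by simp
  have jI: "?j m \<in> I" if "m \<in> i ` I" for m using that by (rule inv_into_into)
  \<comment> \<open>The map \<open>a \<otimes> y \<mapsto> a [y]\<close> is additive in \<open>y\<close> because \<open>[y + y'] - [y] - [y']\<close> lies in the kernel,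
    which elements of \<open>I\<close> multiply into \<open>N\<close>.\<close>
  define e where "e = (free_basis R :: 'f \<Rightarrow> 'f \<Rightarrow> 'r)"
  have e [simp]: "e y \<in> carrier ?P" if "y \<in> carrier F" for y
    using that unfolding e_def free_cover_def by (rule F.R.free_basis_closed)
  have \<pi>e: "cover_map R F (e y) = y" if "y \<in> carrier F" for y
    using that unfolding e_def by (rule cover_map_basis[OF F])
  note \<pi> = cover_map_hom[OF F]
  define B where "B m y = ?p (?j m \<odot>\<^bsub>?P\<^esub> e y)" for m y
  have move: "?p (a \<odot>\<^bsub>?P\<^esub> u) = ?p (a \<odot>\<^bsub>?P\<^esub> v)"
    if "a \<in> I" "u \<in> carrier ?P" "v \<in> carrier ?P" "cover_map R F u = cover_map R F v" for a u v
  proof -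
    have "u \<ominus>\<^bsub>?P\<^esub> v \<in> carrier (syz R F)"
      using that mod_hom_closed[OF \<pi>]
      by (simp add: syz_simps mod_hom_minus[OF P.module_axioms F \<pi>] F.diff_eq_zero_iff)
    then have "a \<odot>\<^bsub>?P\<^esub> (u \<ominus>\<^bsub>?P\<^esub> v) \<in> N" using IN that by blast
    then show ?thesis using that IR by (simp add: P.coset_eq_iff[OF N] P.smult_minus_distr)
  qed
  have bil: "bilinear_map R ?M F ?Q B"
    unfolding bilinear_map_def
  proof (intro conjI ballI)
    fix y assume y: "y \<in> carrier F"
    have "(\<lambda>a. a \<odot>\<^bsub>?P\<^esub> e y) \<in> mod_hom R ?IM ?P"
      using y IR by (intro mod_homI) (auto simp: P.smult_l_distr P.smult_assoc1)
    from mod_hom_comp[OF mod_hom_comp[OF j this] p]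
    show "(\<lambda>m. B m y) \<in> mod_hom R ?M ?Q" by (simp add: B_def)
  next
    fix m assume "m \<in> carrier ?M"
    then have a: "?j m \<in> I" "?j m \<in> carrier R" using jI IR by auto
    show "B m \<in> mod_hom R F ?Q"
    proof (rule mod_homI)
      fix y assume y: "y \<in> carrier F"
      show "B m y \<in> carrier ?Q" unfolding B_def using y a by (intro mod_hom_closed[OF p]) auto
      show "B m (y \<oplus>\<^bsub>F\<^esub> y') = B m y \<oplus>\<^bsub>?Q\<^esub> B m y'" if y': "y' \<in> carrier F" for y'
      proof -
        have "B m (y \<oplus>\<^bsub>F\<^esub> y') = ?p (?j m \<odot>\<^bsub>?P\<^esub> (e y \<oplus>\<^bsub>?P\<^esub> e y'))"
          unfolding B_def using a y y' by (intro move) (auto simp: \<pi>e mod_hom_add[OF \<pi>])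
        also have "\<dots> = B m y \<oplus>\<^bsub>?Q\<^esub> B m y'"
          unfolding B_def using a y y' by (simp add: P.smult_r_distr mod_hom_add[OF p])
        finally show ?thesis .
      qed
      show "B m (r \<odot>\<^bsub>F\<^esub> y) = r \<odot>\<^bsub>?Q\<^esub> B m y" if r: "r \<in> carrier R" for r
      proof -
        have "B m (r \<odot>\<^bsub>F\<^esub> y) = ?p (?j m \<odot>\<^bsub>?P\<^esub> (r \<odot>\<^bsub>?P\<^esub> e y))"
          unfolding B_def using a y r by (intro move) (auto simp: \<pi>e mod_hom_smult[OF \<pi>])
        also have "?j m \<odot>\<^bsub>?P\<^esub> (r \<odot>\<^bsub>?P\<^esub> e y) = r \<odot>\<^bsub>?P\<^esub> (?j m \<odot>\<^bsub>?P\<^esub> e y)"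
          using a y r by (simp add: P.smult_assoc1[symmetric] F.R.m_comm)
        also have "?p \<dots> = r \<odot>\<^bsub>?Q\<^esub> B m y"
          unfolding B_def using a y r by (simp add: mod_hom_smult[OF p])
        finally show ?thesis .
      qed
    qed
  qed
  obtain b where b: "b \<in> mod_hom R (tensor R ?M F) ?Q"
    "\<And>m y. m \<in> carrier ?M \<Longrightarrow> y \<in> carrier F \<Longrightarrow> b (pure_tensor R ?M F m y) = B m y"
    using tensor_descend[OF F.R.is_cring M(1) F Q bil] by blast
  have eA: "(\<lambda>x. \<phi> x \<odot>\<^bsub>?P\<^esub> e x) \<in> ?A \<rightarrow> carrier ?P" using A \<phi>R by auto
  have "b z = (\<Oplus>\<^bsub>?Q\<^esub>x\<in>?A. b (pure_tensor R ?M F (i (\<phi> x)) x))"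
    unfolding z_def by (rule mod_hom_finsum[OF TM Q b(1) A(1) pt])
  also have "\<dots> = (\<Oplus>\<^bsub>?Q\<^esub>x\<in>?A. ?p (\<phi> x \<odot>\<^bsub>?P\<^esub> e x))"
    using A \<phi>(2) \<phi>R mod_hom_closed[OF p]
    by (intro Q.finsum_cong') (auto simp: b(2) B_def inv_into_f_f inj_on_subset[OF i] subset_iff)
  also have "\<dots> = ?p (\<Oplus>\<^bsub>?P\<^esub>x\<in>?A. \<phi> x \<odot>\<^bsub>?P\<^esub> e x)"
    by (rule mod_hom_finsum[OF P.module_axioms Q p A(1) eA, symmetric])
  also have "(\<Oplus>\<^bsub>?P\<^esub>x\<in>?A. \<phi> x \<odot>\<^bsub>?P\<^esub> e x) = \<phi>"
  proof -
    have "lin_ext R ?P e \<phi> = \<phi>"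
    proof (rule F.R.free_hom_eqI[OF P.module_axioms, where A = "carrier F"])
      show "lin_ext R ?P e \<in> mod_hom R (free_mod R (carrier F)) ?P"
        by (rule F.R.lin_ext_hom[OF P.module_axioms]) simp
      show "(\<lambda>x. x) \<in> mod_hom R (free_mod R (carrier F)) ?P"
        by (auto simp: mod_hom_def free_cover_def)
      show "lin_ext R ?P e (free_basis R a) = free_basis R a" if "a \<in> carrier F" for a
        by (subst F.R.lin_ext_basis[OF P.module_axioms that]) (simp_all add: e_def[symmetric])
      show "\<phi> \<in> carrier (free_mod R (carrier F))" using \<phi>P by (simp add: free_cover_def)
    qed
    then show ?thesis by (simp add: lin_ext_def)
  qed
  finally have "?p \<phi> = \<zero>\<^bsub>?Q\<^esub>" using z0 mod_hom_zero[OF TM Q b(1)] by simp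
  then show ?thesis
    using \<phi>P(1) by (simp add: quot_mod_ops[OF P.module_axioms N] P.coset_eq_zero_iff[OF N])
qed

section \<open>Fractions\<close>

text \<open>Restriction of scalars along \<open>\<phi>\<close>.\<close>

definition restr :: "('r \<Rightarrow> 'q) \<Rightarrow> ('q, 'n) module \<Rightarrow> ('r, 'n) module" where
  "restr \<phi> N = \<lparr>carrier = carrier N, mult = mult N, one = one N, zero = zero N, add = add N,
    smult = (\<lambda>a. smult N (\<phi> a))\<rparr>"

lemma restr_simps [simp]:
  "carrier (restr \<phi> N) = carrier N" "zero (restr \<phi> N) = zero N" "add (restr \<phi> N) = add N"
  "smult (restr \<phi> N) a x = \<phi> a \<odot>\<^bsub>N\<^esub> x"
  by (simp_all add: restr_def)

lemma restr_module:
  assumes "cring R" "\<phi> \<in> ring_hom R R'" "module R' N"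
  shows "module R (restr \<phi> N)"
proof -
  interpret R: cring R by fact
  interpret N: module R' N by fact
  show ?thesis
  proof (rule moduleI)
    show "cring R" by fact
    show "abelian_group (restr \<phi> N)"
      by (rule abelian_groupI) (auto simp: N.M.a_ac intro: bexI[of _ "\<ominus>\<^bsub>N\<^esub> x" for x] N.l_neg)
  qed (simp_all add: ring_hom_closed[OF assms(2)] ring_hom_add[OF assms(2)]
      ring_hom_mult[OF assms(2)] ring_hom_one[OF assms(2)] N.smult_l_distr N.smult_r_distr
      N.smult_assoc1)
qed

lemma restr_hom:
  assumes "\<phi> \<in> ring_hom R R'" "f \<in> mod_hom R' M N"
  shows "f \<in> mod_hom R (restr \<phi> M) (restr \<phi> N)"
  using assms(2) ring_hom_closed[OF assms(1)] by (auto simp: mod_hom_def)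



locale localization = cring R for R :: "('r, 'k) ring_scheme" (structure) +
  fixes S :: "'r set"
  assumes S: "submonoid S R"
begin

lemma S_closed [simp]: "s \<in> S \<Longrightarrow> s \<in> carrier R"
  and one_S [simp]: "\<one> \<in> S"
  and mult_S [simp]: "s \<in> S \<Longrightarrow> t \<in> S \<Longrightarrow> s \<otimes> t \<in> S"
  using S by (auto simp: submonoid.one_closed submonoid.m_closed dest: submonoid.subset)

text \<open>
  The fraction \<open>x/s\<close> with numerator in a module. For the ring as a module over itself this is
  \<open>loc_frac\<close>, so the additive structure of the localized ring is a special case of that of
  localized modules.
\<close>

definition frac :: "('r, 'm) module \<Rightarrow> 'm \<Rightarrow> 'r \<Rightarrow> ('m \<times> 'r) set" where
  "frac M x s = {(y, t). y \<in> carrier M \<and> t \<in> S \<and> (\<exists>u\<in>S. (u \<otimes> t) \<odot>\<^bsub>M\<^esub> x = (u \<otimes> s) \<odot>\<^bsub>M\<^esub> y)}"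

definition frac_mod :: "('r, 'm) module \<Rightarrow> (('r \<times> 'r) set, ('m \<times> 'r) set) module" where
  "frac_mod M =
    \<lparr>carrier = (\<lambda>(x, s). frac M x s) ` (carrier M \<times> S), mult = undefined, one = undefined,
     zero = frac M \<zero>\<^bsub>M\<^esub> \<one>,
     add = (\<lambda>X Y. \<Union>(x, s)\<in>X. \<Union>(y, t)\<in>Y. frac M (t \<odot>\<^bsub>M\<^esub> x \<oplus>\<^bsub>M\<^esub> s \<odot>\<^bsub>M\<^esub> y) (s \<otimes> t)),
     smult = (\<lambda>q X. \<Union>(a, s)\<in>q. \<Union>(x, t)\<in>X. frac M (a \<odot>\<^bsub>M\<^esub> x) (s \<otimes> t))\<rparr>"

context
  fixes M :: "('r, 'm) module"
  assumes M: "module R M"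
begin

interpretation M: module R M by (rule M)

lemma scale_eq:
  assumes "a \<odot>\<^bsub>M\<^esub> x = b \<odot>\<^bsub>M\<^esub> y" "a \<in> carrier R" "b \<in> carrier R" "c \<in> carrier R"
    "x \<in> carrier M" "y \<in> carrier M"
  shows "(c \<otimes> a) \<odot>\<^bsub>M\<^esub> x = (c \<otimes> b) \<odot>\<^bsub>M\<^esub> y"
  using assms by (simp add: M.smult_assoc1)

lemma frac_mem: "(y, t) \<in> frac M x s \<longleftrightarrow> y \<in> carrier M \<and> t \<in> S \<and> (\<exists>u\<in>S. (u \<otimes> t) \<odot>\<^bsub>M\<^esub> x = (u \<otimes> s) \<odot>\<^bsub>M\<^esub> y)"
  by (simp add: frac_def)

lemma frac_self: "x \<in> carrier M \<Longrightarrow> s \<in> S \<Longrightarrow> (x, s) \<in> frac M x s"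
  by (auto simp: frac_mem)

lemma frac_trans:
  assumes "(y, t) \<in> frac M x s" "(z, r) \<in> frac M y t" "x \<in> carrier M" "s \<in> S"
  shows "(z, r) \<in> frac M x s"
proof -
  obtain u v where u: "u \<in> S" "(u \<otimes> t) \<odot>\<^bsub>M\<^esub> x = (u \<otimes> s) \<odot>\<^bsub>M\<^esub> y"
    and v: "v \<in> S" "(v \<otimes> r) \<odot>\<^bsub>M\<^esub> y = (v \<otimes> t) \<odot>\<^bsub>M\<^esub> z"
    and c: "y \<in> carrier M" "z \<in> carrier M" "t \<in> S" "r \<in> S"
    using assms(1,2) by (auto simp: frac_mem)
  have "((v \<otimes> r) \<otimes> (u \<otimes> t)) \<odot>\<^bsub>M\<^esub> x = ((v \<otimes> r) \<otimes> (u \<otimes> s)) \<odot>\<^bsub>M\<^esub> y"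
    using u(1) v(1) c assms(3,4) by (intro scale_eq[OF u(2)]) auto
  moreover have "((u \<otimes> s) \<otimes> (v \<otimes> r)) \<odot>\<^bsub>M\<^esub> y = ((u \<otimes> s) \<otimes> (v \<otimes> t)) \<odot>\<^bsub>M\<^esub> z"
    using u(1) v(1) c assms(3,4) by (intro scale_eq[OF v(2)]) auto
  ultimately have "((u \<otimes> v \<otimes> t) \<otimes> r) \<odot>\<^bsub>M\<^esub> x = ((u \<otimes> v \<otimes> t) \<otimes> s) \<odot>\<^bsub>M\<^esub> z"
    using u(1) v(1) c(3,4) assms(4) by (simp add: m_ac)
  moreover have "u \<otimes> v \<otimes> t \<in> S" using u v c by simp
  ultimately show ?thesis using c unfolding frac_mem by blast
qed

lemma frac_sym: "(y, t) \<in> frac M x s \<Longrightarrow> x \<in> carrier M \<Longrightarrow> s \<in> S \<Longrightarrow> (x, s) \<in> frac M y t"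
  unfolding frac_mem by (metis (no_types))

lemma frac_eq_iff:
  assumes "x \<in> carrier M" "s \<in> S" "y \<in> carrier M" "t \<in> S"
  shows "frac M x s = frac M y t \<longleftrightarrow> (\<exists>u\<in>S. (u \<otimes> t) \<odot>\<^bsub>M\<^esub> x = (u \<otimes> s) \<odot>\<^bsub>M\<^esub> y)"
proof -
  have "frac M x s = frac M y t \<longleftrightarrow> (y, t) \<in> frac M x s"
  proof
    assume "frac M x s = frac M y t"
    then show "(y, t) \<in> frac M x s" using frac_self assms by simp
  next
    assume *: "(y, t) \<in> frac M x s"
    have "(z, r) \<in> frac M x s \<longleftrightarrow> (z, r) \<in> frac M y t" for z r
      using frac_trans[OF *] frac_trans[OF frac_sym[OF *]] assms by metis
    then show "frac M x s = frac M y t" by auto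
  qed
  then show ?thesis using assms by (simp add: frac_mem)
qed

lemma frac_eqI:
  assumes "x \<in> carrier M" "s \<in> S" "y \<in> carrier M" "t \<in> S" "t \<odot>\<^bsub>M\<^esub> x = s \<odot>\<^bsub>M\<^esub> y"
  shows "frac M x s = frac M y t"
  unfolding frac_eq_iff[OF assms(1-4)] using assms by (intro bexI[of _ \<one>]) auto

lemma frac_expand: "x \<in> carrier M \<Longrightarrow> s \<in> S \<Longrightarrow> t \<in> S \<Longrightarrow> frac M (t \<odot>\<^bsub>M\<^esub> x) (t \<otimes> s) = frac M x s"
  by (rule frac_eqI) (auto simp: M.smult_assoc1[symmetric] m_ac)

lemma frac_zero: "s \<in> S \<Longrightarrow> frac M \<zero>\<^bsub>M\<^esub> s = frac M \<zero>\<^bsub>M\<^esub> \<one>"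
  by (rule frac_eqI) auto

lemma frac_UN:
  assumes "x \<in> carrier M" "s \<in> S"
    and "\<And>y t u. y \<in> carrier M \<Longrightarrow> t \<in> S \<Longrightarrow> u \<in> S \<Longrightarrow> (u \<otimes> t) \<odot>\<^bsub>M\<^esub> x = (u \<otimes> s) \<odot>\<^bsub>M\<^esub> y \<Longrightarrow> f y t = f x s"
  shows "(\<Union>(y, t)\<in>frac M x s. f y t) = f x s"
proof (rule SUP_eq_const)
  show "frac M x s \<noteq> {}" using frac_self[OF assms(1,2)] by blast
  fix p assume "p \<in> frac M x s"
  then obtain y t u where "p = (y, t)" "y \<in> carrier M" "t \<in> S" "u \<in> S"
    "(u \<otimes> t) \<odot>\<^bsub>M\<^esub> x = (u \<otimes> s) \<odot>\<^bsub>M\<^esub> y"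
    by (cases p) (auto simp: frac_mem)
  then show "(case p of (y, t) \<Rightarrow> f y t) = f x s" using assms(3) by auto
qed

lemma frac_add:
  assumes "x \<in> carrier M" "s \<in> S" "y \<in> carrier M" "t \<in> S"
  shows "frac M x s \<oplus>\<^bsub>frac_mod M\<^esub> frac M y t = frac M (t \<odot>\<^bsub>M\<^esub> x \<oplus>\<^bsub>M\<^esub> s \<odot>\<^bsub>M\<^esub> y) (s \<otimes> t)"
proof -
  have inner: "(\<Union>(y', t')\<in>frac M y t. frac M (t' \<odot>\<^bsub>M\<^esub> x \<oplus>\<^bsub>M\<^esub> s \<odot>\<^bsub>M\<^esub> y') (s \<otimes> t'))
      = frac M (t \<odot>\<^bsub>M\<^esub> x \<oplus>\<^bsub>M\<^esub> s \<odot>\<^bsub>M\<^esub> y) (s \<otimes> t)"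
    if "x \<in> carrier M" "s \<in> S" for x s
  proof (rule frac_UN[OF assms(3,4)])
    fix y' t' v assume y': "y' \<in> carrier M" "t' \<in> S" "v \<in> S" and v: "(v \<otimes> t') \<odot>\<^bsub>M\<^esub> y = (v \<otimes> t) \<odot>\<^bsub>M\<^esub> y'"
    have "((s \<otimes> s) \<otimes> (v \<otimes> t')) \<odot>\<^bsub>M\<^esub> y = ((s \<otimes> s) \<otimes> (v \<otimes> t)) \<odot>\<^bsub>M\<^esub> y'"
      using that y' assms by (intro scale_eq[OF v]) auto
    then have e: "(s \<otimes> (s \<otimes> (v \<otimes> t'))) \<odot>\<^bsub>M\<^esub> y = (s \<otimes> (s \<otimes> (v \<otimes> t))) \<odot>\<^bsub>M\<^esub> y'"
      using that y' assms by (simp add: m_assoc)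
    show "frac M (t' \<odot>\<^bsub>M\<^esub> x \<oplus>\<^bsub>M\<^esub> s \<odot>\<^bsub>M\<^esub> y') (s \<otimes> t') = frac M (t \<odot>\<^bsub>M\<^esub> x \<oplus>\<^bsub>M\<^esub> s \<odot>\<^bsub>M\<^esub> y) (s \<otimes> t)"
      using that y' assms e
      by (subst frac_eq_iff) (auto simp: M.smult_r_distr M.smult_assoc1[symmetric] m_ac intro!: bexI[of _ v])
  qed
  have "(\<Union>(x', s')\<in>frac M x s. \<Union>(y', t')\<in>frac M y t. frac M (t' \<odot>\<^bsub>M\<^esub> x' \<oplus>\<^bsub>M\<^esub> s' \<odot>\<^bsub>M\<^esub> y') (s' \<otimes> t'))
    = (\<Union>(y', t')\<in>frac M y t. frac M (t' \<odot>\<^bsub>M\<^esub> x \<oplus>\<^bsub>M\<^esub> s \<odot>\<^bsub>M\<^esub> y') (s \<otimes> t'))"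
  proof (rule frac_UN[OF assms(1,2)], unfold inner[OF assms(1,2)])
    fix x' s' v assume x': "x' \<in> carrier M" "s' \<in> S" "v \<in> S" and v: "(v \<otimes> s') \<odot>\<^bsub>M\<^esub> x = (v \<otimes> s) \<odot>\<^bsub>M\<^esub> x'"
    have "((t \<otimes> t) \<otimes> (v \<otimes> s')) \<odot>\<^bsub>M\<^esub> x = ((t \<otimes> t) \<otimes> (v \<otimes> s)) \<odot>\<^bsub>M\<^esub> x'"
      using x' assms by (intro scale_eq[OF v]) auto
    then have e: "(s' \<otimes> (t \<otimes> (t \<otimes> v))) \<odot>\<^bsub>M\<^esub> x = (s \<otimes> (t \<otimes> (t \<otimes> v))) \<odot>\<^bsub>M\<^esub> x'"
      using x' assms by (simp add: m_ac)
    show "(\<Union>(y', t')\<in>frac M y t. frac M (t' \<odot>\<^bsub>M\<^esub> x' \<oplus>\<^bsub>M\<^esub> s' \<odot>\<^bsub>M\<^esub> y') (s' \<otimes> t'))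
        = frac M (t \<odot>\<^bsub>M\<^esub> x \<oplus>\<^bsub>M\<^esub> s \<odot>\<^bsub>M\<^esub> y) (s \<otimes> t)"
      unfolding inner[OF x'(1,2)] using x' assms e
      by (subst frac_eq_iff) (auto simp: M.smult_r_distr M.smult_assoc1[symmetric] m_ac intro!: bexI[of _ v])
  qed
  then show ?thesis unfolding inner[OF assms(1,2)] by (simp add: frac_mod_def)
qed

lemma frac_mod_carrier: "X \<in> carrier (frac_mod M) \<longleftrightarrow> (\<exists>x\<in>carrier M. \<exists>s\<in>S. X = frac M x s)"
  by (auto simp: frac_mod_def)

lemma frac_mod_zero: "\<zero>\<^bsub>frac_mod M\<^esub> = frac M \<zero>\<^bsub>M\<^esub> \<one>"
  by (simp add: frac_mod_def)

lemma frac_closed: "x \<in> carrier M \<Longrightarrow> s \<in> S \<Longrightarrow> frac M x s \<in> carrier (frac_mod M)"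
  by (auto simp: frac_mod_carrier)

lemma frac_add_same:
  assumes "x \<in> carrier M" "y \<in> carrier M" "s \<in> S"
  shows "frac M x s \<oplus>\<^bsub>frac_mod M\<^esub> frac M y s = frac M (x \<oplus>\<^bsub>M\<^esub> y) s"
  using assms by (simp add: frac_add M.smult_r_distr[symmetric] frac_expand)

lemma frac_mod_abelian_group: "abelian_group (frac_mod M)"
proof (rule abelian_groupI)
  fix X Y assume "X \<in> carrier (frac_mod M)" "Y \<in> carrier (frac_mod M)"
  then obtain x s y t where X: "x \<in> carrier M" "s \<in> S" "X = frac M x s"
    and Y: "y \<in> carrier M" "t \<in> S" "Y = frac M y t" by (auto simp: frac_mod_carrier)
  show "X \<oplus>\<^bsub>frac_mod M\<^esub> Y \<in> carrier (frac_mod M)"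
    using X Y by (auto simp: frac_add intro!: frac_closed)
  show "X \<oplus>\<^bsub>frac_mod M\<^esub> Y = Y \<oplus>\<^bsub>frac_mod M\<^esub> X"
    using X Y by (simp add: frac_add m_comm M.a_comm)
  fix Z assume "Z \<in> carrier (frac_mod M)"
  then obtain z r where Z: "z \<in> carrier M" "r \<in> S" "Z = frac M z r" by (auto simp: frac_mod_carrier)
  show "X \<oplus>\<^bsub>frac_mod M\<^esub> Y \<oplus>\<^bsub>frac_mod M\<^esub> Z = X \<oplus>\<^bsub>frac_mod M\<^esub> (Y \<oplus>\<^bsub>frac_mod M\<^esub> Z)"
    using X Y Z by (simp add: frac_add M.smult_r_distr M.smult_assoc1[symmetric] m_ac M.a_ac)
next
  show "\<zero>\<^bsub>frac_mod M\<^esub> \<in> carrier (frac_mod M)" by (auto simp: frac_mod_zero intro!: frac_closed)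
  fix X assume "X \<in> carrier (frac_mod M)"
  then obtain x s where X: "x \<in> carrier M" "s \<in> S" "X = frac M x s"
    by (auto simp: frac_mod_carrier)
  show "\<zero>\<^bsub>frac_mod M\<^esub> \<oplus>\<^bsub>frac_mod M\<^esub> X = X"
    using X by (simp add: frac_mod_zero frac_add)
  have "frac M (\<ominus>\<^bsub>M\<^esub> x) s \<oplus>\<^bsub>frac_mod M\<^esub> X = \<zero>\<^bsub>frac_mod M\<^esub>"
    unfolding X(3) using X(1,2) frac_add_same[of "\<ominus>\<^bsub>M\<^esub> x" x s]
    by (simp add: frac_mod_zero M.l_neg frac_zero[of s])
  then show "\<exists>Y\<in>carrier (frac_mod M). Y \<oplus>\<^bsub>frac_mod M\<^esub> X = \<zero>\<^bsub>frac_mod M\<^esub>"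
    by (rule bexI) (simp add: frac_closed X(1,2))
qed

end

lemma loc_frac_eq: "a \<in> carrier R \<Longrightarrow> s \<in> S \<Longrightarrow> loc_frac R S a s = frac (ring_mod R) a s"
proof -
  assume a: "a \<in> carrier R" "s \<in> S"
  have "u \<otimes> (a \<otimes> t \<ominus> b \<otimes> s) = \<zero> \<longleftrightarrow> (u \<otimes> t) \<otimes> a = (u \<otimes> s) \<otimes> b"
    if "b \<in> carrier R" "t \<in> S" "u \<in> S" for b t u
  proof -
    have "u \<otimes> (a \<otimes> t \<ominus> b \<otimes> s) = (u \<otimes> t) \<otimes> a \<ominus> (u \<otimes> s) \<otimes> b"
      using that a by (simp add: a_minus_def r_distr r_minus m_ac)
    then show ?thesis using that a by (simp add: diff_eq_zero_iff)
  qed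
  then show "loc_frac R S a s = frac (ring_mod R) a s"
    by (auto simp: loc_frac_def frac_def)
qed

lemma loc_eq_iff:
  assumes "a \<in> carrier R" "s \<in> S" "b \<in> carrier R" "t \<in> S"
  shows "loc_frac R S a s = loc_frac R S b t \<longleftrightarrow> (\<exists>u\<in>S. (u \<otimes> t) \<otimes> a = (u \<otimes> s) \<otimes> b)"
  using frac_eq_iff[OF ring_mod_module, of a s b t] assms by (simp add: loc_frac_eq)

lemma loc_UN:
  assumes "a \<in> carrier R" "s \<in> S"
    and "\<And>b t u. b \<in> carrier R \<Longrightarrow> t \<in> S \<Longrightarrow> u \<in> S \<Longrightarrow> (u \<otimes> t) \<otimes> a = (u \<otimes> s) \<otimes> b \<Longrightarrow> f b t = f a s"
  shows "(\<Union>(b, t)\<in>loc_frac R S a s. f b t) = f a s"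
  unfolding loc_frac_eq[OF assms(1,2)]
  using assms(1,2) by (intro frac_UN[OF ring_mod_module] assms(3)) simp_all

abbreviation (input) L where "L \<equiv> loc_ring R S"

lemma loc_carrier: "X \<in> carrier L \<longleftrightarrow> (\<exists>a\<in>carrier R. \<exists>s\<in>S. X = loc_frac R S a s)"
  by (auto simp: loc_ring_def)

lemma loc_closed: "a \<in> carrier R \<Longrightarrow> s \<in> S \<Longrightarrow> loc_frac R S a s \<in> carrier L"
  by (auto simp: loc_carrier)

lemma loc_one: "\<one>\<^bsub>L\<^esub> = loc_frac R S \<one> \<one>" and loc_zero: "\<zero>\<^bsub>L\<^esub> = loc_frac R S \<zero> \<one>"
  by (auto simp: loc_ring_def)

lemma frac_loc_smult:
  assumes M: "module R M" and "a \<in> carrier R" "s \<in> S" "x \<in> carrier M" "t \<in> S"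
  shows "loc_frac R S a s \<odot>\<^bsub>frac_mod M\<^esub> frac M x t = frac M (a \<odot>\<^bsub>M\<^esub> x) (s \<otimes> t)"
proof -
  interpret M: module R M by (rule M)
  have inner: "(\<Union>(x', t')\<in>frac M x t. frac M (a \<odot>\<^bsub>M\<^esub> x') (s \<otimes> t')) = frac M (a \<odot>\<^bsub>M\<^esub> x) (s \<otimes> t)"
    if "a \<in> carrier R" "s \<in> S" for a s
  proof (rule frac_UN[OF M assms(4,5)])
    fix y r v assume y: "y \<in> carrier M" "r \<in> S" "v \<in> S" and v: "(v \<otimes> r) \<odot>\<^bsub>M\<^esub> x = (v \<otimes> t) \<odot>\<^bsub>M\<^esub> y"
    have "((a \<otimes> s) \<otimes> (v \<otimes> r)) \<odot>\<^bsub>M\<^esub> x = ((a \<otimes> s) \<otimes> (v \<otimes> t)) \<odot>\<^bsub>M\<^esub> y"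
      using that y assms by (intro scale_eq[OF M v]) auto
    then show "frac M (a \<odot>\<^bsub>M\<^esub> y) (s \<otimes> r) = frac M (a \<odot>\<^bsub>M\<^esub> x) (s \<otimes> t)"
      using that y assms
      by (subst frac_eq_iff[OF M]) (auto simp: M.smult_assoc1[symmetric] m_ac intro!: bexI[of _ v])
  qed
  have "(\<Union>(a', s')\<in>loc_frac R S a s. \<Union>(x', t')\<in>frac M x t. frac M (a' \<odot>\<^bsub>M\<^esub> x') (s' \<otimes> t'))
    = (\<Union>(x', t')\<in>frac M x t. frac M (a \<odot>\<^bsub>M\<^esub> x') (s \<otimes> t'))"
  proof (rule loc_UN[OF assms(2,3)], unfold inner[OF assms(2,3)])
    fix b r v assume b: "b \<in> carrier R" "r \<in> S" "v \<in> S" and v: "(v \<otimes> r) \<otimes> a = (v \<otimes> s) \<otimes> b"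
    have e: "(t \<otimes> ((v \<otimes> r) \<otimes> a)) = (t \<otimes> ((v \<otimes> s) \<otimes> b))" by (simp add: v)
    have "frac M (b \<odot>\<^bsub>M\<^esub> x) (r \<otimes> t) = frac M (a \<odot>\<^bsub>M\<^esub> x) (s \<otimes> t)"
      using b assms e
      by (subst frac_eq_iff[OF M]) (auto simp: M.smult_assoc1[symmetric] m_ac intro!: bexI[of _ v])
    then show "(\<Union>(x', t')\<in>frac M x t. frac M (b \<odot>\<^bsub>M\<^esub> x') (r \<otimes> t')) = frac M (a \<odot>\<^bsub>M\<^esub> x) (s \<otimes> t)"
      unfolding inner[OF b(1,2)] .
  qed
  then show ?thesis unfolding inner[OF assms(2,3)] by (simp add: frac_mod_def)
qed

lemma loc_mem: "(b, t) \<in> loc_frac R S a s \<Longrightarrow> b \<in> carrier R" "(b, t) \<in> loc_frac R S a s \<Longrightarrow> t \<in> S"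
  by (auto simp: loc_frac_def)

lemma loc_mult:
  assumes "a \<in> carrier R" "s \<in> S" "b \<in> carrier R" "t \<in> S"
  shows "loc_frac R S a s \<otimes>\<^bsub>L\<^esub> loc_frac R S b t = loc_frac R S (a \<otimes> b) (s \<otimes> t)"
proof -
  have "(\<Union>(a, s)\<in>loc_frac R S a s. \<Union>(b, t)\<in>loc_frac R S b t. loc_frac R S (a \<otimes> b) (s \<otimes> t))
    = (\<Union>(a, s)\<in>loc_frac R S a s. \<Union>(b, t)\<in>loc_frac R S b t. frac (ring_mod R) (a \<otimes> b) (s \<otimes> t))"
    by (rule SUP_cong[OF refl], clarify, rule SUP_cong[OF refl], clarify)
      (subst loc_frac_eq; use loc_mem in \<open>force\<close>)
  also have "\<dots> = frac (ring_mod R) (a \<otimes> b) (s \<otimes> t)"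
    using frac_loc_smult[OF ring_mod_module assms(1,2), of b t] assms
    by (simp add: frac_mod_def loc_frac_eq)
  finally show ?thesis using assms by (simp add: loc_ring_def loc_frac_eq)
qed

lemma loc_add:
  assumes "a \<in> carrier R" "s \<in> S" "b \<in> carrier R" "t \<in> S"
  shows "loc_frac R S a s \<oplus>\<^bsub>L\<^esub> loc_frac R S b t = loc_frac R S (t \<otimes> a \<oplus> s \<otimes> b) (s \<otimes> t)"
proof -
  have "(\<Union>(a, s)\<in>loc_frac R S a s. \<Union>(b, t)\<in>loc_frac R S b t. loc_frac R S (a \<otimes> t \<oplus> b \<otimes> s) (s \<otimes> t))
    = (\<Union>(a, s)\<in>loc_frac R S a s. \<Union>(b, t)\<in>loc_frac R S b t. frac (ring_mod R) (t \<otimes> a \<oplus> s \<otimes> b) (s \<otimes> t))"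
    by (rule SUP_cong[OF refl], clarify, rule SUP_cong[OF refl], clarify)
      (subst loc_frac_eq; use loc_mem in \<open>force simp: m_comm\<close>)
  also have "\<dots> = frac (ring_mod R) (t \<otimes> a \<oplus> s \<otimes> b) (s \<otimes> t)"
    using frac_add[OF ring_mod_module, of a s b t] assms
    by (simp add: frac_mod_def loc_frac_eq)
  finally show ?thesis using assms by (simp add: loc_ring_def loc_frac_eq)
qed

lemma loc_eqI:
  "a \<in> carrier R \<Longrightarrow> s \<in> S \<Longrightarrow> b \<in> carrier R \<Longrightarrow> t \<in> S \<Longrightarrow> t \<otimes> a = s \<otimes> b
    \<Longrightarrow> loc_frac R S a s = loc_frac R S b t"
  using frac_eqI[OF ring_mod_module, of a s b t] by (simp add: loc_frac_eq)

text \<open>Only the multiplication is new; the additive group is that of fractions over \<open>ring_mod R\<close>.\<close>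

lemma loc_ring_cring: "cring L"
proof (rule cringI)
  note A = frac_mod_abelian_group[OF ring_mod_module]
  interpret A: abelian_group "frac_mod (ring_mod R)" by (rule A)
  have car: "carrier L = carrier (frac_mod (ring_mod R))"
    by (auto simp: loc_carrier frac_mod_carrier[OF ring_mod_module] loc_frac_eq)
  have zero: "\<zero>\<^bsub>L\<^esub> = \<zero>\<^bsub>frac_mod (ring_mod R)\<^esub>"
    by (simp add: loc_zero loc_frac_eq frac_mod_def)
  have add: "X \<oplus>\<^bsub>L\<^esub> Y = X \<oplus>\<^bsub>frac_mod (ring_mod R)\<^esub> Y" if "X \<in> carrier L" "Y \<in> carrier L" for X Y
    using that by (auto simp: loc_carrier loc_add, auto simp: loc_frac_eq frac_add[OF ring_mod_module])
  show "abelian_group L"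
  proof (rule abelian_groupI)
    fix X Y assume X: "X \<in> carrier L" and Y: "Y \<in> carrier L"
    show cl: "X \<oplus>\<^bsub>L\<^esub> Y \<in> carrier L" using X Y add car by simp
    show "X \<oplus>\<^bsub>L\<^esub> Y = Y \<oplus>\<^bsub>L\<^esub> X" using X Y by (simp add: add) (simp add: car A.a_comm)
    fix Z assume Z: "Z \<in> carrier L"
    show "X \<oplus>\<^bsub>L\<^esub> Y \<oplus>\<^bsub>L\<^esub> Z = X \<oplus>\<^bsub>L\<^esub> (Y \<oplus>\<^bsub>L\<^esub> Z)"
      using X Y Z by (simp add: add car A.a_assoc)
  next
    show "\<zero>\<^bsub>L\<^esub> \<in> carrier L" by (simp add: zero car)
    fix X assume X: "X \<in> carrier L"
    show "\<zero>\<^bsub>L\<^esub> \<oplus>\<^bsub>L\<^esub> X = X" using X by (simp add: add zero car)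
    show "\<exists>Y\<in>carrier L. Y \<oplus>\<^bsub>L\<^esub> X = \<zero>\<^bsub>L\<^esub>"
      using X by (intro bexI[of _ "\<ominus>\<^bsub>frac_mod (ring_mod R)\<^esub> X"]) (simp_all add: add zero car A.l_neg)
  qed
  show "comm_monoid L"
  proof (rule comm_monoidI)
    fix X Y assume "X \<in> carrier L" "Y \<in> carrier L"
    then obtain a s b t where X: "a \<in> carrier R" "s \<in> S" "X = loc_frac R S a s"
      and Y: "b \<in> carrier R" "t \<in> S" "Y = loc_frac R S b t" by (auto simp: loc_carrier)
    show "X \<otimes>\<^bsub>L\<^esub> Y \<in> carrier L" using X Y by (auto simp: loc_mult intro!: loc_closed)
    show "X \<otimes>\<^bsub>L\<^esub> Y = Y \<otimes>\<^bsub>L\<^esub> X" using X Y by (simp add: loc_mult m_comm)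
    fix Z assume "Z \<in> carrier L"
    then obtain c r where Z: "c \<in> carrier R" "r \<in> S" "Z = loc_frac R S c r" by (auto simp: loc_carrier)
    show "X \<otimes>\<^bsub>L\<^esub> Y \<otimes>\<^bsub>L\<^esub> Z = X \<otimes>\<^bsub>L\<^esub> (Y \<otimes>\<^bsub>L\<^esub> Z)" using X Y Z by (simp add: loc_mult m_assoc)
  next
    show "\<one>\<^bsub>L\<^esub> \<in> carrier L" by (auto simp: loc_one intro!: loc_closed)
    show "\<one>\<^bsub>L\<^esub> \<otimes>\<^bsub>L\<^esub> X = X" if "X \<in> carrier L" for X
      using that by (auto simp: loc_carrier loc_one loc_mult)
  qed
  fix X Y Z assume "X \<in> carrier L" "Y \<in> carrier L" "Z \<in> carrier L"
  then obtain a s b t c r where "a \<in> carrier R" "s \<in> S" "X = loc_frac R S a s"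
    "b \<in> carrier R" "t \<in> S" "Y = loc_frac R S b t" "c \<in> carrier R" "r \<in> S" "Z = loc_frac R S c r"
    by (auto simp: loc_carrier)
  then show "(X \<oplus>\<^bsub>L\<^esub> Y) \<otimes>\<^bsub>L\<^esub> Z = X \<otimes>\<^bsub>L\<^esub> Z \<oplus>\<^bsub>L\<^esub> Y \<otimes>\<^bsub>L\<^esub> Z"
    by (simp add: loc_add loc_mult, intro loc_eqI) (simp_all add: l_distr r_distr m_ac)
qed

lemma frac_mod_module: 
  assumes M: "module R M" shows "module L (frac_mod M)"
proof (rule moduleI[OF loc_ring_cring frac_mod_abelian_group[OF M]])
  interpret M: module R M by (rule M)
  note simps = frac_add[OF M] frac_loc_smult[OF M] loc_add loc_mult M.smult_l_distr M.smult_r_distr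
    M.smult_assoc1[symmetric] m_ac
  fix q X assume "q \<in> carrier L" "X \<in> carrier (frac_mod M)"
  then obtain a s x t where q: "a \<in> carrier R" "s \<in> S" "q = loc_frac R S a s"
    and X: "x \<in> carrier M" "t \<in> S" "X = frac M x t" by (auto simp: loc_carrier frac_mod_carrier[OF M])
  show "q \<odot>\<^bsub>frac_mod M\<^esub> X \<in> carrier (frac_mod M)"
    using q X by (auto simp: simps intro!: frac_closed[OF M])
  {
    fix Y assume "Y \<in> carrier (frac_mod M)"
    then obtain y r where "y \<in> carrier M" "r \<in> S" "Y = frac M y r"
      by (auto simp: frac_mod_carrier[OF M])
    then show "q \<odot>\<^bsub>frac_mod M\<^esub> (X \<oplus>\<^bsub>frac_mod M\<^esub> Y) = q \<odot>\<^bsub>frac_mod M\<^esub> X \<oplus>\<^bsub>frac_mod M\<^esub> q \<odot>\<^bsub>frac_mod M\<^esub> Y"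
      using q X by (simp add: simps, intro frac_eqI[OF M]) (simp_all add: simps)
  }
  fix p assume "p \<in> carrier L"
  then obtain b r where p: "b \<in> carrier R" "r \<in> S" "p = loc_frac R S b r" by (auto simp: loc_carrier)
  show "(q \<oplus>\<^bsub>L\<^esub> p) \<odot>\<^bsub>frac_mod M\<^esub> X = q \<odot>\<^bsub>frac_mod M\<^esub> X \<oplus>\<^bsub>frac_mod M\<^esub> p \<odot>\<^bsub>frac_mod M\<^esub> X"
    using q X p by (simp add: simps, intro frac_eqI[OF M]) (simp_all add: simps)
  show "q \<otimes>\<^bsub>L\<^esub> p \<odot>\<^bsub>frac_mod M\<^esub> X = q \<odot>\<^bsub>frac_mod M\<^esub> (p \<odot>\<^bsub>frac_mod M\<^esub> X)"
    using q X p by (simp add: simps)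
next
  interpret M: module R M by (rule M)
  fix X assume "X \<in> carrier (frac_mod M)"
  then show "\<one>\<^bsub>L\<^esub> \<odot>\<^bsub>frac_mod M\<^esub> X = X"
    by (auto simp: frac_mod_carrier[OF M] loc_one frac_loc_smult[OF M])
qed

definition to_loc :: "'r \<Rightarrow> ('r \<times> 'r) set" where
  "to_loc a = loc_frac R S a \<one>"

lemma to_loc_hom: "to_loc \<in> ring_hom R L"
  by (rule ring_hom_memI) (auto simp: to_loc_def loc_closed loc_add loc_mult loc_one)

lemma to_loc_closed: "a \<in> carrier R \<Longrightarrow> to_loc a \<in> carrier L"
  by (rule ring_hom_closed[OF to_loc_hom])

lemma to_loc_frac:
  assumes "a \<in> carrier R" "s \<in> S"
  shows "to_loc s \<otimes>\<^bsub>L\<^esub> loc_frac R S a s = to_loc a"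
  using assms by (simp add: to_loc_def loc_mult, intro loc_eqI) (simp_all add: m_ac)

lemma to_loc_inv: "s \<in> S \<Longrightarrow> loc_frac R S \<one> s \<otimes>\<^bsub>L\<^esub> to_loc s = \<one>\<^bsub>L\<^esub>"
  by (simp add: to_loc_def loc_mult loc_one, intro loc_eqI) simp_all

text \<open>
  For \<open>q = a/s\<close>, multiplication by \<open>s\<close> is injective on \<open>N\<close>, and \<open>s (f (q x))\<close> and \<open>s (q f x)\<close> are both
  \<open>a f x\<close> by linearity over \<open>R\<close>.
\<close>

lemma loc_linear:
  assumes "module L M" "module L N" "f \<in> mod_hom R (restr to_loc M) (restr to_loc N)"
  shows "f \<in> mod_hom L M N"
proof (rule mod_homI)
  interpret M: module L M by fact
  interpret N: module L N by fact
  show "f x \<in> carrier N" if "x \<in> carrier M" for x using mod_hom_closed[OF assms(3)] that by simp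
  show "f (x \<oplus>\<^bsub>M\<^esub> y) = f x \<oplus>\<^bsub>N\<^esub> f y" if "x \<in> carrier M" "y \<in> carrier M" for x y
    using mod_hom_add[OF assms(3)] that by simp
  fix q x assume "q \<in> carrier L" and x: "x \<in> carrier M"
  then obtain a s where q: "a \<in> carrier R" "s \<in> S" "q = loc_frac R S a s" by (auto simp: loc_carrier)
  have cl [simp]: "q \<in> carrier L" "to_loc s \<in> carrier L" "loc_frac R S \<one> s \<in> carrier L"
    using q by (auto intro: loc_closed to_loc_closed)
  have e: "to_loc s \<otimes>\<^bsub>L\<^esub> q = to_loc a" using q to_loc_frac by simp
  have fx [simp]: "f x \<in> carrier N" "f (q \<odot>\<^bsub>M\<^esub> x) \<in> carrier N"
    using mod_hom_closed[OF assms(3)] x by auto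
  have "to_loc s \<odot>\<^bsub>N\<^esub> f (q \<odot>\<^bsub>M\<^esub> x) = f (to_loc s \<odot>\<^bsub>M\<^esub> (q \<odot>\<^bsub>M\<^esub> x))"
    using mod_hom_smult[OF assms(3), of s "q \<odot>\<^bsub>M\<^esub> x"] q(2) x by simp
  also have "to_loc s \<odot>\<^bsub>M\<^esub> (q \<odot>\<^bsub>M\<^esub> x) = to_loc a \<odot>\<^bsub>M\<^esub> x"
    using x by (simp add: M.smult_assoc1[symmetric] e)
  also have "f \<dots> = to_loc a \<odot>\<^bsub>N\<^esub> f x"
    using mod_hom_smult[OF assms(3), of a x] q x by simp
  also have "\<dots> = to_loc s \<odot>\<^bsub>N\<^esub> (q \<odot>\<^bsub>N\<^esub> f x)"
    by (simp add: N.smult_assoc1[symmetric] e)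
  finally have "loc_frac R S \<one> s \<odot>\<^bsub>N\<^esub> (to_loc s \<odot>\<^bsub>N\<^esub> f (q \<odot>\<^bsub>M\<^esub> x))
    = loc_frac R S \<one> s \<odot>\<^bsub>N\<^esub> (to_loc s \<odot>\<^bsub>N\<^esub> (q \<odot>\<^bsub>N\<^esub> f x))" by simp
  then show "f (q \<odot>\<^bsub>M\<^esub> x) = q \<odot>\<^bsub>N\<^esub> f x"
    using q(2) x by (simp add: N.smult_assoc1[symmetric] M.m_assoc[symmetric] to_loc_inv)
qed

lemma loc_ring_mod_simps:
  "carrier (loc_ring_mod R S) = carrier L" "zero (loc_ring_mod R S) = \<zero>\<^bsub>L\<^esub>"
  "add (loc_ring_mod R S) = add L"
  by (simp_all add: loc_ring_mod_def)

lemma loc_ring_mod_frac_smult: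
  assumes "r \<in> carrier R" "a \<in> carrier R" "s \<in> S"
  shows "r \<odot>\<^bsub>loc_ring_mod R S\<^esub> loc_frac R S a s = loc_frac R S (r \<otimes> a) s"
proof -
  have "(\<Union>(b, t)\<in>loc_frac R S a s. loc_frac R S (r \<otimes> b) t) = loc_frac R S (r \<otimes> a) s"
  proof (rule loc_UN[OF assms(2,3)])
    fix b t v assume b: "b \<in> carrier R" "t \<in> S" "v \<in> S" and v: "(v \<otimes> t) \<otimes> a = (v \<otimes> s) \<otimes> b"
    have "r \<otimes> ((v \<otimes> t) \<otimes> a) = r \<otimes> ((v \<otimes> s) \<otimes> b)" by (simp add: v)
    then show "loc_frac R S (r \<otimes> b) t = loc_frac R S (r \<otimes> a) s"
      using b assms by (subst loc_eq_iff) (auto simp: m_ac intro!: bexI[of _ v])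
  qed
  then show ?thesis by (simp add: loc_ring_mod_def)
qed

lemma loc_ring_mod_smult:
  assumes "r \<in> carrier R" "X \<in> carrier L"
  shows "r \<odot>\<^bsub>loc_ring_mod R S\<^esub> X = to_loc r \<otimes>\<^bsub>L\<^esub> X"
  using assms by (auto simp: loc_carrier loc_ring_mod_frac_smult to_loc_def loc_mult)

lemma loc_ring_mod_module: "module R (loc_ring_mod R S)"
proof -
  interpret L: cring L by (rule loc_ring_cring)
  have "module R (restr to_loc (ring_mod L))"
    by (rule restr_module[OF is_cring to_loc_hom L.ring_mod_module])
  then show ?thesis
    by (rule module_image[OF _ is_cring id_ring_hom, where p = "\<lambda>x. x"])
      (simp_all add: loc_ring_mod_simps loc_ring_mod_smult)
qed

section \<open>The localized module\<close>

context
  fixes F :: "('r, 'f) module"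
  assumes F: "module R F"
begin

abbreviation (input) T where "T \<equiv> tensor R (loc_ring_mod R S) F"
abbreviation (input) LF where "LF \<equiv> loc_mod R S F"
abbreviation (input) pt where "pt \<equiv> pure_tensor R (loc_ring_mod R S) F"

interpretation L: cring L by (rule loc_ring_cring)
interpretation T: module R T by (rule tensor_module[OF is_cring loc_ring_mod_module F])

lemma loc_mod_simps:
  "carrier LF = carrier T" "zero LF = zero T" "add LF = add T"
  "q \<odot>\<^bsub>LF\<^esub> X = tensor_map R F (loc_ring_mod R S) (\<lambda>p. q \<otimes>\<^bsub>L\<^esub> p) X"
  by (simp_all add: loc_mod_def Let_def)

lemma loc_times_hom:
  "q \<in> carrier L \<Longrightarrow> (\<lambda>p. q \<otimes>\<^bsub>L\<^esub> p) \<in> mod_hom R (loc_ring_mod R S) (loc_ring_mod R S)"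
  by (intro mod_homI)
    (auto simp: loc_ring_mod_simps loc_ring_mod_smult L.r_distr L.m_lcomm to_loc_closed)

lemma pt_linear:
  assumes "y \<in> carrier F"
  shows "(\<lambda>p. pt p y) \<in> mod_hom R (loc_ring_mod R S) T"
  using pure_tensor_bilinear[OF is_cring loc_ring_mod_module F] assms by (simp add: bilinear_map_def)

lemma pt_linear2:
  assumes "p \<in> carrier L"
  shows "pt p \<in> mod_hom R F T"
  using pure_tensor_bilinear[OF is_cring loc_ring_mod_module F] assms
  by (simp add: bilinear_map_def loc_ring_mod_simps)

lemma loc_mod_smult_hom: "q \<in> carrier L \<Longrightarrow> (\<lambda>X. q \<odot>\<^bsub>LF\<^esub> X) \<in> mod_hom R T T"
  and loc_mod_smult_pt: "q \<in> carrier L \<Longrightarrow> p \<in> carrier L \<Longrightarrow> y \<in> carrier F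
    \<Longrightarrow> q \<odot>\<^bsub>LF\<^esub> pt p y = pt (q \<otimes>\<^bsub>L\<^esub> p) y"
  using tensor_map[OF is_cring loc_ring_mod_module loc_ring_mod_module F loc_times_hom]
  by (auto simp: loc_mod_simps loc_ring_mod_simps)

lemma T_hom_eqI:
  assumes "module R X" "f \<in> mod_hom R T X" "g \<in> mod_hom R T X"
    and "\<And>p y. p \<in> carrier L \<Longrightarrow> y \<in> carrier F \<Longrightarrow> f (pt p y) = g (pt p y)" "Z \<in> carrier T"
  shows "f Z = g Z"
  by (rule tensor_hom_eqI[OF is_cring loc_ring_mod_module F assms(1-3) _ assms(5)])
    (simp_all add: assms(4) loc_ring_mod_simps)

lemma pt_closed: "p \<in> carrier L \<Longrightarrow> y \<in> carrier F \<Longrightarrow> pt p y \<in> carrier T"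
  by (rule mod_hom_closed[OF pt_linear2])

lemma loc_mod_module: "module L LF"
proof (rule moduleI)
  show "cring L" by (rule loc_ring_cring)
  show "abelian_group LF"
    by (rule abelian_groupI)
      (auto simp: loc_mod_simps T.M.a_ac intro: bexI[of _ "\<ominus>\<^bsub>T\<^esub> x" for x] T.l_neg)
  note Tm = T.module_axioms
  fix q X assume q: "q \<in> carrier L" and X: "X \<in> carrier LF"
  then have XT: "X \<in> carrier T" by (simp add: loc_mod_simps)
  show "q \<odot>\<^bsub>LF\<^esub> X \<in> carrier LF"
    using mod_hom_closed[OF loc_mod_smult_hom[OF q] XT] by (simp add: loc_mod_simps(1))
  show "q \<odot>\<^bsub>LF\<^esub> (X \<oplus>\<^bsub>LF\<^esub> Y) = q \<odot>\<^bsub>LF\<^esub> X \<oplus>\<^bsub>LF\<^esub> q \<odot>\<^bsub>LF\<^esub> Y" if "Y \<in> carrier LF" for Y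
    using mod_hom_add[OF loc_mod_smult_hom[OF q] XT] that by (simp add: loc_mod_simps(1,3))
  fix p assume p: "p \<in> carrier L"
  have "(q \<oplus>\<^bsub>L\<^esub> p) \<odot>\<^bsub>LF\<^esub> X = q \<odot>\<^bsub>LF\<^esub> X \<oplus>\<^bsub>T\<^esub> p \<odot>\<^bsub>LF\<^esub> X"
  proof (rule T_hom_eqI[OF Tm _ _ _ XT])
    show "(\<lambda>X. (q \<oplus>\<^bsub>L\<^esub> p) \<odot>\<^bsub>LF\<^esub> X) \<in> mod_hom R T T" using p q by (intro loc_mod_smult_hom) auto
    show "(\<lambda>X. q \<odot>\<^bsub>LF\<^esub> X \<oplus>\<^bsub>T\<^esub> p \<odot>\<^bsub>LF\<^esub> X) \<in> mod_hom R T T"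
      using p q by (intro mod_hom_plus Tm loc_mod_smult_hom)
    fix r y assume r: "r \<in> carrier L" and y: "y \<in> carrier F"
    show "(q \<oplus>\<^bsub>L\<^esub> p) \<odot>\<^bsub>LF\<^esub> pt r y = q \<odot>\<^bsub>LF\<^esub> pt r y \<oplus>\<^bsub>T\<^esub> p \<odot>\<^bsub>LF\<^esub> pt r y"
      using p q r y mod_hom_add[OF pt_linear[OF y], of "q \<otimes>\<^bsub>L\<^esub> r" "p \<otimes>\<^bsub>L\<^esub> r"]
      by (simp add: loc_mod_smult_pt L.l_distr loc_ring_mod_simps)
  qed
  then show "(q \<oplus>\<^bsub>L\<^esub> p) \<odot>\<^bsub>LF\<^esub> X = q \<odot>\<^bsub>LF\<^esub> X \<oplus>\<^bsub>LF\<^esub> p \<odot>\<^bsub>LF\<^esub> X" by (simp add: loc_mod_simps(3))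
  show "q \<otimes>\<^bsub>L\<^esub> p \<odot>\<^bsub>LF\<^esub> X = q \<odot>\<^bsub>LF\<^esub> (p \<odot>\<^bsub>LF\<^esub> X)"
  proof (rule T_hom_eqI[OF Tm _ _ _ XT])
    show "(\<lambda>X. (q \<otimes>\<^bsub>L\<^esub> p) \<odot>\<^bsub>LF\<^esub> X) \<in> mod_hom R T T" using p q by (intro loc_mod_smult_hom) auto
    show "(\<lambda>X. q \<odot>\<^bsub>LF\<^esub> (p \<odot>\<^bsub>LF\<^esub> X)) \<in> mod_hom R T T"
      using p q by (intro mod_hom_comp[OF loc_mod_smult_hom loc_mod_smult_hom])
    fix r y assume r: "r \<in> carrier L" and y: "y \<in> carrier F"
    show "q \<otimes>\<^bsub>L\<^esub> p \<odot>\<^bsub>LF\<^esub> pt r y = q \<odot>\<^bsub>LF\<^esub> (p \<odot>\<^bsub>LF\<^esub> pt r y)"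
      using p q r y by (simp add: loc_mod_smult_pt L.m_assoc)
  qed
next
  fix X assume "X \<in> carrier LF"
  then have XT: "X \<in> carrier T" by (simp add: loc_mod_simps)
  show "\<one>\<^bsub>L\<^esub> \<odot>\<^bsub>LF\<^esub> X = X"
    by (rule T_hom_eqI[OF T.module_axioms loc_mod_smult_hom _ _ XT])
      (auto simp: mod_hom_def loc_mod_smult_pt)
qed

text \<open>Scalars of \<open>R\<close> act on the first factor through \<open>R \<rightarrow> S\<^sup>-\<^sup>1R\<close>, which is their action on the tensor product.\<close>

lemma loc_mod_restr: "(\<lambda>X. X) \<in> mod_hom R T (restr to_loc LF)"
  and loc_mod_restr': "(\<lambda>X. X) \<in> mod_hom R (restr to_loc LF) T"
proof -
  have *: "to_loc r \<odot>\<^bsub>LF\<^esub> X = r \<odot>\<^bsub>T\<^esub> X" if r: "r \<in> carrier R" and X: "X \<in> carrier T" for r X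
  proof (rule T_hom_eqI[OF T.module_axioms _ _ _ X])
    show "(\<lambda>X. to_loc r \<odot>\<^bsub>LF\<^esub> X) \<in> mod_hom R T T" by (rule loc_mod_smult_hom[OF to_loc_closed[OF r]])
    show "(\<lambda>X. r \<odot>\<^bsub>T\<^esub> X) \<in> mod_hom R T T"
      by (rule mod_hom_scale[OF T.module_axioms T.module_axioms _ r]) (auto simp: mod_hom_def)
    fix p y assume p: "p \<in> carrier L" and y: "y \<in> carrier F"
    show "to_loc r \<odot>\<^bsub>LF\<^esub> pt p y = r \<odot>\<^bsub>T\<^esub> pt p y"
      using mod_hom_smult[OF pt_linear[OF y] r, of p] p y r
      by (simp add: loc_mod_smult_pt to_loc_closed loc_ring_mod_simps loc_ring_mod_smult)
  qed
  show "(\<lambda>X. X) \<in> mod_hom R T (restr to_loc LF)" "(\<lambda>X. X) \<in> mod_hom R (restr to_loc LF) T"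
    by (auto simp: mod_hom_def * loc_mod_simps(1,3))
qed

lemma loc_mod_unit: "(\<lambda>y. pt \<one>\<^bsub>L\<^esub> y) \<in> mod_hom R F (restr to_loc LF)"
  using mod_hom_comp[OF pt_linear2 loc_mod_restr] by auto

text \<open>
  The extension of \<open>f\<close> is \<open>p \<otimes> y \<mapsto> p f(y)\<close>, whose linearity over \<open>S\<^sup>-\<^sup>1R\<close> follows from that over \<open>R\<close> by
  \<open>loc_linear\<close>.
\<close>

lemma loc_mod_extend:
  assumes N: "module L N" and f: "f \<in> mod_hom R F (restr to_loc N)"
  obtains g where "g \<in> mod_hom L LF N" "\<And>y. y \<in> carrier F \<Longrightarrow> g (pt \<one>\<^bsub>L\<^esub> y) = f y"
proof -
  interpret N: module L N by (rule N)
  have fc: "f y \<in> carrier N" if "y \<in> carrier F" for y using mod_hom_closed[OF f that] by simp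
  note RN = restr_module[OF is_cring to_loc_hom N]
  have B: "bilinear_map R (loc_ring_mod R S) F (restr to_loc N) (\<lambda>p y. p \<odot>\<^bsub>N\<^esub> f y)"
    unfolding bilinear_map_def
  proof (intro conjI ballI mod_homI)
  qed (auto simp: loc_ring_mod_simps loc_ring_mod_smult fc N.smult_l_distr N.smult_assoc1[symmetric]
      mod_hom_add[OF f] mod_hom_smult[OF f] to_loc_closed N.smult_r_distr L.m_comm)
  obtain g where g: "g \<in> mod_hom R T (restr to_loc N)"
    "\<And>p y. p \<in> carrier L \<Longrightarrow> y \<in> carrier F \<Longrightarrow> g (pt p y) = p \<odot>\<^bsub>N\<^esub> f y"
    using tensor_descend[OF is_cring loc_ring_mod_module F RN B] by (auto simp: loc_ring_mod_simps)
  show thesis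
  proof (rule that)
    show "g \<in> mod_hom L LF N"
      by (rule loc_linear[OF loc_mod_module N mod_hom_comp[OF loc_mod_restr' g(1)]])
    show "g (pt \<one>\<^bsub>L\<^esub> y) = f y" if "y \<in> carrier F" for y using that fc by (simp add: g(2))
  qed
qed

lemma loc_mod_hom_eqI:
  assumes N: "module L N" and f: "f \<in> mod_hom L LF N" and g: "g \<in> mod_hom L LF N"
    and eq: "\<And>y. y \<in> carrier F \<Longrightarrow> f (pt \<one>\<^bsub>L\<^esub> y) = g (pt \<one>\<^bsub>L\<^esub> y)" and Z: "Z \<in> carrier LF"
  shows "f Z = g Z"
proof (rule T_hom_eqI[OF restr_module[OF is_cring to_loc_hom N]])
  show "Z \<in> carrier T" using Z by (simp add: loc_mod_simps)
  show "f \<in> mod_hom R T (restr to_loc N)" "g \<in> mod_hom R T (restr to_loc N)"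
    using mod_hom_comp[OF loc_mod_restr restr_hom[OF to_loc_hom f]]
      mod_hom_comp[OF loc_mod_restr restr_hom[OF to_loc_hom g]] by simp_all
  fix p y assume py: "p \<in> carrier L" "y \<in> carrier F"
  have 1: "pt \<one>\<^bsub>L\<^esub> y \<in> carrier LF" using py by (simp add: loc_mod_simps(1) pt_closed)
  have 2: "pt p y = p \<odot>\<^bsub>LF\<^esub> pt \<one>\<^bsub>L\<^esub> y" using py by (simp add: loc_mod_smult_pt)
  show "f (pt p y) = g (pt p y)"
    unfolding 2 mod_hom_smult[OF f py(1) 1] mod_hom_smult[OF g py(1) 1] eq[OF py(2)] ..
qed

end

section \<open>Weakly cotorsion modules and towers\<close>

text \<open>
  For a sequence as in \<open>localization_seq\<close>, the failure of this is the cokernel of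
  \<open>(x n) \<mapsto> (x n - sq n x (n + 1))\<close> on sequences in \<open>C\<close>, which is \<open>Ext\<^sup>1(S\<^sup>-\<^sup>1R, C)\<close>.
\<close>

definition tower_solvable :: "(nat \<Rightarrow> 'r) \<Rightarrow> ('r, 'c) module \<Rightarrow> bool" where
  "tower_solvable sq C \<longleftrightarrow> (\<forall>c. (\<forall>n. c n \<in> carrier C) \<longrightarrow>
    (\<exists>x. \<forall>n. x n \<in> carrier C \<and> x n = c n \<oplus>\<^bsub>C\<^esub> sq n \<odot>\<^bsub>C\<^esub> x (Suc n)))"

end

text \<open>
  Since every element of \<open>S\<close> recurs, an element killed by some \<open>u \<in> S\<close> is killed on multiplying it
  with enough consecutive terms of the sequence, and each \<open>1/s\<close> is a multiple of some \<open>1/(sq 0 \<cdots> sq n)\<close>.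
\<close>

locale localization_seq = localization R S for R :: "('r, 'k) ring_scheme" (structure) and S +
  fixes sq :: "nat \<Rightarrow> 'r"
  assumes sq_S [simp]: "sq n \<in> S" and sq_often: "u \<in> S \<Longrightarrow> \<exists>m\<ge>n. sq m = u"
begin

lemma sq_closed [simp]: "sq n \<in> carrier R" by simp

primrec part :: "nat \<Rightarrow> 'r" where
  "part 0 = \<one>" | "part (Suc n) = part n \<otimes> sq n"

lemma part_S [simp]: "part n \<in> S" by (induction n) auto

lemma part_closed [simp]: "part n \<in> carrier R" by simp

lemma raise_to:
  assumes "\<And>n a. Q n a \<Longrightarrow> Q (Suc n) (f n a)" "Q n a" "n \<le> m"
  shows "\<exists>a. Q m a"
  using assms(3) by (induction rule: dec_induct) (use assms(1,2) in blast)+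

lemma raise_to_zero:
  assumes "module R M" "\<And>n a. Q n a \<Longrightarrow> a \<in> carrier M" "\<And>n a. Q n a \<Longrightarrow> Q (Suc n) (sq n \<odot>\<^bsub>M\<^esub> a)"
    and "Q n a" "u \<in> S" "u \<odot>\<^bsub>M\<^esub> a = \<zero>\<^bsub>M\<^esub>"
  shows "\<exists>m. Q m \<zero>\<^bsub>M\<^esub>"
proof -
  interpret M: module R M by fact
  have "\<exists>a. Q m a \<and> u \<odot>\<^bsub>M\<^esub> a = \<zero>\<^bsub>M\<^esub>" if "n \<le> m" for m
  proof (rule raise_to[OF _ _ that])
    show "Q (Suc n) (sq n \<odot>\<^bsub>M\<^esub> a) \<and> u \<odot>\<^bsub>M\<^esub> (sq n \<odot>\<^bsub>M\<^esub> a) = \<zero>\<^bsub>M\<^esub>" if "Q n a \<and> u \<odot>\<^bsub>M\<^esub> a = \<zero>\<^bsub>M\<^esub>" for n a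
    proof -
      have a: "a \<in> carrier M" using that assms(2) by blast
      have "u \<odot>\<^bsub>M\<^esub> (sq n \<odot>\<^bsub>M\<^esub> a) = sq n \<odot>\<^bsub>M\<^esub> (u \<odot>\<^bsub>M\<^esub> a)"
        using a assms(5) by (simp add: M.smult_assoc1[symmetric] m_comm)
      then show ?thesis using that assms(3) by simp
    qed
    show "Q n a \<and> u \<odot>\<^bsub>M\<^esub> a = \<zero>\<^bsub>M\<^esub>" using assms by blast
  qed
  then show ?thesis using sq_often[OF assms(5)] assms(3) by metis
qed

text \<open>
  Here \<open>Q p c n b\<close> relates \<open>p\<close> and \<open>c\<close> through an auxiliary fraction \<open>b / part n\<close>. For \<open>p = 0\<close> the
  fraction is zero, but \<open>b\<close> is only torsion; enlarging the denominator, which keeps \<open>p\<close> and \<open>c\<close>, makes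
  the numerator zero, where \<open>c = 0\<close> is clear.
\<close>

lemma fraction_relation_hom:
  assumes "module R A" "module R C" "module R B"
    and closed: "\<And>p c n b. Q p c n b \<Longrightarrow> p \<in> carrier A \<and> c \<in> carrier C \<and> b \<in> carrier B"
    and step: "\<And>p c n b. Q p c n b \<Longrightarrow> Q p c (Suc n) (sq n \<odot>\<^bsub>B\<^esub> b)"
    and add: "\<And>p c n b p' c' b'. Q p c n b \<Longrightarrow> Q p' c' n b'
      \<Longrightarrow> Q (p \<oplus>\<^bsub>A\<^esub> p') (c \<oplus>\<^bsub>C\<^esub> c') n (b \<oplus>\<^bsub>B\<^esub> b')"
    and smult: "\<And>r p c n b. r \<in> carrier R \<Longrightarrow> Q p c n b \<Longrightarrow> Q (r \<odot>\<^bsub>A\<^esub> p) (r \<odot>\<^bsub>C\<^esub> c) n (r \<odot>\<^bsub>B\<^esub> b)"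
    and total: "\<And>p. p \<in> carrier A \<Longrightarrow> \<exists>c n b. Q p c n b"
    and torsion: "\<And>c n b. Q \<zero>\<^bsub>A\<^esub> c n b \<Longrightarrow> \<exists>u\<in>S. u \<odot>\<^bsub>B\<^esub> b = \<zero>\<^bsub>B\<^esub>"
    and zero: "\<And>c n. Q \<zero>\<^bsub>A\<^esub> c n \<zero>\<^bsub>B\<^esub> \<Longrightarrow> c = \<zero>\<^bsub>C\<^esub>"
  obtains h where "h \<in> mod_hom R A C" "\<And>p c n b. Q p c n b \<Longrightarrow> h p = c"
proof -
  obtain h where "h \<in> mod_hom R A C" "\<And>p c. (\<exists>n b. Q p c n b) \<Longrightarrow> h p = c"
  proof (rule linear_relation_hom[OF assms(1,2), of "\<lambda>p c. \<exists>n b. Q p c n b"])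
    fix p c p' c' assume "\<exists>n b. Q p c n b" "\<exists>n b. Q p' c' n b"
    then obtain n b n' b' where Q: "Q p c n b" "Q p' c' n' b'" by blast
    obtain a where 1: "Q p c (max n n') a"
      using raise_to[of "Q p c" "\<lambda>n b. sq n \<odot>\<^bsub>B\<^esub> b", OF step Q(1), of "max n n'"] by auto
    obtain a' where 2: "Q p' c' (max n n') a'"
      using raise_to[of "Q p' c'" "\<lambda>n b. sq n \<odot>\<^bsub>B\<^esub> b", OF step Q(2), of "max n n'"] by auto
    show "\<exists>n b. Q (p \<oplus>\<^bsub>A\<^esub> p') (c \<oplus>\<^bsub>C\<^esub> c') n b" using add[OF 1 2] by blast
  next
    fix c assume "\<exists>n b. Q \<zero>\<^bsub>A\<^esub> c n b"
    then obtain n b where Q: "Q \<zero>\<^bsub>A\<^esub> c n b" by blast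
    then obtain u where u: "u \<in> S" "u \<odot>\<^bsub>B\<^esub> b = \<zero>\<^bsub>B\<^esub>" using torsion by blast
    have "\<exists>m. Q \<zero>\<^bsub>A\<^esub> c m \<zero>\<^bsub>B\<^esub>"
      by (rule raise_to_zero[OF assms(3) _ step Q u]) (use closed in blast)
    then show "c = \<zero>\<^bsub>C\<^esub>" using zero by blast
  qed (use closed smult total in blast)+
  then show thesis using that by blast
qed

definition unit_frac :: "nat \<Rightarrow> ('r \<times> 'r) set" where
  "unit_frac n = loc_frac R S \<one> (part n)"

lemma unit_frac_closed: "unit_frac n \<in> carrier (loc_ring_mod R S)"
  by (simp add: unit_frac_def loc_ring_mod_simps loc_closed)

lemma unit_frac_smult:
  "a \<in> carrier R \<Longrightarrow> a \<odot>\<^bsub>loc_ring_mod R S\<^esub> unit_frac n = loc_frac R S a (part n)"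
  by (simp add: unit_frac_def loc_ring_mod_frac_smult)

lemma unit_frac_Suc: "sq n \<odot>\<^bsub>loc_ring_mod R S\<^esub> unit_frac (Suc n) = unit_frac n"
  by (subst unit_frac_smult, simp, unfold unit_frac_def, rule loc_eqI) (simp_all add: m_comm)

lemma loc_as_unit_frac:
  assumes "X \<in> carrier (loc_ring_mod R S)"
  obtains a n where "a \<in> carrier R" "X = a \<odot>\<^bsub>loc_ring_mod R S\<^esub> unit_frac n"
proof -
  obtain a s where a: "a \<in> carrier R" "s \<in> S" "X = loc_frac R S a s"
    using assms by (auto simp: loc_ring_mod_simps loc_carrier)
  obtain m where "sq m = s" using sq_often[OF a(2)] by blast
  then have "X = loc_frac R S (part m \<otimes> a) (part (Suc m))"
    unfolding a(3) using a(1,2) by (intro loc_eqI) (auto simp: m_ac)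
  then show thesis using a(1) by (intro that[of "part m \<otimes> a" "Suc m"]) (simp_all add: unit_frac_smult del: part.simps)
qed

lemma unit_frac_torsion:
  assumes "a \<in> carrier R" "a \<odot>\<^bsub>loc_ring_mod R S\<^esub> unit_frac n = \<zero>\<^bsub>loc_ring_mod R S\<^esub>"
  shows "\<exists>u\<in>S. u \<otimes> a = \<zero>"
  using assms by (auto simp: unit_frac_smult loc_ring_mod_simps loc_zero loc_eq_iff)

text \<open>
  Let \<open>b n\<close> be the basis element of the free cover over \<open>1/part n\<close>, so that \<open>d n = b n - sq n b (n + 1)\<close>
  is in the syzygy. A solution \<open>x\<close> of the tower for \<open>c n = g (d n)\<close> gives consistent values for an
  extension of \<open>g\<close> with \<open>b n \<mapsto> x n\<close>: any \<open>p\<close> is \<open>k + a b n\<close> with \<open>k\<close> in the syzygy, as any element of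
  \<open>S\<^sup>-\<^sup>1R\<close> is of the form \<open>a / part n\<close>, and \<open>p\<close> is sent to \<open>g k + a x n\<close>.
\<close>

lemma tower_solvable_Ext1:
  assumes C: "module R C" and tower: "tower_solvable sq C"
  shows "Ext1_vanishes R (loc_ring_mod R S) C"
  unfolding Ext1_vanishes_iff[OF loc_ring_mod_module C]
proof
  let ?A = "loc_ring_mod R S"
  let ?P = "free_cover R ?A" and ?K = "syz R ?A" and ?\<pi> = "cover_map R ?A"
  fix g assume g: "g \<in> mod_hom R ?K C"
  interpret A: module R ?A by (rule loc_ring_mod_module)
  interpret C: module R C by fact
  interpret P: module R ?P by (rule free_cover_module[OF loc_ring_mod_module])
  interpret K: module R ?K by (rule syz_module[OF loc_ring_mod_module])
  note \<pi> = cover_map_hom[OF loc_ring_mod_module]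
  note gc = mod_hom_closed[OF g]
  have KP: "x \<in> carrier ?P" if "x \<in> carrier ?K" for x using that by (simp add: syz_simps)
  have Kadd [simp]: "add ?K = add ?P" "zero ?K = zero ?P" "smult ?K = smult ?P"
    by (simp_all add: syz_simps)
  define b where "b n = (free_basis R (unit_frac n) :: ('r \<times> 'r) set \<Rightarrow> 'r)" for n
  have b [simp]: "b n \<in> carrier ?P" for n
    unfolding b_def free_cover_def by (rule free_basis_closed[OF unit_frac_closed])
  have \<pi>b: "?\<pi> (b n) = unit_frac n" for n
    unfolding b_def by (rule cover_map_basis[OF loc_ring_mod_module unit_frac_closed])
  define d where "d n = b n \<ominus>\<^bsub>?P\<^esub> sq n \<odot>\<^bsub>?P\<^esub> b (Suc n)" for n
  have d: "d n \<in> carrier ?K" for n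
    using unit_frac_closed
    by (simp add: d_def syz_simps mod_hom_minus[OF P.module_axioms A.module_axioms \<pi>] \<pi>b
        mod_hom_smult[OF \<pi>] unit_frac_Suc A.diff_eq_zero_iff)
  have dP [simp]: "d n \<in> carrier ?P" for n using d KP by blast
  have bd: "b n = d n \<oplus>\<^bsub>?P\<^esub> sq n \<odot>\<^bsub>?P\<^esub> b (Suc n)" for n
    by (simp add: d_def a_minus_def P.a_assoc P.l_neg)
  obtain x where x0: "\<forall>n. x n \<in> carrier C \<and> x n = g (d n) \<oplus>\<^bsub>C\<^esub> sq n \<odot>\<^bsub>C\<^esub> x (Suc n)"
    using tower[unfolded tower_solvable_def, rule_format, of "\<lambda>n. g (d n)", OF gc[OF d]] by (rule exE)
  note x = conjunct1[OF x0[rule_format]] conjunct2[OF x0[rule_format]]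
  define Q where "Q p c n a \<longleftrightarrow> a \<in> carrier R \<and> (\<exists>k\<in>carrier ?K.
    p = k \<oplus>\<^bsub>?P\<^esub> a \<odot>\<^bsub>?P\<^esub> b n \<and> c = g k \<oplus>\<^bsub>C\<^esub> a \<odot>\<^bsub>C\<^esub> x n)" for p c n a
  have QI: "Q p c n a" if "p = k \<oplus>\<^bsub>?P\<^esub> a \<odot>\<^bsub>?P\<^esub> b n" "c = g k \<oplus>\<^bsub>C\<^esub> a \<odot>\<^bsub>C\<^esub> x n" "a \<in> carrier R"
    "k \<in> carrier ?K" for p c n a k using that unfolding Q_def by blast
  have gadd: "g (k \<oplus>\<^bsub>?P\<^esub> k') = g k \<oplus>\<^bsub>C\<^esub> g k'" if "k \<in> carrier ?K" "k' \<in> carrier ?K" for k k'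
    using mod_hom_add[OF g that] by simp
  have gsm: "g (r \<odot>\<^bsub>?P\<^esub> k) = r \<odot>\<^bsub>C\<^esub> g k" if "k \<in> carrier ?K" "r \<in> carrier R" for k r
    using mod_hom_smult[OF g that(2,1)] by simp
  have Kcl: "k \<oplus>\<^bsub>?P\<^esub> k' \<in> carrier ?K" if "k \<in> carrier ?K" "k' \<in> carrier ?K" for k k'
    using K.add.m_closed[OF that] by simp
  have Ksm: "r \<odot>\<^bsub>?P\<^esub> k \<in> carrier ?K" if "k \<in> carrier ?K" "r \<in> carrier R" for k r
    using K.smult_closed[OF that(2,1)] by simp
  obtain h where h: "h \<in> mod_hom R ?P C" "\<And>p c n a. Q p c n a \<Longrightarrow> h p = c"
  proof (rule fraction_relation_hom[OF P.module_axioms C ring_mod_module, of Q])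
    fix p c n a assume "Q p c n a"
    then obtain k where k: "a \<in> carrier R" "k \<in> carrier ?K" "p = k \<oplus>\<^bsub>?P\<^esub> a \<odot>\<^bsub>?P\<^esub> b n"
      "c = g k \<oplus>\<^bsub>C\<^esub> a \<odot>\<^bsub>C\<^esub> x n" unfolding Q_def by blast
    show "p \<in> carrier ?P \<and> c \<in> carrier C \<and> a \<in> carrier (ring_mod R)"
      using k KP gc x(1) by simp
    have "Q p c (Suc n) (sq n \<otimes> a)"
    proof (rule QI)
      have "a \<odot>\<^bsub>?P\<^esub> b n = a \<odot>\<^bsub>?P\<^esub> d n \<oplus>\<^bsub>?P\<^esub> (sq n \<otimes> a) \<odot>\<^bsub>?P\<^esub> b (Suc n)"
        using k(1) by (subst bd) (simp add: P.smult_r_distr P.smult_assoc1[symmetric] m_comm)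
      then show "p = (k \<oplus>\<^bsub>?P\<^esub> a \<odot>\<^bsub>?P\<^esub> d n) \<oplus>\<^bsub>?P\<^esub> (sq n \<otimes> a) \<odot>\<^bsub>?P\<^esub> b (Suc n)"
        using k(1,2,3) KP by (simp add: P.a_assoc)
      have "a \<odot>\<^bsub>C\<^esub> x n = a \<odot>\<^bsub>C\<^esub> g (d n) \<oplus>\<^bsub>C\<^esub> (sq n \<otimes> a) \<odot>\<^bsub>C\<^esub> x (Suc n)"
        using k(1) x(1) gc d by (subst x(2)) (simp add: C.smult_r_distr C.smult_assoc1[symmetric] m_comm)
      then show "c = g (k \<oplus>\<^bsub>?P\<^esub> a \<odot>\<^bsub>?P\<^esub> d n) \<oplus>\<^bsub>C\<^esub> (sq n \<otimes> a) \<odot>\<^bsub>C\<^esub> x (Suc n)"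
        using k(1,2,4) gc d x(1) by (simp add: gadd gsm Ksm C.a_assoc)
      show "k \<oplus>\<^bsub>?P\<^esub> a \<odot>\<^bsub>?P\<^esub> d n \<in> carrier ?K" using k d by (intro Kcl Ksm)
    qed (use k in simp)
    then show "Q p c (Suc n) (sq n \<odot>\<^bsub>ring_mod R\<^esub> a)" by simp
    show "Q (r \<odot>\<^bsub>?P\<^esub> p) (r \<odot>\<^bsub>C\<^esub> c) n (r \<odot>\<^bsub>ring_mod R\<^esub> a)" if r: "r \<in> carrier R" for r
      using r k KP gc x(1)
      by (intro QI[of _ "r \<odot>\<^bsub>?P\<^esub> k"])
        (simp_all add: P.smult_r_distr C.smult_r_distr gsm Ksm P.smult_assoc1 C.smult_assoc1)
    fix p' c' a' assume "Q p' c' n a'"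
    then obtain k' where k': "a' \<in> carrier R" "k' \<in> carrier ?K" "p' = k' \<oplus>\<^bsub>?P\<^esub> a' \<odot>\<^bsub>?P\<^esub> b n"
      "c' = g k' \<oplus>\<^bsub>C\<^esub> a' \<odot>\<^bsub>C\<^esub> x n" unfolding Q_def by blast
    show "Q (p \<oplus>\<^bsub>?P\<^esub> p') (c \<oplus>\<^bsub>C\<^esub> c') n (a \<oplus>\<^bsub>ring_mod R\<^esub> a')"
      using k k' KP gc x(1)
      by (intro QI[of _ "k \<oplus>\<^bsub>?P\<^esub> k'"])
        (simp_all add: P.smult_l_distr C.smult_l_distr gadd Kcl P.a_ac C.a_ac)
  next
    fix p assume p: "p \<in> carrier ?P"
    obtain a n where a: "a \<in> carrier R" "?\<pi> p = a \<odot>\<^bsub>?A\<^esub> unit_frac n"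
      using loc_as_unit_frac[OF mod_hom_closed[OF \<pi> p]] .
    have k: "p \<ominus>\<^bsub>?P\<^esub> a \<odot>\<^bsub>?P\<^esub> b n \<in> carrier ?K"
      using a p unit_frac_closed
      by (simp add: syz_simps mod_hom_minus[OF P.module_axioms A.module_axioms \<pi>] \<pi>b
        mod_hom_smult[OF \<pi>] A.diff_eq_zero_iff)
    have "p = (p \<ominus>\<^bsub>?P\<^esub> a \<odot>\<^bsub>?P\<^esub> b n) \<oplus>\<^bsub>?P\<^esub> a \<odot>\<^bsub>?P\<^esub> b n"
      using p a by (simp add: a_minus_def P.a_assoc P.l_neg)
    from QI[OF this refl a(1) k] show "\<exists>c n a. Q p c n a" by blast
  next
    fix c n a assume "Q \<zero>\<^bsub>?P\<^esub> c n a"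
    then obtain k where k: "a \<in> carrier R" "k \<in> carrier ?K" "\<zero>\<^bsub>?P\<^esub> = k \<oplus>\<^bsub>?P\<^esub> a \<odot>\<^bsub>?P\<^esub> b n"
      unfolding Q_def by blast
    have "?\<pi> k = \<zero>\<^bsub>?A\<^esub>" "k \<in> carrier ?P" using k(2) by (simp_all add: syz_simps)
    then have "?\<pi> (k \<oplus>\<^bsub>?P\<^esub> a \<odot>\<^bsub>?P\<^esub> b n) = a \<odot>\<^bsub>?A\<^esub> unit_frac n"
      using k(1) unit_frac_closed by (simp add: mod_hom_add[OF \<pi>] mod_hom_smult[OF \<pi>] \<pi>b)
    then have "a \<odot>\<^bsub>?A\<^esub> unit_frac n = \<zero>\<^bsub>?A\<^esub>"
      using mod_hom_zero[OF P.module_axioms A.module_axioms \<pi>] unfolding k(3)[symmetric] by simp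
    from unit_frac_torsion[OF k(1) this]
    show "\<exists>u\<in>S. u \<odot>\<^bsub>ring_mod R\<^esub> a = \<zero>\<^bsub>ring_mod R\<^esub>" by simp
  next
    fix c n assume "Q \<zero>\<^bsub>?P\<^esub> c n \<zero>\<^bsub>ring_mod R\<^esub>"
    then obtain k where k: "k \<in> carrier ?K" "\<zero>\<^bsub>?P\<^esub> = k \<oplus>\<^bsub>?P\<^esub> \<zero> \<odot>\<^bsub>?P\<^esub> b n" "c = g k \<oplus>\<^bsub>C\<^esub> \<zero> \<odot>\<^bsub>C\<^esub> x n"
      unfolding Q_def by auto
    have "k = \<zero>\<^bsub>?P\<^esub>" using k(2)[symmetric] KP[OF k(1)] by simp
    then show "c = \<zero>\<^bsub>C\<^esub>"
      using k(3) x(1) mod_hom_zero[OF K.module_axioms C g] by simp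
  qed blast
  have "h k = g k" if "k \<in> carrier ?K" for k
    using that KP gc x(1) by (intro h(2)[of _ _ 0 \<zero>] QI[of _ k]) simp_all
  then show "\<exists>h\<in>mod_hom R ?P C. \<forall>x\<in>carrier ?K. h x = g x" using h(1) by blast
qed

text \<open>
  The element of \<open>S\<^sup>-\<^sup>1R\<close> given by \<open>\<Sum> p i / part i\<close>, for a finitely supported \<open>p\<close>, is
  \<open>clear p n / part n\<close> for large \<open>n\<close>.
\<close>

primrec clear :: "(nat \<Rightarrow> 'r) \<Rightarrow> nat \<Rightarrow> 'r" where
  "clear p 0 = p 0"
| "clear p (Suc n) = p (Suc n) \<oplus> sq n \<otimes> clear p n"

abbreviation (input) seq_free where "seq_free \<equiv> free_mod R (UNIV :: nat set)"

lemma clear_closed [simp]: "p \<in> carrier seq_free \<Longrightarrow> clear p n \<in> carrier R"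
  by (induction n) (auto simp: free_mod_closed)

lemma clear_add:
  assumes "p \<in> carrier seq_free" "q \<in> carrier seq_free"
  shows "clear (p \<oplus>\<^bsub>seq_free\<^esub> q) n = clear p n \<oplus> clear q n"
  using assms
  by (induction n) (simp_all add: free_mod_simps free_mod_closed[OF assms(1)]
    free_mod_closed[OF assms(2)] r_distr a_ac)

lemma clear_smult:
  assumes "p \<in> carrier seq_free" "r \<in> carrier R"
  shows "clear (r \<odot>\<^bsub>seq_free\<^esub> p) n = r \<otimes> clear p n"
  using assms
  by (induction n) (simp_all add: free_mod_simps free_mod_closed[OF assms(1)] r_distr m_lcomm)

text \<open>
  The kernel of \<open>\<Oplus>R \<rightarrow> S\<^sup>-\<^sup>1R\<close>, \<open>e n \<mapsto> 1/part n\<close>, is free on \<open>d n = e n - sq n e (n + 1)\<close>, and the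
  coordinates of \<open>p\<close> in this basis are \<open>clear p n\<close>; they vanish for large \<open>n\<close> since \<open>p\<close> goes to zero in
  \<open>S\<^sup>-\<^sup>1R\<close>. So \<open>d n \<mapsto> c n\<close> defines a map on the kernel. The values \<open>x n\<close> at \<open>e n\<close> of an extension of it
  to \<open>\<Oplus>R\<close> solve the tower for \<open>c\<close>.
\<close>

lemma Ext1_tower_solvable:
  assumes C: "module R C" and ext: "Ext1_vanishes R (loc_ring_mod R S) C"
  shows "tower_solvable sq C"
  unfolding tower_solvable_def
proof (intro allI impI)
  let ?A = "loc_ring_mod R S"
  interpret A: module R ?A by (rule loc_ring_mod_module)
  interpret C: module R C by fact
  interpret N: module R seq_free by (rule free_mod_module)
  fix c :: "nat \<Rightarrow> _" assume c: "\<forall>n. c n \<in> carrier C"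
  let ?\<pi> = "lin_ext R ?A unit_frac"
  have \<pi>: "?\<pi> \<in> mod_hom R seq_free ?A" by (rule lin_ext_hom[OF loc_ring_mod_module unit_frac_closed])
  define e where "e n = (free_basis R n :: nat \<Rightarrow> 'r)" for n
  have e [simp]: "e n \<in> carrier seq_free" for n unfolding e_def by (rule free_basis_closed) simp
  have \<pi>e: "?\<pi> (e n) = unit_frac n" for n
    unfolding e_def by (rule lin_ext_basis[where A = UNIV, OF loc_ring_mod_module UNIV_I unit_frac_closed])
  have onto: "?\<pi> ` carrier seq_free = carrier ?A"
  proof
    show "?\<pi> ` carrier seq_free \<subseteq> carrier ?A" using mod_hom_closed[OF \<pi>] by blast
    show "carrier ?A \<subseteq> ?\<pi> ` carrier seq_free"
    proof
      fix X assume X: "X \<in> carrier ?A"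
      obtain a n where "a \<in> carrier R" "X = a \<odot>\<^bsub>?A\<^esub> unit_frac n" using loc_as_unit_frac[OF X] .
      then have "X = ?\<pi> (a \<odot>\<^bsub>seq_free\<^esub> e n)" "a \<odot>\<^bsub>seq_free\<^esub> e n \<in> carrier seq_free"
        by (simp_all add: mod_hom_smult[OF \<pi>] \<pi>e)
      then show "X \<in> ?\<pi> ` carrier seq_free" by blast
    qed
  qed
  have unit_step: "(sq n \<otimes> a) \<odot>\<^bsub>?A\<^esub> unit_frac (Suc n) = a \<odot>\<^bsub>?A\<^esub> unit_frac n" if "a \<in> carrier R" for a n
    using that unit_frac_closed
    by (subst unit_frac_Suc[symmetric, of n]) (simp add: A.smult_assoc1[symmetric] m_comm)
  define H where "H = {p \<in> carrier seq_free. ?\<pi> p = \<zero>\<^bsub>?A\<^esub>}"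
  \<comment> \<open>The claim above about \<open>clear\<close> is linear in \<open>p\<close>, so it is checked on basis elements.\<close>
  define Cl where "Cl = {p \<in> carrier seq_free. \<exists>m. \<forall>n\<ge>m. ?\<pi> p = clear p n \<odot>\<^bsub>?A\<^esub> unit_frac n}"
  have ev: "carrier seq_free \<subseteq> Cl"
  proof (rule free_basis_generates)
    have add: "p \<oplus>\<^bsub>seq_free\<^esub> q \<in> Cl" if Cl: "p \<in> Cl" "q \<in> Cl" for p q
    proof -
      have pq: "p \<in> carrier seq_free" "q \<in> carrier seq_free" using Cl by (simp_all add: Cl_def)
      from Cl have "\<exists>m. \<forall>n\<ge>m. ?\<pi> p = clear p n \<odot>\<^bsub>?A\<^esub> unit_frac n"
        "\<exists>m. \<forall>n\<ge>m. ?\<pi> q = clear q n \<odot>\<^bsub>?A\<^esub> unit_frac n" by (simp_all only: Cl_def mem_Collect_eq)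
      then obtain m m' where m: "\<forall>n\<ge>m. ?\<pi> p = clear p n \<odot>\<^bsub>?A\<^esub> unit_frac n"
        "\<forall>n\<ge>m'. ?\<pi> q = clear q n \<odot>\<^bsub>?A\<^esub> unit_frac n" by (elim exE)
      have "?\<pi> (p \<oplus>\<^bsub>seq_free\<^esub> q) = clear (p \<oplus>\<^bsub>seq_free\<^esub> q) n \<odot>\<^bsub>?A\<^esub> unit_frac n" if "max m m' \<le> n" for n
        using pq unit_frac_closed[of n] m(1)[rule_format, of n] m(2)[rule_format, of n] that
        by (simp add: mod_hom_add[OF \<pi>] clear_add A.smult_l_distr)
      then show ?thesis using pq N.add.m_closed unfolding Cl_def by blast
    qed
    have smult: "r \<odot>\<^bsub>seq_free\<^esub> p \<in> Cl" if Cl: "r \<in> carrier R" "p \<in> Cl" for r p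
    proof -
      have p: "p \<in> carrier seq_free" using Cl by (simp add: Cl_def)
      from Cl have "\<exists>m. \<forall>n\<ge>m. ?\<pi> p = clear p n \<odot>\<^bsub>?A\<^esub> unit_frac n"
        by (simp only: Cl_def mem_Collect_eq)
      then obtain m where m: "\<forall>n\<ge>m. ?\<pi> p = clear p n \<odot>\<^bsub>?A\<^esub> unit_frac n" by (elim exE)
      have "?\<pi> (r \<odot>\<^bsub>seq_free\<^esub> p) = clear (r \<odot>\<^bsub>seq_free\<^esub> p) n \<odot>\<^bsub>?A\<^esub> unit_frac n" if "m \<le> n" for n
        using Cl(1) p unit_frac_closed[of n] m[rule_format, OF that]
        by (simp add: mod_hom_smult[OF \<pi>] clear_smult A.smult_assoc1)
      then show ?thesis using p Cl(1) N.smult_closed unfolding Cl_def by blast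
    qed
    have basis: "e i \<in> Cl" for i
    proof -
      have lt: "clear (e i) n = \<zero>" if "n < i" for n
        using that by (induction n) (auto simp: e_def free_basis_def)
      have "?\<pi> (e i) = clear (e i) n \<odot>\<^bsub>?A\<^esub> unit_frac n" if "i \<le> n" for n
        using that
      proof (induction rule: dec_induct)
        case base
        have "clear (e i) i = \<one>" using lt[of "i - 1"] by (cases i) (auto simp: e_def free_basis_def)
        then show ?case using unit_frac_closed by (simp add: \<pi>e)
      next
        case (step n)
        then have "e i (Suc n) = \<zero>" by (simp add: e_def free_basis_def)
        then have "clear (e i) (Suc n) = sq n \<otimes> clear (e i) n" by simp
        then show ?case using step unit_step[of "clear (e i) n" n] by simp
      qed
      then show ?thesis unfolding Cl_def by auto
    qed
    then show "free_basis R a \<in> Cl" for a unfolding e_def .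
    have zero: "\<zero>\<^bsub>seq_free\<^esub> \<in> Cl" using smult[OF zero_closed basis[of 0]] by simp
    show "submodule Cl R seq_free"
    proof (rule N.submoduleI)
      show "\<ominus>\<^bsub>seq_free\<^esub> p \<in> Cl" if "p \<in> Cl" for p
        using smult[OF _ that, of "\<ominus> \<one>"] that by (simp add: N.neg_eq_smult Cl_def)
    qed (use add smult zero in \<open>auto simp: Cl_def\<close>)
  qed
  have vanish: "\<exists>m. \<forall>n\<ge>m. clear p n = \<zero>" if p: "p \<in> H" for p
  proof -
    have pN: "p \<in> carrier seq_free" "?\<pi> p = \<zero>\<^bsub>?A\<^esub>" using p by (auto simp: H_def)
    then obtain m where m: "\<And>n. n \<ge> m \<Longrightarrow> ?\<pi> p = clear p n \<odot>\<^bsub>?A\<^esub> unit_frac n"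
      using ev unfolding Cl_def by blast
    have "finite {i. p i \<noteq> \<zero>}" using pN(1) by (simp add: free_mod_carrier)
    then obtain b where b: "\<And>i. p i \<noteq> \<zero> \<Longrightarrow> i \<le> b" by (auto simp: finite_nat_set_iff_bounded_le)
    \<comment> \<open>Beyond \<open>?k\<close> there are no further coefficients, so only multiplication by the \<open>sq n\<close> goes on,
      until it annihilates the torsion element \<open>clear p ?k\<close>.\<close>
    let ?k = "max m b"
    have Suc: "clear p (Suc n) = sq n \<otimes> clear p n" if "n \<ge> ?k" for n
      using that b[of "Suc n"] pN(1) by (cases "p (Suc n) = \<zero>") auto
    obtain u where u: "u \<in> S" "u \<otimes> clear p ?k = \<zero>"
      using unit_frac_torsion[of "clear p ?k" ?k] m[of ?k] pN by auto
    have uz: "u \<otimes> clear p n = \<zero>" if "n \<ge> ?k" for n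
      using that
    proof (induction rule: dec_induct)
      case (step n)
      have "u \<otimes> (sq n \<otimes> clear p n) = sq n \<otimes> (u \<otimes> clear p n)" using u(1) pN(1) by (simp add: m_lcomm)
      then show ?case using step Suc[of n] by simp
    qed (rule u(2))
    obtain l where l: "l \<ge> ?k" "sq l = u" using sq_often[OF u(1)] by blast
    have "clear p n = \<zero>" if "n \<ge> Suc l" for n
      using that
    proof (induction rule: dec_induct)
      case base then show ?case using Suc[OF l(1)] uz[OF l(1)] l(2) by simp
    next
      case (step n)
      then show ?case using Suc[of n] l(1) by simp
    qed
    then show ?thesis by blast
  qed
  have Hs: "submodule H R seq_free"
    unfolding H_def by (rule kernel_submodule[OF N.module_axioms A.module_axioms \<pi>])
  let ?H = "seq_free\<lparr>carrier := H\<rparr>"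
  note Hm = submodule_restrict[OF N.module_axioms Hs]
  have HN: "p \<in> H \<Longrightarrow> p \<in> carrier seq_free" for p by (simp add: H_def)
  have cP: "(\<lambda>n. clear p n \<odot>\<^bsub>C\<^esub> c n) \<in> A \<rightarrow> carrier C" if "p \<in> carrier seq_free" for p A
    using that c by auto
  define G where "G p x \<longleftrightarrow> p \<in> H \<and> (\<exists>m. (\<forall>n\<ge>m. clear p n = \<zero>) \<and>
    x = (\<Oplus>\<^bsub>C\<^esub>n\<in>{..<m}. clear p n \<odot>\<^bsub>C\<^esub> c n))" for p x
  have GI: "G p x" if "p \<in> H" "\<forall>n\<ge>m. clear p n = \<zero>" "x = (\<Oplus>\<^bsub>C\<^esub>n\<in>{..<m}. clear p n \<odot>\<^bsub>C\<^esub> c n)" for p x m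
    unfolding G_def using that by blast
  have longer: "(\<Oplus>\<^bsub>C\<^esub>n\<in>{..<m}. clear p n \<odot>\<^bsub>C\<^esub> c n) = (\<Oplus>\<^bsub>C\<^esub>n\<in>{..<m'}. clear p n \<odot>\<^bsub>C\<^esub> c n)"
    if "p \<in> carrier seq_free" "\<forall>n\<ge>m. clear p n = \<zero>" "m \<le> m'" for p m m'
    using that cP[OF that(1)] c by (intro C.add.finprod_mono_neutral_cong_left) auto
  obtain \<gamma> where \<gamma>: "\<gamma> \<in> mod_hom R ?H C" "\<And>p x. G p x \<Longrightarrow> \<gamma> p = x"
  proof (rule linear_relation_hom[OF Hm C, of G])
    show "a \<in> carrier ?H \<and> x \<in> carrier C" if "G a x" for a x
      using that cP HN by (auto simp: G_def intro!: C.finsum_closed)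
    show "\<exists>x. G a x" if "a \<in> carrier ?H" for a
      using that vanish[of a] unfolding G_def by auto
    fix p x q y assume "G p x" "G q y"
    then obtain m m' where *: "p \<in> H" "q \<in> H" "\<forall>n\<ge>m. clear p n = \<zero>" "\<forall>n\<ge>m'. clear q n = \<zero>"
      "x = (\<Oplus>\<^bsub>C\<^esub>n\<in>{..<m}. clear p n \<odot>\<^bsub>C\<^esub> c n)" "y = (\<Oplus>\<^bsub>C\<^esub>n\<in>{..<m'}. clear q n \<odot>\<^bsub>C\<^esub> c n)"
      unfolding G_def by blast
    let ?m = "max m m'"
    have x: "x = (\<Oplus>\<^bsub>C\<^esub>n\<in>{..<?m}. clear p n \<odot>\<^bsub>C\<^esub> c n)"
      unfolding *(5) by (rule longer) (use * HN in auto)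
    have y: "y = (\<Oplus>\<^bsub>C\<^esub>n\<in>{..<?m}. clear q n \<odot>\<^bsub>C\<^esub> c n)"
      unfolding *(6) by (rule longer) (use * HN in auto)
    have "x \<oplus>\<^bsub>C\<^esub> y = (\<Oplus>\<^bsub>C\<^esub>n\<in>{..<?m}. clear p n \<odot>\<^bsub>C\<^esub> c n \<oplus>\<^bsub>C\<^esub> clear q n \<odot>\<^bsub>C\<^esub> c n)"
      unfolding x y using cP * HN by (intro C.finsum_addf[symmetric]) auto
    also have "\<dots> = (\<Oplus>\<^bsub>C\<^esub>n\<in>{..<?m}. clear (p \<oplus>\<^bsub>seq_free\<^esub> q) n \<odot>\<^bsub>C\<^esub> c n)"
      using * HN c by (intro C.finsum_cong') (auto simp: clear_add C.smult_l_distr)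
    finally have sum: "x \<oplus>\<^bsub>C\<^esub> y = \<dots>" .
    have 0: "\<forall>n\<ge>?m. clear (p \<oplus>\<^bsub>seq_free\<^esub> q) n = \<zero>" using * HN by (simp add: clear_add)
    have "p \<oplus>\<^bsub>seq_free\<^esub> q \<in> H" using * N.submoduleE(5)[OF Hs] by blast
    from GI[OF this 0 sum] show "G (p \<oplus>\<^bsub>?H\<^esub> q) (x \<oplus>\<^bsub>C\<^esub> y)" by simp
  next
    fix r p x assume r: "r \<in> carrier R" and "G p x"
    then obtain m where *: "p \<in> H" "\<forall>n\<ge>m. clear p n = \<zero>"
      "x = (\<Oplus>\<^bsub>C\<^esub>n\<in>{..<m}. clear p n \<odot>\<^bsub>C\<^esub> c n)" unfolding G_def by blast
    have "r \<odot>\<^bsub>C\<^esub> x = (\<Oplus>\<^bsub>C\<^esub>n\<in>{..<m}. r \<odot>\<^bsub>C\<^esub> (clear p n \<odot>\<^bsub>C\<^esub> c n))"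
      unfolding *(3) using cP * HN r by (intro C.finsum_smult_ldistr) auto
    also have "\<dots> = (\<Oplus>\<^bsub>C\<^esub>n\<in>{..<m}. clear (r \<odot>\<^bsub>seq_free\<^esub> p) n \<odot>\<^bsub>C\<^esub> c n)"
      using * HN c r by (intro C.finsum_cong') (auto simp: clear_smult C.smult_assoc1)
    finally have sum: "r \<odot>\<^bsub>C\<^esub> x = \<dots>" .
    have 0: "\<forall>n\<ge>m. clear (r \<odot>\<^bsub>seq_free\<^esub> p) n = \<zero>" using * HN r by (simp add: clear_smult)
    have "r \<odot>\<^bsub>seq_free\<^esub> p \<in> H" using * r N.submoduleE(4)[OF Hs] by blast
    from GI[OF this 0 sum] show "G (r \<odot>\<^bsub>?H\<^esub> p) (r \<odot>\<^bsub>C\<^esub> x)" by simp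
  next
    fix x assume "G \<zero>\<^bsub>?H\<^esub> x"
    then obtain m where m: "x = (\<Oplus>\<^bsub>C\<^esub>n\<in>{..<m}. clear \<zero>\<^bsub>seq_free\<^esub> n \<odot>\<^bsub>C\<^esub> c n)" unfolding G_def by auto
    have "clear \<zero>\<^bsub>seq_free\<^esub> n = \<zero>" for n by (induction n) (simp_all add: free_mod_simps)
    then show "x = \<zero>\<^bsub>C\<^esub>" unfolding m using c by simp
  qed blast
  obtain h where h: "h \<in> mod_hom R seq_free C" "\<And>p. p \<in> H \<Longrightarrow> h p = \<gamma> p"
    using Ext1_vanishes_extend[OF ext A.module_axioms C N.module_axioms \<pi> onto H_def \<gamma>(1)] by blast
  have x: "h (e n) = c n \<oplus>\<^bsub>C\<^esub> sq n \<odot>\<^bsub>C\<^esub> h (e (Suc n))" for n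
  proof -
    define d where "d = e n \<ominus>\<^bsub>seq_free\<^esub> sq n \<odot>\<^bsub>seq_free\<^esub> e (Suc n)"
    have d: "d = e n \<oplus>\<^bsub>seq_free\<^esub> (\<ominus> sq n) \<odot>\<^bsub>seq_free\<^esub> e (Suc n)"
      by (simp add: d_def a_minus_def N.smult_l_minus)
    have dN: "d \<in> carrier seq_free" by (simp add: d)
    have dH: "d \<in> H" unfolding H_def
      using dN unit_frac_closed by (simp add: d_def mod_hom_minus[OF N.module_axioms A.module_axioms \<pi>]
        mod_hom_smult[OF \<pi>] \<pi>e unit_frac_Suc A.diff_eq_zero_iff)
    have val: "d i = (if i = n then \<one> else if i = Suc n then \<ominus> sq n else \<zero>)" for i
      by (auto simp: d free_mod_simps e_def free_basis_def)
    have lt: "clear d i = \<zero>" if "i < n" for i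
      using that by (induction i) (auto simp: val)
    have eq: "clear d n = \<one>" using lt[of "n - 1"] by (cases n) (auto simp: val)
    have gt: "clear d i = \<zero>" if "Suc n \<le> i" for i
      using that
    proof (induction rule: dec_induct)
      case base then show ?case using val[of "Suc n"] eq by (simp add: l_neg)
    next
      case (step j) then show ?case using val[of "Suc j"] by simp
    qed
    have "\<gamma> d = (\<Oplus>\<^bsub>C\<^esub>i\<in>{..<Suc n}. clear d i \<odot>\<^bsub>C\<^esub> c i)"
      by (rule \<gamma>(2)) (use dH gt in \<open>auto simp: G_def intro!: exI[of _ "Suc n"]\<close>)
    also have "\<dots> = (\<Oplus>\<^bsub>C\<^esub>i\<in>{..<Suc n}. if n = i then c i else \<zero>\<^bsub>C\<^esub>)"
      using c lt eq by (intro C.finsum_cong') (auto simp: less_Suc_eq)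
    also have "\<dots> = c n" using c by (subst C.finsum_singleton) auto
    finally have "h d = c n" using h(2)[OF dH] by simp
    then have *: "h (e n) \<ominus>\<^bsub>C\<^esub> sq n \<odot>\<^bsub>C\<^esub> h (e (Suc n)) = c n"
      by (simp add: d_def mod_hom_minus[OF N.module_axioms C h(1)] mod_hom_smult[OF h(1)])
    show ?thesis
      unfolding *[symmetric] using mod_hom_closed[OF h(1) e]
      by (simp add: a_minus_def C.a_assoc C.l_neg)
  qed
  then show "\<exists>x. \<forall>n. x n \<in> carrier C \<and> x n = c n \<oplus>\<^bsub>C\<^esub> sq n \<odot>\<^bsub>C\<^esub> x (Suc n)"
    using mod_hom_closed[OF h(1) e] by (intro exI[of _ "\<lambda>n. h (e n)"]) blast
qed

end

lemma (in localization) localization_seq_exists: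
  assumes "countable S"
  obtains sq where "localization_seq R S sq"
proof
  have ne: "S \<noteq> {}" using one_S by blast
  \<comment> \<open>Each element is repeated once for every second component of the pairing function.\<close>
  let ?sq = "\<lambda>n. from_nat_into S (fst (prod_decode n))"
  show "localization_seq R S ?sq"
  proof
    show "?sq n \<in> S" for n by (rule from_nat_into[OF ne])
    fix u n assume "u \<in> S"
    then obtain i where "from_nat_into S i = u" using from_nat_into_surj[OF assms] by blast
    then show "\<exists>m\<ge>n. ?sq m = u" by (intro exI[of _ "prod_encode (i, n)"]) (simp add: le_prod_encode_2)
  qed
qed

section \<open>Projectivity after base change\<close>

text \<open>
  \<open>F'\<close> with \<open>\<eta> : F \<rightarrow> F'\<close> represents the maps from \<open>F\<close> into modules over \<open>R'\<close>; then projectivity of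
  \<open>F'\<close> is a lifting property of \<open>F\<close>: restrict along \<open>\<eta>\<close>, lift, and extend again.
\<close>

lemma projective_base_change:
  fixes U :: "'u itself" and F :: "('r, 'f) module" and F' :: "('q, 'g) module"
  assumes \<phi>: "\<phi> \<in> ring_hom R R'" and F': "module R' F'"
    and \<eta>: "\<eta> \<in> mod_hom R F (restr \<phi> F')"
    and extend: "\<And>(N :: ('q, 'u) module) f. module R' N \<Longrightarrow> f \<in> mod_hom R F (restr \<phi> N)
      \<Longrightarrow> \<exists>g\<in>mod_hom R' F' N. \<forall>y\<in>carrier F. g (\<eta> y) = f y"
    and unique: "\<And>(N :: ('q, 'u) module) f g. module R' N \<Longrightarrow> f \<in> mod_hom R' F' N
      \<Longrightarrow> g \<in> mod_hom R' F' N \<Longrightarrow> \<forall>y\<in>carrier F. f (\<eta> y) = g (\<eta> y)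
      \<Longrightarrow> \<forall>x\<in>carrier F'. f x = g x"
    and lift: "\<And>(M :: ('q, 'u) module) (N :: ('q, 'u) module) g f. module R' M \<Longrightarrow> module R' N
      \<Longrightarrow> g \<in> mod_hom R' M N \<Longrightarrow> g ` carrier M = carrier N \<Longrightarrow> f \<in> mod_hom R F (restr \<phi> N)
      \<Longrightarrow> \<exists>h\<in>mod_hom R F (restr \<phi> M). \<forall>y\<in>carrier F. g (h y) = f y"
  shows "projective_mod R' F' U"
  unfolding projective_mod_def
proof (intro conjI F' allI impI)
  fix M N :: "('q, 'u) module" and g f
  assume M: "module R' M" and N: "module R' N" and g: "g \<in> mod_hom R' M N"
    "g ` carrier M = carrier N" and f: "f \<in> mod_hom R' F' N"
  have "(\<lambda>y. f (\<eta> y)) \<in> mod_hom R F (restr \<phi> N)"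
    by (rule mod_hom_comp[OF \<eta> restr_hom[OF \<phi> f]])
  then obtain h where h: "h \<in> mod_hom R F (restr \<phi> M)" "\<forall>y\<in>carrier F. g (h y) = f (\<eta> y)"
    using lift[OF M N g] by blast
  then obtain h' where h': "h' \<in> mod_hom R' F' M" "\<forall>y\<in>carrier F. h' (\<eta> y) = h y"
    using extend[OF M] by blast
  have "\<forall>x\<in>carrier F'. g (h' x) = f x"
    by (rule unique[OF N mod_hom_comp[OF h'(1) g(1)] f]) (use h(2) h'(2) in simp)
  then show "\<exists>h\<in>mod_hom R' F' M. \<forall>x\<in>carrier F'. g (h x) = f x" using h'(1) by blast
qed

text \<open>
  It suffices that \<open>M\<close> embeds into \<open>'u\<close>: its quotient \<open>N\<close> then embeds too, by choosing preimages.
\<close>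

lemma projective_lift_small:
  fixes i :: "'m \<Rightarrow> 'u"
  assumes P: "projective_mod R P TYPE('u)" and M: "module R M" and N: "module R N"
    and g: "g \<in> mod_hom R M N" "g ` carrier M = carrier N" and f: "f \<in> mod_hom R P N"
    and i: "inj_on i (carrier M)"
  obtains h where "h \<in> mod_hom R P M" "\<And>x. x \<in> carrier P \<Longrightarrow> g (h x) = f x"
proof -
  let ?j = "\<lambda>x. i (inv_into (carrier M) g x)"
  have j: "inj_on ?j (carrier N)"
    by (rule inj_onI) (metis g(2) i inj_onD inv_into_injective inv_into_into)
  note cM = copy_mod[OF M i] and cN = copy_mod[OF N j]
  let ?g = "\<lambda>x. ?j (g (inv_into (carrier M) i x))"
  have gh: "?g \<in> mod_hom R (copy_mod i M) (copy_mod ?j N)"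
    by (rule mod_hom_comp[OF mod_hom_comp[OF cM(4) g(1)] cN(3)])
  have onto: "?g ` carrier (copy_mod i M) = carrier (copy_mod ?j N)"
    unfolding cM(2) cN(2) image_image g(2)[symmetric]
    by (rule image_cong) (simp_all add: inv_into_f_f[OF i])
  have fh: "(\<lambda>x. ?j (f x)) \<in> mod_hom R P (copy_mod ?j N)" by (rule mod_hom_comp[OF f cN(3)])
  obtain h where h: "h \<in> mod_hom R P (copy_mod i M)" "\<forall>x\<in>carrier P. ?g (h x) = ?j (f x)"
    using P cM(1) cN(1) gh onto fh unfolding projective_mod_def by blast
  show thesis
  proof (rule that[OF mod_hom_comp[OF h(1) cM(4)]])
    fix x assume x: "x \<in> carrier P"
    have "inv_into (carrier M) i (h x) \<in> carrier M"
      using mod_hom_closed[OF mod_hom_comp[OF h(1) cM(4)] x] .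
    then have "g (inv_into (carrier M) i (h x)) \<in> carrier N" using g(2) by blast
    then show "g (inv_into (carrier M) i (h x)) = f x"
      using h(2) x mod_hom_closed[OF f x] inj_onD[OF j] by blast
  qed
qed

section \<open>Reduction modulo an element\<close>

lemma (in cring) ring_mod_minus:
  "a \<in> carrier R \<Longrightarrow> b \<in> carrier R \<Longrightarrow> b \<ominus>\<^bsub>ring_mod R\<^esub> a = b \<ominus> a"
  using module.neg_eq_smult[OF ring_mod_module, of a] by (simp add: a_minus_def l_minus)

lemma scale_submodule:
  fixes F :: "('r, 'f) module"
  assumes "module R F" "s \<in> carrier R" "submodule K R F"
  shows "submodule ((\<lambda>x. s \<odot>\<^bsub>F\<^esub> x) ` K) R F"
proof -
  interpret F: module R F by fact
  have "(\<lambda>x. x) \<in> mod_hom R (F\<lparr>carrier := K\<rparr>) F"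
    using F.submoduleE(1)[OF assms(3)] by (auto simp: mod_hom_def)
  from mod_hom_scale[OF submodule_restrict[OF assms(1,3)] assms(1) this assms(2)]
  show ?thesis using range_submodule[OF submodule_restrict[OF assms(1,3)] assms(1)] by force
qed

context
  fixes R :: "('r, 'k) ring_scheme" and F :: "('r, 'f) module" and s :: 'r
  assumes F: "module R F" and s: "s \<in> carrier R"
begin

interpretation F: module R F by (rule F)
interpretation I: ideal "PIdl\<^bsub>R\<^esub> s" R by (rule F.R.cgenideal_ideal[OF s])

abbreviation (input) "sF \<equiv> (\<lambda>x. s \<odot>\<^bsub>F\<^esub> x) ` carrier F"
abbreviation (input) "Rs \<equiv> R Quot (PIdl\<^bsub>R\<^esub> s)"
abbreviation (input) "red \<equiv> \<lambda>a. PIdl\<^bsub>R\<^esub> s +>\<^bsub>R\<^esub> a"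
abbreviation (input) "cls \<equiv> \<lambda>x. sF +>\<^bsub>F\<^esub> x"

lemma sF_submodule: "submodule sF R F"
  by (rule scale_submodule[OF F s F.carrier_is_submodule])

lemma red_ring_hom: "red \<in> ring_hom R Rs"
  using I.rcos_ring_hom by simp

lemma red_onto: "red ` carrier R = carrier Rs"
  by (auto simp: FactRing_def A_RCOSETS_def')

lemma Rs_cring: "cring Rs"
  by (rule I.quotient_is_cring[OF F.R.is_cring])

lemma red_mod_simps:
  "carrier (red_mod R F s) = cls ` carrier F"
  "\<zero>\<^bsub>red_mod R F s\<^esub> = sF"
  "x \<in> carrier F \<Longrightarrow> y \<in> carrier F \<Longrightarrow> cls x \<oplus>\<^bsub>red_mod R F s\<^esub> cls y = cls (x \<oplus>\<^bsub>F\<^esub> y)"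
  using quot_mod_ops[OF F sF_submodule] by (simp_all add: red_mod_def Let_def)

lemma PIdl_mem: "a \<in> PIdl\<^bsub>R\<^esub> s \<longleftrightarrow> (\<exists>r\<in>carrier R. a = r \<otimes>\<^bsub>R\<^esub> s)"
  unfolding cgenideal_def by blast

lemma red_mod_smult:
  assumes "a \<in> carrier R" "x \<in> carrier F"
  shows "red a \<odot>\<^bsub>red_mod R F s\<^esub> cls x = cls (a \<odot>\<^bsub>F\<^esub> x)"
proof -
  note S = sF_submodule
  have inner: "(\<Union>y\<in>cls x. cls (b \<odot>\<^bsub>F\<^esub> y)) = cls (b \<odot>\<^bsub>F\<^esub> x)" if "b \<in> carrier R" for b
    using that assms(2) F.submoduleE(4)[OF S that]
    by (intro F.coset_UN S) (auto simp: F.coset_eq_iff[OF S] F.smult_minus_distr[symmetric])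
  have "(\<Union>b\<in>red a. \<Union>y\<in>cls x. cls (b \<odot>\<^bsub>F\<^esub> y)) = (\<Union>y\<in>cls x. cls (a \<odot>\<^bsub>F\<^esub> y))"
  proof (rule module.coset_UN[OF F.R.ring_mod_module F.R.ideal_submodule[OF I.ideal_axioms],
        of a, simplified a_r_coset_def' ring_mod_simps, folded a_r_coset_def'])
    fix b assume b: "b \<in> carrier R" "b \<ominus>\<^bsub>ring_mod R\<^esub> a \<in> PIdl\<^bsub>R\<^esub> s"
    then obtain r where r: "r \<in> carrier R" "b \<ominus>\<^bsub>R\<^esub> a = r \<otimes>\<^bsub>R\<^esub> s"
      using assms(1) by (auto simp: F.R.ring_mod_minus PIdl_mem)
    have "(b \<odot>\<^bsub>F\<^esub> x) \<ominus>\<^bsub>F\<^esub> (a \<odot>\<^bsub>F\<^esub> x) = (b \<ominus>\<^bsub>R\<^esub> a) \<odot>\<^bsub>F\<^esub> x"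
      using b assms by (simp add: a_minus_def F.smult_l_distr F.smult_l_minus)
    also have "\<dots> = s \<odot>\<^bsub>F\<^esub> (r \<odot>\<^bsub>F\<^esub> x)"
      unfolding r(2) using r(1) s assms by (simp add: F.smult_assoc1[symmetric] F.R.m_comm)
    also have "\<dots> \<in> sF" using r assms by blast
    finally show "(\<Union>y\<in>cls x. cls (b \<odot>\<^bsub>F\<^esub> y)) = (\<Union>y\<in>cls x. cls (a \<odot>\<^bsub>F\<^esub> y))"
      unfolding inner[OF b(1)] inner[OF assms(1)] using b assms by (simp add: F.coset_eq_iff[OF S])
  qed (use assms in simp)
  then show ?thesis unfolding inner[OF assms(1)] by (simp add: red_mod_def Let_def)
qed

lemma red_mod_module: "module Rs (red_mod R F s)"
  by (rule module_image[OF F Rs_cring red_ring_hom red_onto, of cls])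
    (simp_all add: red_mod_simps red_mod_smult F.coset_zero[OF sF_submodule])

lemma red_unit: "cls \<in> mod_hom R F (restr red (red_mod R F s))"
  by (intro mod_homI) (simp_all add: red_mod_simps red_mod_smult)

lemma red_zero: "red s = \<zero>\<^bsub>Rs\<^esub>"
  using I.a_rcos_const[OF F.R.cgenideal_self[OF s]] by (simp add: FactRing_def)

text \<open>A map from \<open>F\<close> into a module over \<open>R/sR\<close> kills \<open>sF\<close>.\<close>

lemma red_mod_extend:
  assumes N: "module Rs N" and f: "f \<in> mod_hom R F (restr red N)"
  obtains g where "g \<in> mod_hom Rs (red_mod R F s) N" "\<And>y. y \<in> carrier F \<Longrightarrow> g (cls y) = f y"
proof -
  interpret N: module Rs N by (rule N)
  have ker: "f x = \<zero>\<^bsub>restr red N\<^esub>" if "x \<in> carrier F" "cls x = \<zero>\<^bsub>restr red (red_mod R F s)\<^esub>" for x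
  proof -
    have "x \<in> sF" using that by (simp add: red_mod_simps F.coset_eq_zero_iff[OF sF_submodule])
    then obtain y where "y \<in> carrier F" "x = s \<odot>\<^bsub>F\<^esub> y" by blast
    then show ?thesis using mod_hom_smult[OF f s] mod_hom_closed[OF f] by (simp add: red_zero)
  qed
  obtain g where g: "g \<in> mod_hom R (restr red (red_mod R F s)) (restr red N)"
    "\<And>x. x \<in> carrier F \<Longrightarrow> g (cls x) = f x"
    using hom_factor[OF F restr_module[OF F.R.is_cring red_ring_hom red_mod_module]
        restr_module[OF F.R.is_cring red_ring_hom N] red_unit _ f ker]
    by (auto simp: red_mod_simps)
  show thesis
  proof (rule that)
    show "g \<in> mod_hom Rs (red_mod R F s) N"
      using g(1) unfolding mod_hom_def red_onto[symmetric] by auto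
  qed (rule g(2))
qed

end

section \<open>Strongly flat modules have projective reductions and localization\<close>

context localization_seq
begin

text \<open>
  Substituting the equations into each other, \<open>x n\<close> is a finite sum that ends at the first
  occurrence of \<open>u\<close> from position \<open>n\<close> on; \<open>X d n\<close> is the sum that ends after \<open>d\<close> further steps.
\<close>

lemma tower_solvable_killed:
  assumes C: "module R C" and u: "u \<in> S" "\<And>x. x \<in> carrier C \<Longrightarrow> u \<odot>\<^bsub>C\<^esub> x = \<zero>\<^bsub>C\<^esub>"
  shows "tower_solvable sq C"
  unfolding tower_solvable_def
proof (intro allI impI)
  interpret C: module R C by fact
  fix c :: "nat \<Rightarrow> _" assume c: "\<forall>n. c n \<in> carrier C"
  define X where "X = rec_nat c (\<lambda>_ y n. c n \<oplus>\<^bsub>C\<^esub> sq n \<odot>\<^bsub>C\<^esub> y (Suc n))"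
  have X0: "X 0 n = c n" and XS: "X (Suc d) n = c n \<oplus>\<^bsub>C\<^esub> sq n \<odot>\<^bsub>C\<^esub> X d (Suc n)" for d n
    by (simp_all add: X_def)
  have Xc: "X d n \<in> carrier C" for d n
    by (induction d arbitrary: n) (use c in \<open>auto simp: X0 XS\<close>)
  define dist where "dist n = (LEAST d. sq (n + d) = u)" for n
  have ex: "\<exists>d. sq (n + d) = u" for n
    using sq_often[OF u(1), of n] by (auto simp: le_iff_add)
  have "X (dist n) n = c n \<oplus>\<^bsub>C\<^esub> sq n \<odot>\<^bsub>C\<^esub> X (dist (Suc n)) (Suc n)" for n
  proof (cases "sq n = u")
    case True
    then have "dist n = 0" unfolding dist_def by (intro Least_eq_0) simp
    then show ?thesis using True u(2)[OF Xc] c by (simp add: X0)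
  next
    case False
    obtain d where d: "sq (n + d) = u" using ex by blast
    have "dist n = Suc (dist (Suc n))"
      unfolding dist_def using Least_Suc[of "\<lambda>d. sq (n + d) = u", OF d] False by simp
    then show ?thesis by (simp add: XS)
  qed
  then show "\<exists>x. \<forall>n. x n \<in> carrier C \<and> x n = c n \<oplus>\<^bsub>C\<^esub> sq n \<odot>\<^bsub>C\<^esub> x (Suc n)"
    using Xc by (intro exI[of _ "\<lambda>n. X (dist n) n"]) blast
qed

lemma tower_solvable_divisible:
  assumes C: "module R C" and div: "\<And>n y. y \<in> carrier C \<Longrightarrow> \<exists>z\<in>carrier C. sq n \<odot>\<^bsub>C\<^esub> z = y"
  shows "tower_solvable sq C"
  unfolding tower_solvable_def
proof (intro allI impI)
  interpret C: module R C by fact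
  fix c :: "nat \<Rightarrow> _" assume c: "\<forall>n. c n \<in> carrier C"
  define q where "q n y = (SOME z. z \<in> carrier C \<and> sq n \<odot>\<^bsub>C\<^esub> z = y)" for n y
  have q: "q n y \<in> carrier C \<and> sq n \<odot>\<^bsub>C\<^esub> q n y = y" if "y \<in> carrier C" for n y
    unfolding q_def by (rule someI_ex) (use div[OF that] in blast)
  define x where "x = rec_nat \<zero>\<^bsub>C\<^esub> (\<lambda>n y. q n (y \<ominus>\<^bsub>C\<^esub> c n))"
  have xS: "x (Suc n) = q n (x n \<ominus>\<^bsub>C\<^esub> c n)" for n by (simp add: x_def)
  have xc: "x n \<in> carrier C" for n
    by (induction n) (use c q in \<open>auto simp: xS, simp add: x_def\<close>)
  have "x n = c n \<oplus>\<^bsub>C\<^esub> sq n \<odot>\<^bsub>C\<^esub> x (Suc n)" for n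
  proof -
    have "sq n \<odot>\<^bsub>C\<^esub> x (Suc n) = x n \<ominus>\<^bsub>C\<^esub> c n" using q xc c by (simp add: xS)
    moreover have "c n \<oplus>\<^bsub>C\<^esub> (x n \<ominus>\<^bsub>C\<^esub> c n) = x n \<oplus>\<^bsub>C\<^esub> (c n \<ominus>\<^bsub>C\<^esub> c n)"
      using xc c by (simp add: a_minus_def C.a_lcomm)
    ultimately show ?thesis using xc c by (simp add: a_minus_def C.r_neg)
  qed
  then show "\<exists>x. \<forall>n. x n \<in> carrier C \<and> x n = c n \<oplus>\<^bsub>C\<^esub> sq n \<odot>\<^bsub>C\<^esub> x (Suc n)" using xc by blast
qed

text \<open>The kernel of the surjection is weakly cotorsion, so Ext vanishes and the map lifts.\<close>

lemma strongly_flat_lift: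
  fixes M :: "('q, 'u) module" and N :: "('q, 'u) module"
  assumes sf: "strongly_flat R S F TYPE('u)" and \<phi>: "\<phi> \<in> ring_hom R R'"
    and M: "module R' M" and N: "module R' N"
    and g: "g \<in> mod_hom R' M N" "g ` carrier M = carrier N" and f: "f \<in> mod_hom R F (restr \<phi> N)"
    and tower: "module R ((restr \<phi> M)\<lparr>carrier := {x \<in> carrier M. g x = \<zero>\<^bsub>N\<^esub>}\<rparr>)
      \<Longrightarrow> tower_solvable sq ((restr \<phi> M)\<lparr>carrier := {x \<in> carrier M. g x = \<zero>\<^bsub>N\<^esub>}\<rparr>)"
  shows "\<exists>h\<in>mod_hom R F (restr \<phi> M). \<forall>y\<in>carrier F. g (h y) = f y"
proof -
  let ?H = "{x \<in> carrier M. g x = \<zero>\<^bsub>N\<^esub>}" and ?C = "(restr \<phi> M)\<lparr>carrier := {x \<in> carrier M. g x = \<zero>\<^bsub>N\<^esub>}\<rparr>"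
  have F: "module R F" using sf by (simp add: strongly_flat_def)
  note RM = restr_module[OF is_cring \<phi> M] and RN = restr_module[OF is_cring \<phi> N]
  note g' = restr_hom[OF \<phi> g(1)]
  have H: "?H = {x \<in> carrier (restr \<phi> M). g x = \<zero>\<^bsub>restr \<phi> N\<^esub>}" by simp
  have C: "module R ?C" unfolding H by (intro submodule_restrict kernel_submodule RM RN g')
  then have "weakly_cotorsion R S ?C"
    unfolding weakly_cotorsion_def using tower tower_solvable_Ext1 by blast
  then have "Ext1_vanishes R F ?C" using sf by (simp add: strongly_flat_def)
  then obtain h where "h \<in> mod_hom R F (restr \<phi> M)" "\<And>y. y \<in> carrier F \<Longrightarrow> g (h y) = f y"
    using Ext1_vanishes_lift[OF F RM RN g' _ H _ f] g(2) by auto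
  then show ?thesis by blast
qed

lemma strongly_flat_reduction:
  assumes sf: "strongly_flat R S F TYPE('u)" and s: "s \<in> S"
  shows "projective_mod (R Quot (PIdl s)) (red_mod R F s) TYPE('u)"
proof -
  have F: "module R F" using sf by (simp add: strongly_flat_def)
  have sR: "s \<in> carrier R" using s by simp
  show ?thesis
  proof (rule projective_base_change[OF red_ring_hom[OF F sR] red_mod_module[OF F sR] red_unit[OF F sR]])
    fix N :: "('r set, 'u) module" and f
    assume "module (R Quot PIdl s) N" "f \<in> mod_hom R F (restr ((+>) (PIdl s)) N)"
    from red_mod_extend[OF F sR this]
    show "\<exists>g\<in>mod_hom (R Quot PIdl s) (red_mod R F s) N.
      \<forall>y\<in>carrier F. g ((\<lambda>x. s \<odot>\<^bsub>F\<^esub> x) ` carrier F +>\<^bsub>F\<^esub> y) = f y" by metis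
  next
    fix N :: "('r set, 'u) module" and f g
    assume "\<forall>y\<in>carrier F. f ((\<lambda>x. s \<odot>\<^bsub>F\<^esub> x) ` carrier F +>\<^bsub>F\<^esub> y)
      = g ((\<lambda>x. s \<odot>\<^bsub>F\<^esub> x) ` carrier F +>\<^bsub>F\<^esub> y)"
    then show "\<forall>x\<in>carrier (red_mod R F s). f x = g x" by (simp add: red_mod_simps[OF F sR])
  next
    fix M N :: "('r set, 'u) module" and g f
    assume M: "module (R Quot PIdl s) M" and N: "module (R Quot PIdl s) N"
      and g: "g \<in> mod_hom (R Quot PIdl s) M N" "g ` carrier M = carrier N"
      and f: "f \<in> mod_hom R F (restr ((+>) (PIdl s)) N)"
    interpret M: module "R Quot PIdl s" M by (rule M)
    show "\<exists>h\<in>mod_hom R F (restr ((+>) (PIdl s)) M). \<forall>y\<in>carrier F. g (h y) = f y"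
      by (rule strongly_flat_lift[OF sf red_ring_hom[OF F sR] M N g f], rule tower_solvable_killed[OF _ s])
        (auto simp: red_zero[OF F sR])
  qed
qed

lemma strongly_flat_localization:
  assumes sf: "strongly_flat R S F TYPE('u)"
  shows "projective_mod L (loc_mod R S F) TYPE('u)"
proof -
  have F: "module R F" using sf by (simp add: strongly_flat_def)
  show ?thesis
  proof (rule projective_base_change[OF to_loc_hom loc_mod_module[OF F] loc_mod_unit[OF F]])
    fix N :: "(('r \<times> 'r) set, 'u) module" and f
    assume "module L N" "f \<in> mod_hom R F (restr to_loc N)"
    from loc_mod_extend[OF F this]
    show "\<exists>g\<in>mod_hom L (loc_mod R S F) N.
      \<forall>y\<in>carrier F. g (pure_tensor R (loc_ring_mod R S) F \<one>\<^bsub>L\<^esub> y) = f y" by metis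
  next
    fix N :: "(('r \<times> 'r) set, 'u) module" and f g
    assume "module L N" "f \<in> mod_hom L (loc_mod R S F) N" "g \<in> mod_hom L (loc_mod R S F) N"
      "\<forall>y\<in>carrier F. f (pure_tensor R (loc_ring_mod R S) F \<one>\<^bsub>L\<^esub> y)
        = g (pure_tensor R (loc_ring_mod R S) F \<one>\<^bsub>L\<^esub> y)"
    then show "\<forall>x\<in>carrier (loc_mod R S F). f x = g x" using loc_mod_hom_eqI[OF F] by blast
  next
    fix M N :: "(('r \<times> 'r) set, 'u) module" and g f
    assume M: "module L M" and N: "module L N"
      and g: "g \<in> mod_hom L M N" "g ` carrier M = carrier N"
      and f: "f \<in> mod_hom R F (restr to_loc N)"
    interpret M: module L M by (rule M)
    interpret N: module L N by (rule N)
    show "\<exists>h\<in>mod_hom R F (restr to_loc M). \<forall>y\<in>carrier F. g (h y) = f y"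
    proof (rule strongly_flat_lift[OF sf to_loc_hom M N g f], rule tower_solvable_divisible)
      let ?H = "{x \<in> carrier M. g x = \<zero>\<^bsub>N\<^esub>}"
      fix n y assume "y \<in> carrier ((restr to_loc M)\<lparr>carrier := ?H\<rparr>)"
      then have y: "y \<in> carrier M" "g y = \<zero>\<^bsub>N\<^esub>" by auto
      have q: "loc_frac R S \<one> (sq n) \<in> carrier L" by (simp add: loc_closed)
      let ?z = "loc_frac R S \<one> (sq n) \<odot>\<^bsub>M\<^esub> y"
      have "?z \<in> ?H" using y q by (simp add: mod_hom_smult[OF g(1)])
      moreover have "to_loc (sq n) \<odot>\<^bsub>M\<^esub> ?z = y"
        using y q to_loc_inv[OF sq_S[of n]] 
        by (simp add: M.smult_assoc1[symmetric] to_loc_closed M.R.m_comm)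
      ultimately show "\<exists>z\<in>carrier ((restr to_loc M)\<lparr>carrier := ?H\<rparr>).
          sq n \<odot>\<^bsub>(restr to_loc M)\<lparr>carrier := ?H\<rparr>\<^esub> z = y"
        by (intro bexI[of _ ?z]) auto
    qed
  qed
qed

end

section \<open>Splitting off a free module modulo an element\<close>

lemma (in abelian_group) add_diff_cancel:
  assumes "x \<in> carrier G" "y \<in> carrier G" shows "y \<oplus> (x \<ominus> y) = x"
proof -
  have "y \<oplus> (x \<ominus> y) = x \<oplus> (y \<ominus> y)" using assms by (simp add: a_minus_def a_lcomm)
  then show ?thesis using assms by (simp add: a_minus_def r_neg)
qed

lemma free_cover_hom_eqI:
  assumes "module R A" "module R M"
    and "f \<in> mod_hom R (free_cover R A) M" "g \<in> mod_hom R (free_cover R A) M"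
    and "\<And>a. a \<in> carrier A \<Longrightarrow> f (free_basis R a) = g (free_basis R a)"
    and "\<phi> \<in> carrier (free_cover R A)"
  shows "f \<phi> = g \<phi>"
  using cring.free_hom_eqI[OF module.axioms(1)[OF assms(1)] assms(2)
      assms(3,4)[unfolded free_cover_def] assms(5) assms(6)[unfolded free_cover_def]] .

lemma syz_diff:
  assumes "module R F" "p \<in> carrier (free_cover R F)" "q \<in> carrier (free_cover R F)"
    "cover_map R F p = cover_map R F q"
  shows "p \<ominus>\<^bsub>free_cover R F\<^esub> q \<in> carrier (syz R F)"
proof -
  interpret F: module R F by fact
  interpret P: module R "free_cover R F" by (rule free_cover_module) fact
  show ?thesis
    using assms mod_hom_closed[OF cover_map_hom[OF assms(1)]]
    by (simp add: syz_simps mod_hom_minus[OF P.module_axioms assms(1) cover_map_hom[OF assms(1)]]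
        F.diff_eq_zero_iff)
qed

text \<open>
  A section of \<open>P/sP \<rightarrow> F/sF\<close> gives for each basis element \<open>[x]\<close> a \<open>k \<in> K\<close> such that \<open>[x] - k\<close> represents
  the image of \<open>x\<close>; let \<open>r\<close> send \<open>[x]\<close> to \<open>k\<close>. Then \<open>p - r p\<close> represents the image of the class of \<open>p\<close> in
  \<open>F/sF\<close> for all \<open>p\<close>, by linearity, so for \<open>p \<in> K\<close> it lies in \<open>sP\<close>. By flatness \<open>sP \<inter> K = sK\<close>.
\<close>

lemma split_mod_element:
  fixes F :: "('r, 'f) module" and i :: "('f \<Rightarrow> 'r) \<Rightarrow> 'u" and j :: "'r \<Rightarrow> 'u"
  assumes flat: "flat_mod R F TYPE('u)" and s: "s \<in> carrier R"
    and proj: "projective_mod (R Quot (PIdl\<^bsub>R\<^esub> s)) (red_mod R F s) TYPE('u)"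
    and i: "inj i" and j: "inj j"
  obtains r where "r \<in> mod_hom R (free_cover R F) (syz R F)"
    "\<And>k. k \<in> carrier (syz R F) \<Longrightarrow> \<exists>d\<in>carrier (syz R F). s \<odot>\<^bsub>free_cover R F\<^esub> d = k \<ominus>\<^bsub>free_cover R F\<^esub> r k"
proof -
  have F: "module R F" using flat by (simp add: flat_mod_def)
  let ?P = "free_cover R F" and ?K = "syz R F" and ?\<pi> = "cover_map R F"
  have P: "module R ?P" by (rule free_cover_module[OF F])
  have K: "module R ?K" by (rule syz_module[OF F])
  interpret F: module R F by (rule F)
  interpret P: module R ?P by (rule P)
  note \<pi> = cover_map_hom[OF F]
  let ?Rs = "R Quot (PIdl\<^bsub>R\<^esub> s)" and ?\<phi> = "\<lambda>a. PIdl\<^bsub>R\<^esub> s +>\<^bsub>R\<^esub> a"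
  let ?PS = "red_mod R ?P s" and ?FS = "red_mod R F s"
  let ?cP = "\<lambda>x. (\<lambda>x. s \<odot>\<^bsub>?P\<^esub> x) ` carrier ?P +>\<^bsub>?P\<^esub> x" and ?cF = "\<lambda>x. (\<lambda>x. s \<odot>\<^bsub>F\<^esub> x) ` carrier F +>\<^bsub>F\<^esub> x"
  note PSm = red_mod_module[OF P s] and FSm = red_mod_module[OF F s]
  note SP = sF_submodule[OF P s] and SF = sF_submodule[OF F s]
  note \<phi> = red_ring_hom[OF F s]
  note cP = red_unit[OF P s] and cF = red_unit[OF F s]
  obtain g where g: "g \<in> mod_hom ?Rs ?PS ?FS" "\<And>p. p \<in> carrier ?P \<Longrightarrow> g (?cP p) = ?cF (?\<pi> p)"
    using red_mod_extend[OF P s FSm mod_hom_comp[OF \<pi> cF]] by blast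
  have "g ` carrier ?PS = (\<lambda>p. ?cF (?\<pi> p)) ` carrier ?P"
    unfolding red_mod_simps(1)[OF P s] image_image by (rule image_cong[OF refl g(2)])
  also have "\<dots> = ?cF ` (?\<pi> ` carrier ?P)" by (simp add: image_image)
  also have "\<dots> = carrier ?FS"
    unfolding cover_map_onto[OF F] red_mod_simps(1)[OF F s] ..
  finally have onto: "g ` carrier ?PS = carrier ?FS" .
  have inj: "inj_on (\<lambda>X. i (inv_into (carrier ?P) ?cP X)) (carrier ?PS)"
    unfolding red_mod_simps(1)[OF P s]
    by (rule inj_onI) (metis i injD inv_into_injective)
  have idF: "(\<lambda>x. x) \<in> mod_hom ?Rs ?FS ?FS" by (auto simp: mod_hom_def)
  obtain h where h: "h \<in> mod_hom ?Rs ?FS ?PS" "\<And>X. X \<in> carrier ?FS \<Longrightarrow> g (h X) = X"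
    using projective_lift_small[OF proj PSm FSm g(1) onto idF inj] by blast
  have "\<exists>k\<in>carrier ?K. ?cP (free_basis R x \<ominus>\<^bsub>?P\<^esub> k) = h (?cF x)" if x: "x \<in> carrier F" for x
  proof -
    have cx: "?cF x \<in> carrier ?FS" using x by (simp add: red_mod_simps(1)[OF F s])
    then obtain p where p: "p \<in> carrier ?P" "h (?cF x) = ?cP p"
      using mod_hom_closed[OF h(1) cx] unfolding red_mod_simps(1)[OF P s] by blast
    have \<pi>p: "?\<pi> p \<in> carrier F" using mod_hom_closed[OF \<pi> p(1)] .
    have "?cF x = ?cF (?\<pi> p)" using h(2)[OF cx] g(2)[OF p(1)] p(2) by simp
    then obtain y where y: "y \<in> carrier F" "x \<ominus>\<^bsub>F\<^esub> ?\<pi> p = s \<odot>\<^bsub>F\<^esub> y"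
      using F.coset_eq_iff[OF SF x \<pi>p] by blast
    obtain p' where p': "p' \<in> carrier ?P" "y = ?\<pi> p'" using y(1) cover_map_onto[OF F] by blast
    \<comment> \<open>The representative \<open>p\<close> maps to \<open>x\<close> only modulo \<open>sF\<close>; correcting it by \<open>s p'\<close> makes it exact.\<close>
    let ?q = "p \<oplus>\<^bsub>?P\<^esub> s \<odot>\<^bsub>?P\<^esub> p'" and ?e = "free_basis R x"
    have e: "?e \<in> carrier ?P" unfolding free_cover_def by (rule F.R.free_basis_closed[OF x])
    have q: "?q \<in> carrier ?P" using p p' s by simp
    have "?\<pi> ?q = ?\<pi> p \<oplus>\<^bsub>F\<^esub> (x \<ominus>\<^bsub>F\<^esub> ?\<pi> p)"
      unfolding y(2) p'(2) using p p' s by (simp add: mod_hom_add[OF \<pi>] mod_hom_smult[OF \<pi>])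
    also have "\<dots> = x" using x \<pi>p by (simp add: a_minus_def F.a_lcomm F.r_neg)
    finally have "?e \<ominus>\<^bsub>?P\<^esub> ?q \<in> carrier ?K"
      by (intro syz_diff[OF F e q]) (simp add: cover_map_basis[OF F x])
    moreover have "?e \<ominus>\<^bsub>?P\<^esub> (?e \<ominus>\<^bsub>?P\<^esub> ?q) = ?q"
      using e q by (simp add: a_minus_def P.minus_add P.minus_minus P.a_assoc[symmetric] P.r_neg)
    moreover have "?cP ?q = ?cP p"
    proof -
      have "?q \<ominus>\<^bsub>?P\<^esub> p = s \<odot>\<^bsub>?P\<^esub> p'"
        using p p' s by (simp add: a_minus_def P.a_ac P.r_neg P.r_neg1 P.r_neg2)
      then show ?thesis using P.coset_eq_iff[OF SP q p(1)] p'(1) by blast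
    qed
    ultimately show ?thesis using p(2) by (intro bexI[of _ "?e \<ominus>\<^bsub>?P\<^esub> ?q"]) simp_all
  qed
  then obtain \<kappa> where \<kappa>: "\<And>x. x \<in> carrier F \<Longrightarrow> \<kappa> x \<in> carrier ?K"
    "\<And>x. x \<in> carrier F \<Longrightarrow> ?cP (free_basis R x \<ominus>\<^bsub>?P\<^esub> \<kappa> x) = h (?cF x)" by metis
  let ?r = "lin_ext R ?K \<kappa>"
  have r: "?r \<in> mod_hom R ?P ?K"
    unfolding free_cover_def by (rule F.R.lin_ext_hom[OF K \<kappa>(1)])
  have rP: "?r \<in> mod_hom R ?P ?P" using mod_hom_comp[OF r syz_incl[OF F]] .
  have idP: "(\<lambda>x. x) \<in> mod_hom R ?P ?P" by (auto simp: mod_hom_def)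
  note diff = mod_hom_diff[OF P P idP rP]
  have eq: "?cP (p \<ominus>\<^bsub>?P\<^esub> ?r p) = h (?cF (?\<pi> p))" if p: "p \<in> carrier ?P" for p
  proof (rule free_cover_hom_eqI[OF F restr_module[OF F.R.is_cring \<phi> PSm] mod_hom_comp[OF diff cP]
        mod_hom_comp[OF mod_hom_comp[OF \<pi> cF] restr_hom[OF \<phi> h(1)]] _ p])
    fix x assume x: "x \<in> carrier F"
    show "?cP (free_basis R x \<ominus>\<^bsub>?P\<^esub> ?r (free_basis R x)) = h (?cF (?\<pi> (free_basis R x)))"
      using \<kappa>(2)[OF x] F.R.lin_ext_basis[where f = \<kappa>, OF K x \<kappa>(1)] by (simp add: cover_map_basis[OF F x])
  qed
  have KP: "k \<in> carrier ?P" "?\<pi> k = \<zero>\<^bsub>F\<^esub>" if "k \<in> carrier ?K" for k using that by (simp_all add: syz_simps)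
  have "\<exists>d\<in>carrier ?K. s \<odot>\<^bsub>?P\<^esub> d = k \<ominus>\<^bsub>?P\<^esub> ?r k" if k: "k \<in> carrier ?K" for k
  proof -
    have "?cP (k \<ominus>\<^bsub>?P\<^esub> ?r k) = h \<zero>\<^bsub>?FS\<^esub>"
      using eq[OF KP(1)[OF k]] KP(2)[OF k] F.coset_zero[OF SF] by (simp add: red_mod_simps(2)[OF F s])
    also have "\<dots> = (\<lambda>x. s \<odot>\<^bsub>?P\<^esub> x) ` carrier ?P"
      using mod_hom_zero[OF FSm PSm h(1)] by (simp add: red_mod_simps(2)[OF P s])
    finally have "k \<ominus>\<^bsub>?P\<^esub> ?r k \<in> (\<lambda>x. s \<odot>\<^bsub>?P\<^esub> x) ` carrier ?P"
      using P.coset_eq_zero_iff[OF SP, of "k \<ominus>\<^bsub>?P\<^esub> ?r k"] mod_hom_closed[OF diff KP(1)[OF k]] by simp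
    then obtain p where p: "p \<in> carrier ?P" "k \<ominus>\<^bsub>?P\<^esub> ?r k = s \<odot>\<^bsub>?P\<^esub> p" by blast
    have kK: "k \<ominus>\<^bsub>?P\<^esub> ?r k \<in> carrier ?K"
      using KP[OF k] KP[OF mod_hom_closed[OF r KP(1)[OF k]]] by (intro syz_diff[OF F]) simp_all
    have "s \<odot>\<^bsub>?P\<^esub> p \<in> (\<lambda>x. s \<odot>\<^bsub>?P\<^esub> x) ` carrier ?K"
    proof (rule flat_kernel_coeffs[OF flat j F.R.cgenideal_ideal[OF s]])
      show "submodule ((\<lambda>x. s \<odot>\<^bsub>?P\<^esub> x) ` carrier ?K) R ?P"
        by (rule scale_submodule[OF P s syz_submodule[OF F]])
      show "s \<odot>\<^bsub>?P\<^esub> p \<in> carrier ?K" using kK p(2) by simp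
      fix a k assume "a \<in> PIdl\<^bsub>R\<^esub> s" and k: "k \<in> carrier ?K"
      then obtain b where b: "b \<in> carrier R" "a = b \<otimes>\<^bsub>R\<^esub> s" using PIdl_mem[OF F s] by blast
      have "a \<odot>\<^bsub>?P\<^esub> k = s \<odot>\<^bsub>?P\<^esub> (b \<odot>\<^bsub>?P\<^esub> k)"
        using b s KP(1)[OF k] by (simp add: P.smult_assoc1[symmetric] F.R.m_comm)
      then show "a \<odot>\<^bsub>?P\<^esub> k \<in> (\<lambda>x. s \<odot>\<^bsub>?P\<^esub> x) ` carrier ?K"
        using P.submoduleE(4)[OF syz_submodule[OF F] b(1) k] by blast
    next
      fix x
      have "p x \<in> carrier R" using p(1) F.R.free_mod_closed by (auto simp: free_cover_def)
      moreover have "(s \<odot>\<^bsub>?P\<^esub> p) x = p x \<otimes>\<^bsub>R\<^esub> s"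
        using s calculation by (simp add: free_cover_def free_mod_simps F.R.m_comm)
      ultimately show "(s \<odot>\<^bsub>?P\<^esub> p) x \<in> PIdl\<^bsub>R\<^esub> s" using PIdl_mem[OF F s] by blast
    qed
    then show ?thesis using p(2) by fastforce
  qed
  with r show thesis by (rule that)
qed

text \<open>
  The map \<open>t = 1 - r\<close> of the previous lemma sends \<open>K\<close> into \<open>sK\<close>. By flatness the elements of \<open>K\<close> killed by
  \<open>s\<close> are combinations of elements of \<open>K\<close> with coefficients killed by \<open>s\<close>, so \<open>t\<close> vanishes on them.
  Hence \<open>E k = t d\<close>, for any \<open>d \<in> K\<close> with \<open>s d = t k\<close>, is well-defined, and \<open>s E = t\<^sup>2\<close>. It remains to
  write \<open>1 = (1 - t\<^sup>2) + s E\<close> and to note that \<open>1 - t\<^sup>2 = r + t r\<close> extends to \<open>P\<close>.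
\<close>

lemma split_element:
  fixes F :: "('r, 'f) module" and i :: "('f \<Rightarrow> 'r) \<Rightarrow> 'u" and j :: "'r \<Rightarrow> 'u"
  assumes flat: "flat_mod R F TYPE('u)" and s: "s \<in> carrier R"
    and proj: "projective_mod (R Quot (PIdl\<^bsub>R\<^esub> s)) (red_mod R F s) TYPE('u)"
    and i: "inj i" and j: "inj j"
  obtains r E where "r \<in> mod_hom R (free_cover R F) (syz R F)" "E \<in> mod_hom R (syz R F) (syz R F)"
    "\<And>k. k \<in> carrier (syz R F) \<Longrightarrow> k = r k \<oplus>\<^bsub>free_cover R F\<^esub> s \<odot>\<^bsub>free_cover R F\<^esub> E k"
proof -
  have F: "module R F" using flat by (simp add: flat_mod_def)
  let ?P = "free_cover R F" and ?K = "syz R F"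
  have P: "module R ?P" by (rule free_cover_module[OF F])
  have K: "module R ?K" by (rule syz_module[OF F])
  interpret F: module R F by (rule F)
  interpret P: module R ?P by (rule P)
  interpret K: module R ?K by (rule K)
  obtain r where r: "r \<in> mod_hom R ?P ?K"
    and d: "\<And>k. k \<in> carrier ?K \<Longrightarrow> \<exists>d\<in>carrier ?K. s \<odot>\<^bsub>?P\<^esub> d = k \<ominus>\<^bsub>?P\<^esub> r k"
    using split_mod_element[OF assms] by blast
  have KP: "k \<in> carrier ?P" if "k \<in> carrier ?K" for k using that by (simp add: syz_simps)
  have rP: "r \<in> mod_hom R ?P ?P" using mod_hom_comp[OF r syz_incl[OF F]] .
  have idP: "(\<lambda>x. x) \<in> mod_hom R ?P ?P" by (auto simp: mod_hom_def)
  define t where "t p = p \<ominus>\<^bsub>?P\<^esub> r p" for p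
  have t: "t \<in> mod_hom R ?P ?P" unfolding t_def by (rule mod_hom_diff[OF P P idP rP])
  have tK: "t k \<in> carrier ?K" if "k \<in> carrier ?K" for k
  proof -
    have "r k \<in> carrier ?P" "cover_map R F (r k) = \<zero>\<^bsub>F\<^esub>"
      using mod_hom_closed[OF r KP[OF that]] by (simp_all add: syz_simps)
    moreover have "cover_map R F k = \<zero>\<^bsub>F\<^esub>" using that by (simp add: syz_simps)
    ultimately show ?thesis unfolding t_def by (intro syz_diff[OF F KP[OF that]]) simp_all
  qed
  have Kops: "add ?K = add ?P" "zero ?K = zero ?P" "smult ?K = smult ?P" by (simp_all add: syz_simps)
  have tKh: "t \<in> mod_hom R ?K ?K"
    using tK KP mod_hom_add[OF t] mod_hom_smult[OF t] by (intro mod_homI) (simp_all add: Kops)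
  have torsion: "t k = \<zero>\<^bsub>?P\<^esub>" if k: "k \<in> carrier ?K" and sk: "s \<odot>\<^bsub>?P\<^esub> k = \<zero>\<^bsub>?P\<^esub>" for k
  proof -
    define I where "I = {a \<in> carrier R. a \<otimes>\<^bsub>R\<^esub> s = \<zero>\<^bsub>R\<^esub>}"
    have I: "ideal I R"
    proof (rule idealI)
      show "ring R" by (rule F.R.ring_axioms)
      show "subgroup I (add_monoid R)"
        by (rule F.R.add.subgroupI)
          (use s in \<open>auto simp: I_def F.R.l_distr F.R.l_minus a_inv_def[symmetric]\<close>)
      fix a x assume a: "a \<in> I" and x: "x \<in> carrier R"
      have "x \<otimes>\<^bsub>R\<^esub> (a \<otimes>\<^bsub>R\<^esub> s) = \<zero>\<^bsub>R\<^esub>" using a x by (simp add: I_def)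
      then show "x \<otimes>\<^bsub>R\<^esub> a \<in> I" "a \<otimes>\<^bsub>R\<^esub> x \<in> I"
        using a x s by (simp_all add: I_def F.R.m_assoc F.R.m_comm[of a x])
    qed
    have "k \<in> {p \<in> carrier ?P. t p = \<zero>\<^bsub>?P\<^esub>}"
    proof (rule flat_kernel_coeffs[OF flat j I kernel_submodule[OF P P t] _ k])
      fix a k assume a: "a \<in> I" and k: "k \<in> carrier ?K"
      obtain d' where d': "d' \<in> carrier ?K" "s \<odot>\<^bsub>?P\<^esub> d' = t k" using d[OF k] by (auto simp: t_def)
      have aR: "a \<in> carrier R" "a \<otimes>\<^bsub>R\<^esub> s = \<zero>\<^bsub>R\<^esub>" using a by (auto simp: I_def)
      have "t (a \<odot>\<^bsub>?P\<^esub> k) = (a \<otimes>\<^bsub>R\<^esub> s) \<odot>\<^bsub>?P\<^esub> d'"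
        using aR(1) s KP[OF k] KP[OF d'(1)] d'(2) by (simp add: mod_hom_smult[OF t] P.smult_assoc1)
      then show "a \<odot>\<^bsub>?P\<^esub> k \<in> {p \<in> carrier ?P. t p = \<zero>\<^bsub>?P\<^esub>}" using aR KP k d' by simp
    next
      fix x
      have kx: "k x \<in> carrier R"
        using KP[OF k] F.R.free_mod_closed by (auto simp: free_cover_def)
      have "s \<otimes>\<^bsub>R\<^esub> k x = \<zero>\<^bsub>R\<^esub>" using fun_cong[OF sk, of x] by (simp add: free_cover_def free_mod_simps)
      then show "k x \<in> I" using kx s by (simp add: I_def F.R.m_comm)
    qed
    then show ?thesis by simp
  qed
  define G where "G k c \<longleftrightarrow> k \<in> carrier ?K \<and> (\<exists>d\<in>carrier ?K. s \<odot>\<^bsub>?P\<^esub> d = t k \<and> c = t d)" for k c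
  obtain E where E: "E \<in> mod_hom R ?K ?K" "\<And>k c. G k c \<Longrightarrow> E k = c"
  proof (rule linear_relation_hom[OF K K, of G])
    show "k \<in> carrier ?K \<and> c \<in> carrier ?K" if "G k c" for k c using that tK by (auto simp: G_def)
    show "\<exists>c. G k c" if "k \<in> carrier ?K" for k
      using d[OF that] that unfolding G_def t_def[symmetric] by blast
    fix k c assume "G k c"
    then obtain d where d: "k \<in> carrier ?K" "d \<in> carrier ?K" "s \<odot>\<^bsub>?P\<^esub> d = t k" "c = t d"
      unfolding G_def by blast
    show "G (a \<odot>\<^bsub>?K\<^esub> k) (a \<odot>\<^bsub>?K\<^esub> c)" if a: "a \<in> carrier R" for a
    proof -
      have "s \<odot>\<^bsub>?P\<^esub> (a \<odot>\<^bsub>?P\<^esub> d) = a \<odot>\<^bsub>?P\<^esub> t k" unfolding d(3)[symmetric]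
        using a s KP[OF d(2)] by (simp add: P.smult_assoc1[symmetric] F.R.m_comm)
      then show ?thesis unfolding G_def Kops
        using a d(1,2,4) K.smult_closed[OF a] KP
        by (intro conjI bexI[of _ "a \<odot>\<^bsub>?P\<^esub> d"]) (simp_all add: mod_hom_smult[OF t] Kops)
    qed
    fix k' c' assume "G k' c'"
    then obtain d' where d': "k' \<in> carrier ?K" "d' \<in> carrier ?K" "s \<odot>\<^bsub>?P\<^esub> d' = t k'" "c' = t d'"
      unfolding G_def by blast
    have "s \<odot>\<^bsub>?P\<^esub> (d \<oplus>\<^bsub>?P\<^esub> d') = t k \<oplus>\<^bsub>?P\<^esub> t k'"
      using s KP[OF d(2)] KP[OF d'(2)] d(3) d'(3) by (simp add: P.smult_r_distr)
    then show "G (k \<oplus>\<^bsub>?K\<^esub> k') (c \<oplus>\<^bsub>?K\<^esub> c')" unfolding G_def Kops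
      using d(1,2,4) d'(1,2,4) K.add.m_closed[unfolded monoid.simps partial_object.simps] KP
      by (intro conjI bexI[of _ "d \<oplus>\<^bsub>?P\<^esub> d'"]) (simp_all add: mod_hom_add[OF t] Kops)
  next
    fix c assume "G \<zero>\<^bsub>?K\<^esub> c"
    then obtain d where "d \<in> carrier ?K" "s \<odot>\<^bsub>?P\<^esub> d = t \<zero>\<^bsub>?P\<^esub>" "c = t d"
      unfolding G_def Kops by blast
    then show "c = \<zero>\<^bsub>?K\<^esub>" using torsion mod_hom_zero[OF P P t] by (simp add: Kops)
  qed blast
  define r' where "r' p = r p \<oplus>\<^bsub>?P\<^esub> t (r p)" for p
  have r': "r' \<in> mod_hom R ?P ?K"
    using mod_hom_plus[OF P K r mod_hom_comp[OF r tKh]] by (simp add: r'_def[abs_def] Kops)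
  have "k = r' k \<oplus>\<^bsub>?P\<^esub> s \<odot>\<^bsub>?P\<^esub> E k" if k: "k \<in> carrier ?K" for k
  proof -
    obtain d' where d': "d' \<in> carrier ?K" "s \<odot>\<^bsub>?P\<^esub> d' = t k" using d[OF k] by (auto simp: t_def)
    have "E k = t d'" by (rule E(2)) (use k d' in \<open>auto simp: G_def\<close>)
    then have sE: "s \<odot>\<^bsub>?P\<^esub> E k = t (t k)"
      using mod_hom_smult[OF t s KP[OF d'(1)]] d'(2) by simp
    have rk: "r k \<in> carrier ?P" and kP: "k \<in> carrier ?P"
      using mod_hom_closed[OF rP] KP k by auto
    have tc: "t x \<in> carrier ?P" if "x \<in> carrier ?P" for x using mod_hom_closed[OF t that] .
    have dec: "x = r x \<oplus>\<^bsub>?P\<^esub> t x" if "x \<in> carrier ?P" for x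
      using that mod_hom_closed[OF rP that] by (simp add: t_def a_minus_def P.a_lcomm P.r_neg)
    have "k = r k \<oplus>\<^bsub>?P\<^esub> t (r k \<oplus>\<^bsub>?P\<^esub> t k)" using dec[OF kP] by simp
    also have "\<dots> = r k \<oplus>\<^bsub>?P\<^esub> (t (r k) \<oplus>\<^bsub>?P\<^esub> t (t k))"
      using rk tc[OF kP] by (simp add: mod_hom_add[OF t])
    also have "\<dots> = r' k \<oplus>\<^bsub>?P\<^esub> s \<odot>\<^bsub>?P\<^esub> E k"
      unfolding sE r'_def using rk tc kP by (simp add: P.a_assoc)
    finally show ?thesis .
  qed
  with r' E(1) show thesis by (rule that)
qed

context localization_seq
begin

section \<open>Splitting after localization\<close>

definition frac_map :: "('r, 'n) module \<Rightarrow> ('m \<Rightarrow> 'n) \<Rightarrow> ('m \<times> 'r) set \<Rightarrow> ('n \<times> 'r) set" where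
  "frac_map N f X = (\<Union>(x, t)\<in>X. frac N (f x) t)"

lemma frac_map_frac:
  assumes "module R M" "module R N" "f \<in> mod_hom R M N" "x \<in> carrier M" "s \<in> S"
  shows "frac_map N f (frac M x s) = frac N (f x) s"
  unfolding frac_map_def
proof (rule frac_UN[OF assms(1,4,5)])
  fix y t u assume y: "y \<in> carrier M" "t \<in> S" "u \<in> S" "(u \<otimes> t) \<odot>\<^bsub>M\<^esub> x = (u \<otimes> s) \<odot>\<^bsub>M\<^esub> y"
  have "f ((u \<otimes> t) \<odot>\<^bsub>M\<^esub> x) = f ((u \<otimes> s) \<odot>\<^bsub>M\<^esub> y)" using y(4) by simp
  then have "(u \<otimes> s) \<odot>\<^bsub>N\<^esub> f y = (u \<otimes> t) \<odot>\<^bsub>N\<^esub> f x"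
    using y(1-3) assms(4,5) by (simp add: mod_hom_smult[OF assms(3)])
  then show "frac N (f y) t = frac N (f x) s"
    using y assms(4,5) mod_hom_closed[OF assms(3)] by (subst frac_eq_iff[OF assms(2)]) auto
qed

lemma frac_map_hom:
  assumes M: "module R M" and N: "module R N" and f: "f \<in> mod_hom R M N"
  shows "frac_map N f \<in> mod_hom L (frac_mod M) (frac_mod N)"
proof -
  interpret M: module R M by (rule M)
  note fm = frac_map_frac[OF M N f] and fc = mod_hom_closed[OF f]
  show ?thesis
  proof (rule mod_homI)
    fix X assume "X \<in> carrier (frac_mod M)"
    then obtain x s where X: "x \<in> carrier M" "s \<in> S" "X = frac M x s" by (auto simp: frac_mod_carrier[OF M])
    show "frac_map N f X \<in> carrier (frac_mod N)" using X by (auto simp: fm fc intro!: frac_closed[OF N])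
    {
      fix Y assume "Y \<in> carrier (frac_mod M)"
      then obtain y t where "y \<in> carrier M" "t \<in> S" "Y = frac M y t" by (auto simp: frac_mod_carrier[OF M])
      then show "frac_map N f (X \<oplus>\<^bsub>frac_mod M\<^esub> Y) = frac_map N f X \<oplus>\<^bsub>frac_mod N\<^esub> frac_map N f Y"
        using X by (simp add: fm fc frac_add[OF M] frac_add[OF N] mod_hom_add[OF f] mod_hom_smult[OF f])
    }
    fix q assume "q \<in> carrier L"
    then obtain a t where "a \<in> carrier R" "t \<in> S" "q = loc_frac R S a t" by (auto simp: loc_carrier)
    then show "frac_map N f (q \<odot>\<^bsub>frac_mod M\<^esub> X) = q \<odot>\<^bsub>frac_mod N\<^esub> frac_map N f X"
      using X by (simp add: fm fc frac_loc_smult[OF M] frac_loc_smult[OF N] mod_hom_smult[OF f])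
  qed
qed

lemma frac_unit:
  assumes M: "module R M"
  shows "(\<lambda>x. frac M x \<one>) \<in> mod_hom R M (restr to_loc (frac_mod M))"
proof -
  interpret M: module R M by (rule M)
  show ?thesis
    by (intro mod_homI) (auto simp: frac_add_same[OF M] to_loc_def frac_loc_smult[OF M] intro: frac_closed[OF M])
qed

text \<open>
  The map from \<open>S\<^sup>-\<^sup>1F\<close> to \<open>S\<^sup>-\<^sup>1P\<close> that splits \<open>S\<^sup>-\<^sup>1P \<rightarrow> S\<^sup>-\<^sup>1F\<close>, restricted to \<open>F\<close>. Both \<open>S\<^sup>-\<^sup>1P\<close> and the
  target \<open>S\<^sup>-\<^sup>1F\<close> are taken as modules of fractions, where it is visible when an element is zero.
\<close>

lemma localized_section:
  fixes F :: "('r, 'f) module" and i :: "('f \<Rightarrow> 'r) \<times> 'r \<Rightarrow> 'u"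
  assumes F: "module R F" and proj: "projective_mod L (loc_mod R S F) TYPE('u)" and i: "inj i"
  obtains \<sigma> where "\<sigma> \<in> mod_hom R F (restr to_loc (frac_mod (free_cover R F)))"
    "\<And>y. y \<in> carrier F \<Longrightarrow> frac_map F (cover_map R F) (\<sigma> y) = frac F y \<one>"
proof -
  let ?P = "free_cover R F" and ?\<pi> = "cover_map R F"
  note P = free_cover_module[OF F] and \<pi> = cover_map_hom[OF F]
  note FP = frac_mod_module[OF P] and FF = frac_mod_module[OF F]
  note g = frac_map_hom[OF P F \<pi>]
  have onto: "frac_map F ?\<pi> ` carrier (frac_mod ?P) = carrier (frac_mod F)"
  proof
    show "frac_map F ?\<pi> ` carrier (frac_mod ?P) \<subseteq> carrier (frac_mod F)"
      using mod_hom_closed[OF g] by blast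
    show "carrier (frac_mod F) \<subseteq> frac_map F ?\<pi> ` carrier (frac_mod ?P)"
    proof
      fix X assume "X \<in> carrier (frac_mod F)"
      then obtain x s where X: "x \<in> carrier F" "s \<in> S" "X = frac F x s" by (auto simp: frac_mod_carrier[OF F])
      then obtain p where "p \<in> carrier ?P" "x = ?\<pi> p" using cover_map_onto[OF F] by blast
      then show "X \<in> frac_map F ?\<pi> ` carrier (frac_mod ?P)"
        using X frac_map_frac[OF P F \<pi>, of p s] frac_closed[OF P, of p s] by (metis imageI)
    qed
  qed
  let ?c = "\<lambda>(p, s). frac ?P p s"
  have inj: "inj_on (\<lambda>X. i (inv_into (carrier ?P \<times> S) ?c X)) (carrier (frac_mod ?P))"
  proof (rule inj_onI)
    fix X Y assume "X \<in> carrier (frac_mod ?P)" "Y \<in> carrier (frac_mod ?P)"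
      and eq: "i (inv_into (carrier ?P \<times> S) ?c X) = i (inv_into (carrier ?P \<times> S) ?c Y)"
    then have "X \<in> ?c ` (carrier ?P \<times> S)" "Y \<in> ?c ` (carrier ?P \<times> S)"
      by (auto simp: frac_mod_def)
    then show "X = Y" using injD[OF i eq] inv_into_injective by metis
  qed
  obtain f where f: "f \<in> mod_hom L (loc_mod R S F) (frac_mod F)"
    "\<And>y. y \<in> carrier F \<Longrightarrow> f (pure_tensor R (loc_ring_mod R S) F \<one>\<^bsub>L\<^esub> y) = frac F y \<one>"
    using loc_mod_extend[OF F FF frac_unit[OF F]] by blast
  obtain h where h: "h \<in> mod_hom L (loc_mod R S F) (frac_mod ?P)"
    "\<And>X. X \<in> carrier (loc_mod R S F) \<Longrightarrow> frac_map F ?\<pi> (h X) = f X"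
    using projective_lift_small[OF proj FP FF g onto f(1) inj] by blast
  show thesis
  proof (rule that)
    show "(\<lambda>y. h (pure_tensor R (loc_ring_mod R S) F \<one>\<^bsub>L\<^esub> y)) \<in> mod_hom R F (restr to_loc (frac_mod ?P))"
      by (rule mod_hom_comp[OF loc_mod_unit[OF F] restr_hom[OF to_loc_hom h(1)]])
    show "frac_map F ?\<pi> (h (pure_tensor R (loc_ring_mod R S) F \<one>\<^bsub>L\<^esub> y)) = frac F y \<one>"
      if "y \<in> carrier F" for y
      using f(2)[OF that] h(2) mod_hom_closed[OF loc_mod_unit[OF F] that] by simp
  qed
qed

text \<open>
  For \<open>p \<in> P\<close> the fraction \<open>p/1 - \<sigma>(\<pi> p)\<close> maps to zero in \<open>S\<^sup>-\<^sup>1F\<close>, so it is \<open>k / part n\<close> with \<open>k \<in> K\<close>; put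
  \<open>v p = w n k\<close>. Enlarging the denominator replaces \<open>k\<close> by \<open>sq n k\<close> and \<open>n\<close> by \<open>n + 1\<close>, which does not
  change the value, by compatibility of the family.
\<close>

lemma extend_compatible_family:
  fixes F :: "('r, 'f) module" and w :: "nat \<Rightarrow> ('f \<Rightarrow> 'r) \<Rightarrow> 'c"
  assumes F: "module R F" and C: "module R C"
    and \<sigma>: "\<sigma> \<in> mod_hom R F (restr to_loc (frac_mod (free_cover R F)))"
      "\<And>y. y \<in> carrier F \<Longrightarrow> frac_map F (cover_map R F) (\<sigma> y) = frac F y \<one>"
    and w: "\<And>n. w n \<in> mod_hom R (syz R F) C"
      "\<And>n k. k \<in> carrier (syz R F) \<Longrightarrow> w n k = sq n \<odot>\<^bsub>C\<^esub> w (Suc n) k"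
  obtains v where "v \<in> mod_hom R (free_cover R F) C" "\<And>k. k \<in> carrier (syz R F) \<Longrightarrow> v k = w 0 k"
proof -
  let ?P = "free_cover R F" and ?K = "syz R F" and ?\<pi> = "cover_map R F"
  let ?X = "frac_mod (free_cover R F)"
  note P = free_cover_module[OF F] and K = syz_module[OF F] and \<pi> = cover_map_hom[OF F]
  interpret F: module R F by (rule F)
  interpret P: module R ?P by (rule P)
  interpret K: module R ?K by (rule K)
  interpret C: module R C by (rule C)
  interpret X: module L ?X by (rule frac_mod_module[OF P])
  interpret Y: module L "frac_mod F" by (rule frac_mod_module[OF F])
  note RX = restr_module[OF is_cring to_loc_hom X.module_axioms]
  have \<sigma>c: "\<sigma> y \<in> carrier ?X" if "y \<in> carrier F" for y using mod_hom_closed[OF \<sigma>(1) that] by simp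
  have Kops: "add ?K = add ?P" "zero ?K = zero ?P" "smult ?K = smult ?P" by (simp_all add: syz_simps)
  have KP: "k \<in> carrier ?P" "?\<pi> k = \<zero>\<^bsub>F\<^esub>" if "k \<in> carrier ?K" for k using that by (simp_all add: syz_simps)
  note pc = mod_hom_closed[OF \<pi>] and fcl = frac_closed[OF P]
  define Q where "Q p c n k \<longleftrightarrow> p \<in> carrier ?P \<and> k \<in> carrier ?K \<and>
    frac ?P p \<one> = \<sigma> (?\<pi> p) \<oplus>\<^bsub>?X\<^esub> frac ?P k (part n) \<and> c = w n k" for p c n k
  obtain v where v: "v \<in> mod_hom R ?P C" "\<And>p c n k. Q p c n k \<Longrightarrow> v p = c"
  proof (rule fraction_relation_hom[OF P C K, of Q])
    fix p c n k assume "Q p c n k"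
    then have Q: "p \<in> carrier ?P" "k \<in> carrier ?K"
      "frac ?P p \<one> = \<sigma> (?\<pi> p) \<oplus>\<^bsub>?X\<^esub> frac ?P k (part n)" "c = w n k" by (auto simp: Q_def)
    show "p \<in> carrier ?P \<and> c \<in> carrier C \<and> k \<in> carrier ?K" using Q mod_hom_closed[OF w(1)] by blast
    have "frac ?P (sq n \<odot>\<^bsub>?P\<^esub> k) (part (Suc n)) = frac ?P k (part n)"
      using frac_expand[OF P KP(1)[OF Q(2)], of "part n" "sq n"] by (simp add: m_comm)
    moreover have "w (Suc n) (sq n \<odot>\<^bsub>?P\<^esub> k) = c"
      using mod_hom_smult[OF w(1) _ Q(2), of "sq n" "Suc n"] w(2)[OF Q(2), of n] Q(4) by (simp add: Kops)
    ultimately show "Q p c (Suc n) (sq n \<odot>\<^bsub>?K\<^esub> k)"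
      unfolding Q_def Kops using Q K.smult_closed[OF _ Q(2), of "sq n"] by (simp add: Kops)
    show "Q (r \<odot>\<^bsub>?P\<^esub> p) (r \<odot>\<^bsub>C\<^esub> c) n (r \<odot>\<^bsub>?K\<^esub> k)" if r: "r \<in> carrier R" for r
    proof -
      have sm: "to_loc r \<odot>\<^bsub>?X\<^esub> frac ?P x t = frac ?P (r \<odot>\<^bsub>?P\<^esub> x) t" if "x \<in> carrier ?P" "t \<in> S" for x t
        using that r by (simp add: to_loc_def frac_loc_smult[OF P])
      have "frac ?P (r \<odot>\<^bsub>?P\<^esub> p) \<one> = to_loc r \<odot>\<^bsub>?X\<^esub> (\<sigma> (?\<pi> p) \<oplus>\<^bsub>?X\<^esub> frac ?P k (part n))"
        unfolding Q(3)[symmetric] using sm[OF Q(1) one_S] by simp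
      also have "\<dots> = \<sigma> (?\<pi> (r \<odot>\<^bsub>?P\<^esub> p)) \<oplus>\<^bsub>?X\<^esub> frac ?P (r \<odot>\<^bsub>?P\<^esub> k) (part n)"
        using Q(1) KP(1)[OF Q(2)] r mod_hom_smult[OF \<sigma>(1) r pc[OF Q(1)]]
        by (simp add: X.smult_r_distr to_loc_closed \<sigma>c pc fcl sm mod_hom_smult[OF \<pi>])
      finally show ?thesis unfolding Q_def
        using Q r K.smult_closed[OF r Q(2)] mod_hom_smult[OF w(1) r Q(2)] by (simp add: Kops)
    qed
    fix p' c' k' assume "Q p' c' n k'"
    then have Q': "p' \<in> carrier ?P" "k' \<in> carrier ?K"
      "frac ?P p' \<one> = \<sigma> (?\<pi> p') \<oplus>\<^bsub>?X\<^esub> frac ?P k' (part n)" "c' = w n k'" by (auto simp: Q_def)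
    have "frac ?P (p \<oplus>\<^bsub>?P\<^esub> p') \<one> = frac ?P p \<one> \<oplus>\<^bsub>?X\<^esub> frac ?P p' \<one>"
      using Q(1) Q'(1) by (simp add: frac_add_same[OF P])
    also have "\<dots> = (\<sigma> (?\<pi> p) \<oplus>\<^bsub>?X\<^esub> \<sigma> (?\<pi> p')) \<oplus>\<^bsub>?X\<^esub> (frac ?P k (part n) \<oplus>\<^bsub>?X\<^esub> frac ?P k' (part n))"
      unfolding Q(3) Q'(3) using Q(1) Q'(1) KP(1)[OF Q(2)] KP(1)[OF Q'(2)]
      by (simp add: X.M.a_ac \<sigma>c pc fcl)
    also have "\<dots> = \<sigma> (?\<pi> (p \<oplus>\<^bsub>?P\<^esub> p')) \<oplus>\<^bsub>?X\<^esub> frac ?P (k \<oplus>\<^bsub>?P\<^esub> k') (part n)"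
      using Q(1) Q'(1) KP(1)[OF Q(2)] KP(1)[OF Q'(2)] mod_hom_add[OF \<sigma>(1) pc[OF Q(1)] pc[OF Q'(1)]]
      by (simp add: frac_add_same[OF P] mod_hom_add[OF \<pi>])
    finally show "Q (p \<oplus>\<^bsub>?P\<^esub> p') (c \<oplus>\<^bsub>C\<^esub> c') n (k \<oplus>\<^bsub>?K\<^esub> k')"
      unfolding Q_def using Q Q' K.M.a_closed[OF Q(2) Q'(2)] mod_hom_add[OF w(1) Q(2) Q'(2)]
      by (simp add: Kops)
  next
    fix p assume p: "p \<in> carrier ?P"
    let ?z = "frac ?P p \<one> \<ominus>\<^bsub>?X\<^esub> \<sigma> (?\<pi> p)"
    have zc: "?z \<in> carrier ?X" using p by (simp add: fcl \<sigma>c pc)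
    then obtain p' u where z: "p' \<in> carrier ?P" "u \<in> S" "?z = frac ?P p' u"
      by (auto simp: frac_mod_carrier[OF P])
    have "frac_map F ?\<pi> ?z = \<zero>\<^bsub>frac_mod F\<^esub>"
      using p \<sigma>(2)[OF pc[OF p]] frac_closed[OF F pc[OF p] one_S]
      by (simp add: mod_hom_minus[OF X.module_axioms Y.module_axioms frac_map_hom[OF P F \<pi>]] fcl \<sigma>c pc
          frac_map_frac[OF P F \<pi>] Y.diff_eq_zero_iff)
    then have "frac F (?\<pi> p') u = frac F \<zero>\<^bsub>F\<^esub> \<one>"
      unfolding z(3) using z(1,2) by (simp add: frac_map_frac[OF P F \<pi>] frac_mod_zero[OF F])
    then obtain u' where u': "u' \<in> S" "u' \<odot>\<^bsub>F\<^esub> ?\<pi> p' = \<zero>\<^bsub>F\<^esub>"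
      using z(1,2) pc by (auto simp: frac_eq_iff[OF F])
    \<comment> \<open>The denominator \<open>u' u\<close> is a term of the sequence, so it divides \<open>part (m + 1)\<close>.\<close>
    obtain m where m: "sq m = u' \<otimes> u" using sq_often[of "u' \<otimes> u"] u'(1) z(2) by auto
    let ?k = "part m \<odot>\<^bsub>?P\<^esub> (u' \<odot>\<^bsub>?P\<^esub> p')"
    have k: "?k \<in> carrier ?K"
      using u' z(1) by (simp add: syz_simps mod_hom_smult[OF \<pi>])
    have "frac ?P ?k (part (Suc m)) = frac ?P p' u"
      using frac_expand[OF P, of "u' \<odot>\<^bsub>?P\<^esub> p'" "u' \<otimes> u" "part m"] frac_expand[OF P z(1,2) u'(1)] u'(1) z(1,2)
      by (simp add: m)
    then have "frac ?P p \<one> = \<sigma> (?\<pi> p) \<oplus>\<^bsub>?X\<^esub> frac ?P ?k (part (Suc m))"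
      unfolding z(3)[symmetric] using X.M.add_diff_cancel[OF fcl[OF p one_S] \<sigma>c[OF pc[OF p]]] by simp
    then show "\<exists>c n k. Q p c n k" unfolding Q_def using p k by blast
  next
    fix c n k assume "Q \<zero>\<^bsub>?P\<^esub> c n k"
    then have k: "k \<in> carrier ?K" and "frac ?P \<zero>\<^bsub>?P\<^esub> \<one> = \<sigma> (?\<pi> \<zero>\<^bsub>?P\<^esub>) \<oplus>\<^bsub>?X\<^esub> frac ?P k (part n)"
      by (auto simp: Q_def)
    then have "frac ?P k (part n) = frac ?P \<zero>\<^bsub>?P\<^esub> \<one>"
      using mod_hom_zero[OF F RX \<sigma>(1)] mod_hom_zero[OF P F \<pi>] KP(1)[OF k] by (simp add: fcl)
    then show "\<exists>u\<in>S. u \<odot>\<^bsub>?K\<^esub> k = \<zero>\<^bsub>?K\<^esub>"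
      using KP(1)[OF k] by (auto simp: frac_eq_iff[OF P] Kops)
  next
    fix c n assume "Q \<zero>\<^bsub>?P\<^esub> c n \<zero>\<^bsub>?K\<^esub>"
    then show "c = \<zero>\<^bsub>C\<^esub>" using mod_hom_zero[OF K C w(1)] by (simp add: Q_def)
  qed blast
  have "v k = w 0 k" if k: "k \<in> carrier ?K" for k
    using KP[OF k] k mod_hom_zero[OF F RX \<sigma>(1)] by (intro v(2)[of _ _ 0 k]) (simp add: Q_def fcl)
  with v(1) show thesis by (rule that)
qed

section \<open>The converse\<close>

text \<open>
  In the proof \<open>G n\<close> and \<open>y n\<close> satisfy the same recursion with the inhomogeneous term \<open>f n\<close>, the
  former on \<open>K\<close> and the latter on \<open>P\<close>, so their difference \<open>w n\<close> is a compatible family.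
\<close>

lemma strongly_flat_if_split:
  fixes F :: "('r, 'f) module"
  assumes F: "module R F"
    and split: "\<And>s. s \<in> S \<Longrightarrow> \<exists>r\<in>mod_hom R (free_cover R F) (syz R F). \<exists>E\<in>mod_hom R (syz R F) (syz R F).
      \<forall>k\<in>carrier (syz R F). k = r k \<oplus>\<^bsub>free_cover R F\<^esub> s \<odot>\<^bsub>free_cover R F\<^esub> E k"
    and \<sigma>: "\<sigma> \<in> mod_hom R F (restr to_loc (frac_mod (free_cover R F)))"
      "\<And>y. y \<in> carrier F \<Longrightarrow> frac_map F (cover_map R F) (\<sigma> y) = frac F y \<one>"
  shows "strongly_flat R S F U"
  unfolding strongly_flat_def
proof (intro conjI F allI impI)
  let ?P = "free_cover R F" and ?K = "syz R F"
  fix C :: "('r, 'u) module"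
  assume wc: "weakly_cotorsion R S C"
  then have C: "module R C" by (simp add: weakly_cotorsion_def)
  have tower: "tower_solvable sq C" using wc Ext1_tower_solvable[OF C] by (simp add: weakly_cotorsion_def)
  note P = free_cover_module[OF F] and K = syz_module[OF F]
  interpret P: module R ?P by (rule P)
  interpret C: module R C by (rule C)
  have Kops: "add ?K = add ?P" "zero ?K = zero ?P" "smult ?K = smult ?P" by (simp_all add: syz_simps)
  obtain r E where r: "\<And>s. s \<in> S \<Longrightarrow> r s \<in> mod_hom R ?P ?K" and E: "\<And>s. s \<in> S \<Longrightarrow> E s \<in> mod_hom R ?K ?K"
    and rE: "\<And>s k. s \<in> S \<Longrightarrow> k \<in> carrier ?K \<Longrightarrow> k = r s k \<oplus>\<^bsub>?P\<^esub> s \<odot>\<^bsub>?P\<^esub> E s k"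
    using split by metis
  show "Ext1_vanishes R F C"
    unfolding Ext1_vanishes_iff[OF F C]
  proof
    fix g assume g: "g \<in> mod_hom R ?K C"
    \<comment> \<open>Divide \<open>g\<close> repeatedly by the terms of the sequence, up to maps that extend to \<open>P\<close>.\<close>
    define G where "G = rec_nat g (\<lambda>n \<gamma> k. \<gamma> (E (sq n) k))"
    have G0: "G 0 = g" and GS: "G (Suc n) = (\<lambda>k. G n (E (sq n) k))" for n by (simp_all add: G_def)
    have G: "G n \<in> mod_hom R ?K C" for n
      by (induction n) (simp_all add: G0 GS g mod_hom_comp[OF E[OF sq_S]])
    define f where "f n p = G n (r (sq n) p)" for n p
    have f: "f n \<in> mod_hom R ?P C" for n unfolding f_def by (rule mod_hom_comp[OF r G]) simp
    have Gf: "G n k = f n k \<oplus>\<^bsub>C\<^esub> sq n \<odot>\<^bsub>C\<^esub> G (Suc n) k" if k: "k \<in> carrier ?K" for n k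
    proof -
      have rk: "r (sq n) k \<in> carrier ?K" and Ek: "E (sq n) k \<in> carrier ?K"
        using mod_hom_closed[OF r] mod_hom_closed[OF E] k by (auto simp: syz_simps)
      have "G n k = G n (r (sq n) k \<oplus>\<^bsub>?K\<^esub> sq n \<odot>\<^bsub>?K\<^esub> E (sq n) k)"
        using rE[OF sq_S k, of n] by (simp add: Kops)
      also have "\<dots> = f n k \<oplus>\<^bsub>C\<^esub> sq n \<odot>\<^bsub>C\<^esub> G (Suc n) k"
        using rk Ek module.smult_closed[OF K, of "sq n"]
        by (simp add: mod_hom_add[OF G] mod_hom_smult[OF G] f_def GS)
      finally show ?thesis .
    qed
    define e where "e = (free_basis R :: 'f \<Rightarrow> 'f \<Rightarrow> 'r)"
    have e: "e a \<in> carrier ?P" if "a \<in> carrier F" for a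
      unfolding e_def free_cover_def using that by (rule free_basis_closed)
    have ex: "\<exists>x. \<forall>n. x n \<in> carrier C \<and> x n = f n (e a) \<oplus>\<^bsub>C\<^esub> sq n \<odot>\<^bsub>C\<^esub> x (Suc n)"
      if a: "a \<in> carrier F" for a
      using tower[unfolded tower_solvable_def, rule_format, of "\<lambda>n. f n (e a)"]
        mod_hom_closed[OF f e[OF a]] by blast
    define x where "x a = (SOME x. \<forall>n. x n \<in> carrier C \<and> x n = f n (e a) \<oplus>\<^bsub>C\<^esub> sq n \<odot>\<^bsub>C\<^esub> x (Suc n))" for a
    have x: "x a n \<in> carrier C \<and> x a n = f n (e a) \<oplus>\<^bsub>C\<^esub> sq n \<odot>\<^bsub>C\<^esub> x a (Suc n)" if "a \<in> carrier F" for a n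
      using someI_ex[OF ex[OF that]] unfolding x_def[symmetric] by (rule spec)
    define y where "y n = lin_ext R C (\<lambda>a. x a n)" for n
    have y: "y n \<in> mod_hom R ?P C" for n
      unfolding y_def free_cover_def by (rule lin_ext_hom[OF C]) (use x in blast)
    have ye: "y n (e a) = x a n" if "a \<in> carrier F" for n a
      unfolding y_def e_def by (rule lin_ext_basis[OF C that]) (use x in blast)
    have yf: "y n p = f n p \<oplus>\<^bsub>C\<^esub> sq n \<odot>\<^bsub>C\<^esub> y (Suc n) p" if p: "p \<in> carrier ?P" for n p
    proof (rule free_cover_hom_eqI[OF F C y mod_hom_plus[OF P C f mod_hom_scale[OF P C y sq_closed]] _ p])
      fix a assume a: "a \<in> carrier F"
      show "y n (free_basis R a) = f n (free_basis R a) \<oplus>\<^bsub>C\<^esub> sq n \<odot>\<^bsub>C\<^esub> y (Suc n) (free_basis R a)"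
        unfolding e_def[symmetric] ye[OF a] using conjunct2[OF x[OF a]] .
    qed
    define w where "w n k = G n k \<ominus>\<^bsub>C\<^esub> y n k" for n k
    have w: "w n \<in> mod_hom R ?K C" for n
      unfolding w_def by (rule mod_hom_diff[OF K C G syz_restrict_hom[OF y]])
    have ws: "w n k = sq n \<odot>\<^bsub>C\<^esub> w (Suc n) k" if k: "k \<in> carrier ?K" for n k
    proof -
      have kP: "k \<in> carrier ?P" using k by (simp add: syz_simps)
      note cl = mod_hom_closed[OF f kP] mod_hom_closed[OF y kP] mod_hom_closed[OF G k]
      have "w n k = (f n k \<oplus>\<^bsub>C\<^esub> sq n \<odot>\<^bsub>C\<^esub> G (Suc n) k) \<ominus>\<^bsub>C\<^esub> (f n k \<oplus>\<^bsub>C\<^esub> sq n \<odot>\<^bsub>C\<^esub> y (Suc n) k)"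
        unfolding w_def using Gf[OF k, of n] yf[OF kP, of n] by simp
      also have "\<dots> = sq n \<odot>\<^bsub>C\<^esub> G (Suc n) k \<ominus>\<^bsub>C\<^esub> sq n \<odot>\<^bsub>C\<^esub> y (Suc n) k"
        using cl by (simp add: a_minus_def C.minus_add C.a_ac C.r_neg1 C.r_neg2)
      also have "\<dots> = sq n \<odot>\<^bsub>C\<^esub> w (Suc n) k"
        unfolding w_def using cl by (simp add: C.smult_minus_distr)
      finally show ?thesis .
    qed
    obtain v where v: "v \<in> mod_hom R ?P C" "\<And>k. k \<in> carrier ?K \<Longrightarrow> v k = w 0 k"
      using extend_compatible_family[OF F C \<sigma> w ws] by blast
    have "v k \<oplus>\<^bsub>C\<^esub> y 0 k = g k" if k: "k \<in> carrier ?K" for k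
    proof -
      have kP: "k \<in> carrier ?P" using k by (simp add: syz_simps)
      show ?thesis
        using mod_hom_closed[OF g k] mod_hom_closed[OF y kP, of 0]
        by (simp add: v(2)[OF k] w_def G0 a_minus_def C.a_assoc C.l_neg)
    qed
    then show "\<exists>h\<in>mod_hom R ?P C. \<forall>k\<in>carrier ?K. h k = g k"
      by (intro bexI[OF _ mod_hom_plus[OF P C v(1) y[of 0]]] ballI)
  qed
qed

end

text \<open>
  The free cover of \<open>F\<close> consists of functions \<open>'f \<Rightarrow> 'r\<close>. The graph of a function is a set of pairs, and
  an infinite type contains a copy of its square.
\<close>

lemma inj_functions_into_universe:
  fixes univ :: "('r + 'f + nat) set \<Rightarrow> 'u"
  assumes "inj univ"
  obtains i :: "('f \<Rightarrow> 'r) \<times> 'r \<Rightarrow> 'u" where "inj i"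
proof -
  let ?D = "UNIV :: ('r + 'f + nat) set"
  have "infinite ?D"
  proof
    assume "finite ?D"
    moreover have "inj (\<lambda>n :: nat. Inr (Inr n) :: 'r + 'f + nat)" by (simp add: inj_def)
    ultimately show False
      using finite_imageD finite_subset[of "range (\<lambda>n. Inr (Inr n))" ?D] infinite_UNIV_nat by blast
  qed
  then have "(card_of (?D \<times> ?D), card_of ?D) \<in> ordIso" by (rule card_of_Times_same_infinite)
  then obtain j where j: "bij_betw j (?D \<times> ?D) ?D" using card_of_ordIso by blast
  define enc where "enc = (\<lambda>(\<phi> :: 'f \<Rightarrow> 'r, a :: 'r).
    range (\<lambda>x. (Inr (Inl x), Inl (\<phi> x)) :: ('r + 'f + nat) \<times> ('r + 'f + nat))
      \<union> {(Inr (Inr 0), Inl a)})"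
  have enc: "inj enc"
  proof (rule injI, clarify)
    fix \<phi> \<psi> :: "'f \<Rightarrow> 'r" and a b :: 'r assume eq: "enc (\<phi>, a) = enc (\<psi>, b)"
    have mem: "(Inr (Inl x), Inl c) \<in> enc (\<chi>, d) \<longleftrightarrow> c = \<chi> x" "(Inr (Inr 0), Inl c) \<in> enc (\<chi>, d) \<longleftrightarrow> c = d"
      for x c \<chi> d by (auto simp: enc_def)
    show "\<phi> = \<psi> \<and> a = b" using mem eq by (metis ext)
  qed
  have "inj (\<lambda>p. univ (j ` enc p))"
  proof (rule injI)
    fix p q assume "univ (j ` enc p) = univ (j ` enc q)"
    then have "j ` enc p = j ` enc q" by (rule injD[OF assms])
    moreover have "inj j" using j by (simp add: bij_betw_def)
    ultimately show "p = q" using inj_image_eq_iff injD[OF enc] by metis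
  qed
  then show thesis by (rule that)
qed

section \<open>The characterization of strongly flat modules\<close>

theorem theorem1p3:
  fixes R :: "('r, 'k) ring_scheme" and S :: "'r set" and F :: "('r, 'f) module"
    and univ :: "('r + 'f + nat) set \<Rightarrow> 'u"
  assumes "cring R"
    and "submonoid S R" and "countable S"
    and "inj univ"
    and "flat_mod R F TYPE('u)"
  shows "strongly_flat R S F TYPE('u) \<longleftrightarrow>
    (\<forall>s\<in>S. projective_mod (R Quot (PIdl\<^bsub>R\<^esub> s)) (red_mod R F s) TYPE('u)) \<and>
    projective_mod (loc_ring R S) (loc_mod R S F) TYPE('u)"
proof -
  interpret localization R S using assms(1,2) by (simp add: localization_def localization_axioms_def)
  obtain sq where "localization_seq R S sq" using localization_seq_exists[OF assms(3)] .
  then interpret localization_seq R S sq .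
  have F: "module R F" using assms(5) by (simp add: flat_mod_def)
  obtain i :: "('f \<Rightarrow> 'r) \<times> 'r \<Rightarrow> 'u" where i: "inj i" using inj_functions_into_universe[OF assms(4)] .
  \<comment> \<open>Fixing one component gives the injections needed for \<open>P\<close> and for \<open>R\<close>.\<close>
  have i1: "inj (\<lambda>\<phi>. i (\<phi>, undefined))" and i2: "inj (\<lambda>a. i (undefined, a))"
    using i by (auto simp: inj_def)
  show ?thesis
  proof
    assume "strongly_flat R S F TYPE('u)"
    then show "(\<forall>s\<in>S. projective_mod (R Quot (PIdl\<^bsub>R\<^esub> s)) (red_mod R F s) TYPE('u)) \<and>
      projective_mod (loc_ring R S) (loc_mod R S F) TYPE('u)"
      using strongly_flat_reduction strongly_flat_localization by blast
  next
    assume *: "(\<forall>s\<in>S. projective_mod (R Quot (PIdl\<^bsub>R\<^esub> s)) (red_mod R F s) TYPE('u)) \<and>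
      projective_mod (loc_ring R S) (loc_mod R S F) TYPE('u)"
    obtain \<sigma> where \<sigma>: "\<sigma> \<in> mod_hom R F (restr to_loc (frac_mod (free_cover R F)))"
      "\<And>y. y \<in> carrier F \<Longrightarrow> frac_map F (cover_map R F) (\<sigma> y) = frac F y \<one>\<^bsub>R\<^esub>"
      using localized_section[OF F conjunct2[OF *] i] by blast
    show "strongly_flat R S F TYPE('u)"
    proof (rule strongly_flat_if_split[OF F _ \<sigma>])
      fix s assume s: "s \<in> S"
      then have "projective_mod (R Quot (PIdl\<^bsub>R\<^esub> s)) (red_mod R F s) TYPE('u)" using * by blast
      from split_element[OF assms(5) S_closed[OF s] this i1 i2]
      show "\<exists>r\<in>mod_hom R (free_cover R F) (syz R F). \<exists>E\<in>mod_hom R (syz R F) (syz R F).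
        \<forall>k\<in>carrier (syz R F). k = r k \<oplus>\<^bsub>free_cover R F\<^esub> s \<odot>\<^bsub>free_cover R F\<^esub> E k" by metis
    qed
  qed
qed

end
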